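(* With the parameters $\omega,\nu,\epsilon,g$, the derived quantities $\kappa,g_0$, the energy $E$, the space $\Lambda_0$ and the infimum $I(\epsilon,\kappa)$ as in the context, let $$J=\inf\left\{\frac12\int_{\mathbb R}t^2p(t)^2dt+\frac{g_0}2\int_{\mathbb R}p(t)^4dt:\ p\in L^2(\mathbb R)\cap L^4(\mathbb R)\text{ real-valued},\ \|p\|_{L^2(\mathbb R)}=1\right\}.$$ Then $$\lim_{(\epsilon,\,\epsilon^{1/3}\kappa^{-1})\to(0,0)}\ \frac{I(\epsilon,\kappa)-\frac{\kappa^2}{8\pi}}{\epsilon^{2/3}}=J .$$ In addition, if $u$ is a minimizer of $I(\epsilon,\kappa)$, i.e. $u\in\Lambda_0$, $\|u\|_{L^2}=1$, $E(u)=I(\epsilon,\kappa)$, then, as $(\epsilon,\epsilon^{1/3}\kappa^{-1})\to(0,0)$, $$\frac1{\epsilon^{1/3}}\left|u\left(\frac{x_1}{\epsilon^{2/3}},x_2\right)\right|\longrightarrow 2^{1/4}e^{-\pi x_2^2}\,p(x_1)\qquad\text{in }L^2(\mathbb R^2)\cap L^4(\mathbb R^2),$$ where $p$ is the (unique nonnegative) minimizer of $J$.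
   Context: Parameters: $g>0$ is fixed; $\omega,\nu,\epsilon$ are real with $\nu\ge0$, $\epsilon>0$, $\omega^2+\nu^2+\epsilon^2=1$ and $\omega\ge\omega_0$ for some fixed $\omega_0>0$. Set $$\alpha=\sqrt{\nu^4+4\omega^2},\quad \mu_2=(1+\omega^2+\alpha)^{1/2},\quad \beta_2=\frac{2\omega\mu_2}{\alpha+2\omega^2+\nu^2},\quad\gamma=\frac{2\alpha}{\omega},$$ $$\kappa_1^2=(2\nu^2+\epsilon^2)\Bigl(1+\frac{2\nu^2}{\alpha-\nu^2+2\omega^2}\Bigr)\ (\kappa_1>0),\quad g_1=g\,\frac{\alpha+2\omega^2+\nu^2}{2\alpha},\quad \kappa=\frac{\kappa_1}{\beta_2},\quad g_0=\frac{g_1\gamma^2}{4\beta_2}.$$ Under these assumptions $\kappa$ is bounded and $g_0$ is bounded above and away from $0$. The limits are along such parameters. Since $J$ and $p$ depend on $g_0$, which itself depends on $(\omega,\nu,\epsilon)$, the limits are understood as: the difference between the left-hand quantity and $J$ (resp. the $L^2$ and $L^4$ norms of the difference of the two functions) tends to $0$, with $J$, $p$ taken at the current value of $g_0$. $\Lambda_0=\{u\in L^2(\mathbb R^2):\ u(x_1,x_2)=f(z)e^{-\pi|z|^2/2},\ f \text{ entire},\ z=x_1+ix_2\}$. The energy is $$E(u)=\int_{\mathbb R^2}\Bigl(\tfrac12(\epsilon^2x_1^2+\kappa^2x_2^2)|u|^2+\tfrac{g_0}{2}|u|^4\Bigr)dx,$$ and $I(\epsilon,\kappa)=\inf\{E(u):u\in\Lambda_0,\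 \|u\|_{L^2(\mathbb R^2)}=1\}$. Energies may take the value $+\infty$. *)

theory Defs
  imports "HOL-Analysis.Analysis"
begin

subsection \<open>Parameters\<close>

definition alpha :: "real \<Rightarrow> real \<Rightarrow> real" where
  "alpha \<omega> \<nu> = sqrt (\<nu>^4 + 4 * \<omega>\<^sup>2)"

definition mu2 :: "real \<Rightarrow> real \<Rightarrow> real" where
  "mu2 \<omega> \<nu> = sqrt (1 + \<omega>\<^sup>2 + alpha \<omega> \<nu>)"

definition beta2 :: "real \<Rightarrow> real \<Rightarrow> real" where
  "beta2 \<omega> \<nu> = 2 * \<omega> * mu2 \<omega> \<nu> / (alpha \<omega> \<nu> + 2 * \<omega>\<^sup>2 + \<nu>\<^sup>2)"

definition gamma :: "real \<Rightarrow> real \<Rightarrow> real" where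
  "gamma \<omega> \<nu> = 2 * alpha \<omega> \<nu> / \<omega>"

definition kappa1 :: "real \<Rightarrow> real \<Rightarrow> real \<Rightarrow> real" where
  "kappa1 \<omega> \<nu> \<epsilon> =
     sqrt ((2 * \<nu>\<^sup>2 + \<epsilon>\<^sup>2) * (1 + 2 * \<nu>\<^sup>2 / (alpha \<omega> \<nu> - \<nu>\<^sup>2 + 2 * \<omega>\<^sup>2)))"

definition g1 :: "real \<Rightarrow> real \<Rightarrow> real \<Rightarrow> real" where
  "g1 g \<omega> \<nu> = g * ((alpha \<omega> \<nu> + 2 * \<omega>\<^sup>2 + \<nu>\<^sup>2) / (2 * alpha \<omega> \<nu>))"

definition kappa :: "real \<Rightarrow> real \<Rightarrow> real \<Rightarrow> real" where
  "kappa \<omega> \<nu> \<epsilon> = kappa1 \<omega> \<nu> \<epsilon> / beta2 \<omega> \<nu>"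

definition g0 :: "real \<Rightarrow> real \<Rightarrow> real \<Rightarrow> real" where
  "g0 g \<omega> \<nu> = g1 g \<omega> \<nu> * (gamma \<omega> \<nu>)\<^sup>2 / (4 * beta2 \<omega> \<nu>)"

definition admissible :: "real \<Rightarrow> (real \<times> real \<times> real) set" where
  "admissible \<omega>\<^sub>0 = {(\<omega>, \<nu>, \<epsilon>). 0 \<le> \<nu> \<and> 0 < \<epsilon> \<and> \<omega>\<^sup>2 + \<nu>\<^sup>2 + \<epsilon>\<^sup>2 = 1 \<and> \<omega>\<^sub>0 \<le> \<omega>}"

text \<open>The limit \<open>(\<epsilon>, \<epsilon>\<^bsup>1/3\<^esup> / \<kappa>) \<rightarrow> (0, 0)\<close> along admissible parameters. It is uniform in
  \<open>(\<omega>, \<nu>, \<epsilon>)\<close>: an event holds eventually iff, for some \<open>\<delta> > 0\<close>, it holds for all admissible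
  \<open>(\<omega>, \<nu>, \<epsilon>)\<close> for which \<open>(\<epsilon>, \<epsilon>\<^bsup>1/3\<^esup> / \<kappa>)\<close> is within \<open>\<delta>\<close> of the origin.\<close>

definition limit_regime :: "real \<Rightarrow> (real \<times> real \<times> real) filter" where
  "limit_regime \<omega>\<^sub>0 =
     inf (filtercomap (\<lambda>(\<omega>, \<nu>, \<epsilon>). (\<epsilon>, \<epsilon> powr (1/3) / kappa \<omega> \<nu> \<epsilon>)) (nhds (0, 0)))
         (principal (admissible \<omega>\<^sub>0))"

subsection \<open>Lebesgue spaces\<close>

text \<open>Elements are Borel functions rather than classes modulo null sets; \<open>Lnorm\<close> is only
  meaningful on members of \<open>Lspace\<close>.\<close>

definition Lspace :: "nat \<Rightarrow> ('a::euclidean_space \<Rightarrow> 'b::real_normed_vector) set" where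
  "Lspace q = {u \<in> borel_measurable lborel. integrable lborel (\<lambda>x. norm (u x) ^ q)}"

definition Lnorm :: "nat \<Rightarrow> ('a::euclidean_space \<Rightarrow> 'b::real_normed_vector) \<Rightarrow> real" where
  "Lnorm q u = root q (LINT x|lborel. norm (u x) ^ q)"

subsection \<open>The lowest Landau level problem\<close>

text \<open>Each class in \<open>\<Lambda>\<^sub>0\<close> is represented by its unique continuous member.\<close>

definition Lambda0 :: "(real \<times> real \<Rightarrow> complex) set" where
  "Lambda0 = {u \<in> Lspace 2. \<exists>f. f holomorphic_on UNIV \<and>
     (\<forall>x1 x2. u (x1, x2) =
        f (Complex x1 x2) * of_real (exp (- pi * (cmod (Complex x1 x2))\<^sup>2 / 2)))}"

definition energy :: "real \<Rightarrow> real \<Rightarrow> real \<Rightarrow> (real \<times> real \<Rightarrow> complex) \<Rightarrow> ennreal" where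
  "energy \<epsilon> \<kappa> g\<^sub>0 u = (\<integral>\<^sup>+(x1, x2). ennreal
     (1/2 * (\<epsilon>\<^sup>2 * x1\<^sup>2 + \<kappa>\<^sup>2 * x2\<^sup>2) * (cmod (u (x1, x2)))\<^sup>2
       + g\<^sub>0 / 2 * cmod (u (x1, x2)) ^ 4) \<partial>lborel)"

definition I_inf :: "real \<Rightarrow> real \<Rightarrow> real \<Rightarrow> ennreal" where
  "I_inf \<epsilon> \<kappa> g\<^sub>0 = (INF u \<in> {u \<in> Lambda0. Lnorm 2 u = 1}. energy \<epsilon> \<kappa> g\<^sub>0 u)"

definition I_minimizer :: "real \<Rightarrow> real \<Rightarrow> real \<Rightarrow> (real \<times> real \<Rightarrow> complex) \<Rightarrow> bool" where
  "I_minimizer \<epsilon> \<kappa> g\<^sub>0 u \<longleftrightarrow>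
     u \<in> Lambda0 \<and> Lnorm 2 u = 1 \<and> energy \<epsilon> \<kappa> g\<^sub>0 u = I_inf \<epsilon> \<kappa> g\<^sub>0"

subsection \<open>The one-dimensional problem\<close>

definition J_energy :: "real \<Rightarrow> (real \<Rightarrow> real) \<Rightarrow> ennreal" where
  "J_energy g\<^sub>0 p = ennreal (1/2) * (\<integral>\<^sup>+t. ennreal (t\<^sup>2 * (p t)\<^sup>2) \<partial>lborel)
     + ennreal (g\<^sub>0 / 2) * (\<integral>\<^sup>+t. ennreal (p t ^ 4) \<partial>lborel)"

definition J_inf :: "real \<Rightarrow> ennreal" where
  "J_inf g\<^sub>0 = (INF p \<in> {p \<in> Lspace 2 \<inter> Lspace 4. Lnorm 2 p = 1}. J_energy g\<^sub>0 p)"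

definition J_nonneg_minimizer :: "real \<Rightarrow> (real \<Rightarrow> real) \<Rightarrow> bool" where
  "J_nonneg_minimizer g\<^sub>0 p \<longleftrightarrow>
     p \<in> Lspace 2 \<inter> Lspace 4 \<and> Lnorm 2 p = 1 \<and> J_energy g\<^sub>0 p = J_inf g\<^sub>0 \<and>
     (AE t in lborel. 0 \<le> p t)"

subsection \<open>The rescaled profile\<close>

definition profile_error ::
    "real \<Rightarrow> (real \<times> real \<Rightarrow> complex) \<Rightarrow> (real \<Rightarrow> real) \<Rightarrow> real \<times> real \<Rightarrow> real" where
  "profile_error \<epsilon> u p = (\<lambda>(x1, x2).
     1 / \<epsilon> powr (1/3) * cmod (u (x1 / \<epsilon> powr (2/3), x2))
       - 2 powr (1/4) * exp (- pi * x2\<^sup>2) * p x1)"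

end

theory Submission
  imports Defs "HOL-Probability.Distributions" "HOL-Complex_Analysis.Cauchy_Integral_Formula"
    "HOL-Real_Asymp.Real_Asymp"
begin

text \<open>
  Multiplying the holomorphic factor of a lowest Landau level function \<open>u\<close> by
  \<open>exp (- pi z\<^sup>2 / 2)\<close> gives \<open>|u (x, y)|\<^sup>2 = |F (x + i y)|\<^sup>2 exp (- 2 pi y\<^sup>2)\<close> with \<open>F\<close> entire.
  So \<open>|u|\<close> is a function of \<open>x\<close> times the Gaussian of the limit profile exactly when \<open>|F|\<close> does
  not depend on \<open>y\<close>, and \<open>|F'|\<close> bounds the derivative of \<open>|F|\<close> in \<open>y\<close>. The Laplacian of \<open>|F|\<^sup>2\<close> is \<open>4 |F'|\<^sup>2\<close>;
  integrating \<open>y\<^sup>2 |u|\<^sup>2\<close> by parts therefore gives \<open>1 / (4 pi)\<close> plus \<open>1 / (4 pi\<^sup>2)\<close> times the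
  integral of \<open>|F'|\<^sup>2 exp (- 2 pi y\<^sup>2)\<close>. This is the origin of the term \<open>\<kappa>\<^sup>2 / (8 pi)\<close>, and whatever the
  potential \<open>\<kappa>\<^sup>2 y\<^sup>2 / 2\<close> costs beyond it pays for \<open>F'\<close>. The inequality that is needed,
  \<open>strip_mass_derivative_le_variance\<close>, is obtained from Gaussian averages of \<open>|F|\<^sup>2\<close> instead of an
  integration by parts, so that all integrands are nonnegative and nothing has to be known about
  \<open>F\<close> at infinity.

  The rest of the energy, \<open>\<epsilon>\<^sup>2 x\<^sup>2 |u|\<^sup>2 / 2 + G |u|\<^sup>4 / 2\<close> with \<open>G\<close> the coupling constant, is a convex
  quadratic functional of the density \<open>|u|\<^sup>2\<close>, and so is the one-dimensional energy, whose minimizer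
  is the Thomas--Fermi density \<open>p\<^sup>2 = (T\<^sup>2 - t\<^sup>2)\<^sub>+ / (2 G)\<close>. Completing the square around a
  minimizer leaves the squared \<open>L\<^sup>2\<close> distance of the densities. In one dimension this gives existence,
  uniqueness and the value of \<open>J\<close> at once (\<open>J_energy_ge\<close>). In the plane the same computation works
  after the weight \<open>exp (- 2 pi y\<^sup>2)\<close> in the linear term has been traded for
  \<open>\<surd>2 exp (- 4 pi y\<^sup>2)\<close>, which has the same mass; by a Poincare type inequality in \<open>y\<close> the price is
  again controlled by \<open>F'\<close> (\<open>strip_weight_comparison\<close>). With \<open>L = \<epsilon>\<^bsup>2/3\<^esup>\<close> and \<open>R\<close> the square of the
  limit profile in unscaled variables, \<open>energy_lower_bound\<close> reads
  \<open>E u \<ge> \<kappa>\<^sup>2 / (8 pi) + L J - 2 pi\<^sup>2 T\<^sup>4 L\<^sup>2 / \<kappa>\<^sup>2 + (G / 2) \<parallel>|u|\<^sup>2 - R\<parallel>\<^sup>2\<close>.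
  Relative to \<open>L\<close> the loss is a constant times \<open>(\<epsilon>\<^bsup>1/3\<^esup> / \<kappa>)\<^sup>2\<close>, the quantity that tends to zero.

  For the opposite bound the profile is convolved with a Gaussian of small width \<open>\<tau>\<close>, which
  makes it entire. On the line at height \<open>y\<close> the extension is at most \<open>exp (y\<^sup>2 / (2 \<tau>\<^sup>2))\<close>
  times its values on the axis, so all integrals of the trial function factor
  (\<open>I_inf_upper_bound\<close>).

  Comparing the two bounds at a minimizer makes the rescaled densities \<open>L\<^sup>2\<close> close, hence the moduli
  \<open>L\<^sup>4\<close> close, since \<open>|a - b|\<^sup>4 \<le> (a\<^sup>2 - b\<^sup>2)\<^sup>2\<close> for nonnegative \<open>a\<close> and \<open>b\<close>. The densities
  having equal mass, they are also \<open>L\<^sup>1\<close> close, which is \<open>L\<^sup>2\<close> closeness of the moduli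
  (\<open>profile_error_bounds\<close>). Every estimate is explicit in the parameters, so that
  uniformity only requires that \<open>\<kappa>\<close> is bounded and that the coupling is bounded above and away from
  zero (\<open>parameter_bounds\<close>).
\<close>

section \<open>Gaussian integrals and rotations of the plane\<close>

lemma gaussian_eq_normal_density:
  fixes a :: real assumes "a > 0"
  shows "exp (- a * (y - m)\<^sup>2) = sqrt (pi / a) * normal_density m (sqrt (1 / (2 * a))) y"
  using assms by (simp add: normal_density_def real_sqrt_divide field_simps)

lemma has_bochner_integral_gaussian:
  fixes a :: real assumes "a > 0"
  shows "has_bochner_integral lborel (\<lambda>y. exp (- a * (y - m)\<^sup>2)) (sqrt (pi / a))"
  unfolding gaussian_eq_normal_density[OF assms]
  using has_bochner_integral_mult_right[OF normal_moment_even[of "sqrt (1/(2*a))" m 0], of "sqrt (pi/a)"] assms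
  by simp

lemma has_bochner_integral_gaussian_square:
  fixes a :: real assumes "a > 0"
  shows "has_bochner_integral lborel (\<lambda>y. y\<^sup>2 * exp (- a * y\<^sup>2)) (sqrt (pi / a) / (2 * a))"
proof -
  have "y\<^sup>2 * exp (- a * y\<^sup>2) = sqrt (pi / a) * (normal_density 0 (sqrt (1 / (2 * a))) y * (y - 0) ^ (2 * 1))" for y
    using gaussian_eq_normal_density[OF assms, of y 0] by simp
  then show ?thesis
    using has_bochner_integral_mult_right[OF normal_moment_even[of "sqrt (1/(2*a))" 0 1], of "sqrt (pi/a)"] assms
    by (simp only: fact_numeral) simp
qed

lemma nn_integral_gaussian:
  fixes a :: real assumes "a > 0"
  shows "(\<integral>\<^sup>+y. ennreal (exp (- a * (y - m)\<^sup>2)) \<partial>lborel) = ennreal (sqrt (pi / a))"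
  using has_bochner_integral_gaussian[OF assms, of m]
  by (subst nn_integral_eq_integral) (auto simp: has_bochner_integral_iff)

lemma nn_integral_gaussian_convolution:
  fixes a c :: real assumes "a > 0" "c > 0"
  shows "(\<integral>\<^sup>+w. ennreal (exp (- c * w\<^sup>2) * exp (- a * (y - w)\<^sup>2)) \<partial>lborel)
       = ennreal (sqrt (pi / (a + c)) * exp (- (a * c / (a + c)) * y\<^sup>2))"
proof -
  have ac: "a + c > 0" "a + c \<noteq> 0" using assms by auto
  have *: "exp (- c * w\<^sup>2) * exp (- a * (y - w)\<^sup>2)
      = exp (- (a * c / (a + c)) * y\<^sup>2) * exp (- (a + c) * (w - a * y / (a + c))\<^sup>2)" for w
  proof -
    have "- c * w\<^sup>2 + - a * (y - w)\<^sup>2 = - (a * c / (a + c)) * y\<^sup>2 + - (a + c) * (w - a * y / (a + c))\<^sup>2"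
      using ac(2) by (simp add: divide_simps power2_eq_square) (simp add: algebra_simps)
    then show ?thesis by (simp only: exp_add[symmetric])
  qed
  show ?thesis unfolding * ennreal_mult[OF exp_ge_zero exp_ge_zero]
    by (subst nn_integral_cmult) (use ac(1) in \<open>auto simp: nn_integral_gaussian[OF ac(1), simplified] ennreal_mult[symmetric] mult.commute\<close>)
qed

text \<open>
  A rotation factors into shears and dilations along the axes, each of which is a
  one-dimensional affine substitution under an iterated integral. A quarter turn, where this
  factorization degenerates, exchanges the axes.
\<close>

lemma nn_integral_rotation:
  fixes h :: "real \<Rightarrow> real \<Rightarrow> ennreal"
  assumes [measurable]: "case_prod h \<in> borel_measurable borel" and cs: "c\<^sup>2 + s\<^sup>2 = (1::real)"
  shows "(\<integral>\<^sup>+x. \<integral>\<^sup>+y. h (c * x - s * y) (s * x + c * y) \<partial>lborel \<partial>lborel) = (\<integral>\<^sup>+x. \<integral>\<^sup>+y. h x y \<partial>lborel \<partial>lborel)"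
proof -
  have hm[measurable]: "case_prod h \<in> borel_measurable (lborel \<Otimes>\<^sub>M lborel)"
    by (simp add: lborel_prod)
  have hm2[measurable]: "(\<lambda>x. h (f x) (g x)) \<in> borel_measurable M"
    if [measurable]: "f \<in> borel_measurable M" "g \<in> borel_measurable M" for f g :: "_ \<Rightarrow> real" and M :: "'z measure"
    using measurable_compose[of "\<lambda>x. (f x, g x)" M borel "case_prod h" borel] by auto
  show ?thesis
  proof (cases "c = 0")
    case True
    then have s: "s = 1 \<or> s = -1" using cs by (simp add: power2_eq_1_iff)
    have "(\<integral>\<^sup>+y. h y (s * x) \<partial>lborel) = (\<integral>\<^sup>+y. h (c * x - s * y) (s * x + c * y) \<partial>lborel)" for x
      using True s nn_integral_real_affine[where c="-s" and t=0 and f="\<lambda>y. h y (s * x)"] by auto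
    then have "(\<integral>\<^sup>+x. \<integral>\<^sup>+y. h (c * x - s * y) (s * x + c * y) \<partial>lborel \<partial>lborel)
        = (\<integral>\<^sup>+x. \<integral>\<^sup>+y. h y (s * x) \<partial>lborel \<partial>lborel)"
      by simp
    also have "\<dots> = (\<integral>\<^sup>+x. \<integral>\<^sup>+y. h y x \<partial>lborel \<partial>lborel)"
      using s by (subst (2) nn_integral_real_affine[where c=s and t=0]) auto
    also have "\<dots> = (\<integral>\<^sup>+x. \<integral>\<^sup>+y. h x y \<partial>lborel \<partial>lborel)"
      by (rule lborel_pair.Fubini') measurable
    finally show ?thesis .
  next
    case False
    have eq1: "c * (s / c * y + 1 / c * x) - s * y = x" for x y
      using False by (simp add: field_simps)
    have eq2: "s * (s / c * y + 1 / c * x) + c * y = s / c * x + 1 / c * y" for x y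
    proof -
      have "s * (s / c * y + 1 / c * x) + c * y = s / c * x + (s\<^sup>2 + c\<^sup>2) / c * y"
        using False by (simp add: field_simps power2_eq_square)
      then show ?thesis using cs by (simp add: add.commute)
    qed
    have "(\<integral>\<^sup>+x. \<integral>\<^sup>+y. h (c * x - s * y) (s * x + c * y) \<partial>lborel \<partial>lborel)
        = (\<integral>\<^sup>+y. \<integral>\<^sup>+x. h (c * x - s * y) (s * x + c * y) \<partial>lborel \<partial>lborel)"
      by (rule lborel_pair.Fubini') measurable
    also have "\<dots> = (\<integral>\<^sup>+y. \<integral>\<^sup>+x. ennreal \<bar>1 / c\<bar> * h x (s / c * x + 1 / c * y) \<partial>lborel \<partial>lborel)"
    proof (rule nn_integral_cong)
      fix y :: real
      show "(\<integral>\<^sup>+x. h (c * x - s * y) (s * x + c * y) \<partial>lborel) = (\<integral>\<^sup>+x. ennreal \<bar>1 / c\<bar> * h x (s / c * x + 1 / c * y) \<partial>lborel)"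
        using False
        by (subst nn_integral_real_affine[where c="1/c" and t="s/c*y"])
          (simp_all only: eq1 eq2, simp_all add: nn_integral_cmult)
    qed
    also have "\<dots> = (\<integral>\<^sup>+x. \<integral>\<^sup>+y. ennreal \<bar>1 / c\<bar> * h x (s / c * x + 1 / c * y) \<partial>lborel \<partial>lborel)"
      by (rule lborel_pair.Fubini') measurable
    also have "\<dots> = (\<integral>\<^sup>+x. \<integral>\<^sup>+y. h x y \<partial>lborel \<partial>lborel)"
    proof (rule nn_integral_cong)
      fix x :: real
      show "(\<integral>\<^sup>+y. ennreal \<bar>1 / c\<bar> * h x (s / c * x + 1 / c * y) \<partial>lborel) = (\<integral>\<^sup>+y. h x y \<partial>lborel)"
        using False nn_integral_real_affine[where c="1/c" and t="s/c*x" and f="h x"]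
        by (simp add: nn_integral_cmult)
    qed
    finally show ?thesis .
  qed
qed

section \<open>Gaussian mean values of entire functions\<close>

text \<open>
  Bessel's inequality on the circle: by the Cauchy formulas for \<open>F\<close> and for its derivative, the
  Fourier coefficients of \<open>F\<close> at the modes 0 and 1 are \<open>F z\<close> and \<open>r F' z\<close>.
\<close>

lemma circle_mean_square_lower_bound:
  fixes F :: "complex \<Rightarrow> complex"
  assumes F: "F holomorphic_on UNIV" and r: "0 \<le> r"
  shows "(\<integral>\<^sup>+t\<in>{0..1}. ennreal ((cmod (F (z + of_real r * exp (2 * of_real pi * \<i> * of_real t))))\<^sup>2) \<partial>lborel)
     \<ge> ennreal ((cmod (F z))\<^sup>2 + r\<^sup>2 * (cmod (deriv F z))\<^sup>2)"
proof -
  define e where "e t = exp (2 * of_real pi * \<i> * of_real t)" for t :: real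
  define G where "G t = F (z + of_real r * e t)" for t
  have contF: "continuous_on UNIV F" using F holomorphic_on_imp_continuous_on by blast
  have conte: "continuous_on S e" for S unfolding e_def by (intro continuous_intros)
  have contG: "continuous_on S G" for S
    unfolding G_def using contF conte by (intro continuous_on_compose2[OF contF] continuous_intros) auto
  have ne[simp]: "cmod (e t) = 1" for t by (simp add: e_def)
  have e0[simp]: "e t \<noteq> 0" for t by (simp add: e_def)
  have cnje: "cnj (e t) = 1 / e t" for t
    using complex_norm_square[of "e t"] by (simp add: field_simps)
  have G0: "(G has_integral F z) {0..1}" and G1: "((\<lambda>t. G t * cnj (e t)) has_integral (of_real r * deriv F z)) {0..1}"
  proof -
    have "(G has_integral F z) {0..1} \<and> ((\<lambda>t. G t * cnj (e t)) has_integral (of_real r * deriv F z)) {0..1}"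
    proof (cases "r = 0")
      case True
      have "((\<lambda>t. cnj (e t)) has_integral 0) {0..1}"
      proof -
        have "((\<lambda>t. exp (- (2 * of_real pi * \<i> * of_real t))) has_integral
           (- exp (- (2 * of_real pi * \<i> * of_real 1)) / (2 * of_real pi * \<i>) - (- exp (- (2 * of_real pi * \<i> * of_real 0)) / (2 * of_real pi * \<i>)))) {0..1::real}"
          by (rule fundamental_theorem_of_calculus)
             (auto intro!: derivative_eq_intros has_vector_derivative_real_field simp: field_simps)
        moreover have "cnj (e t) = exp (- (2 * of_real pi * \<i> * of_real t))" for t
          unfolding cnje by (simp add: e_def exp_minus field_simps)
        moreover have "exp (- (2 * of_real pi * \<i>)) = 1" by (simp add: exp_minus)
        ultimately show ?thesis by simp
      qed
      from has_integral_mult_right[OF this, of "F z"] show ?thesis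
        using True has_integral_const_real[of "F z" 0 1] by (simp add: G_def[abs_def])
    next
      case False
      then have r: "r > 0" using r by simp
      have vd: "vector_derivative (circlepath z r) (at t within {0..1}) = 2 * of_real pi * \<i> * of_real r * e t" if "t \<in> {0..1}" for t
        using that by (simp add: vector_derivative_circlepath01 e_def)
      have cp: "circlepath z r t = z + of_real r * e t" for t by (simp add: circlepath e_def)
      have h: "((\<lambda>u. F u / (u - z)) has_contour_integral (2 * of_real pi * \<i> * F z)) (circlepath z r)"
        by (rule Cauchy_integral_circlepath_simple) (use F r in \<open>auto intro: holomorphic_on_subset\<close>)
      have h1: "((\<lambda>u. F u / (u - z)\<^sup>2) has_contour_integral (2 * of_real pi * \<i> * deriv F z)) (circlepath z r)"
        using Cauchy_has_contour_integral_higher_derivative_circlepath[of z r F z 1] r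
          holomorphic_on_subset[OF F] continuous_on_subset[OF contF] by (simp add: numeral_2_eq_2)
      have "((\<lambda>t. 2 * of_real pi * \<i> * G t) has_integral (2 * of_real pi * \<i> * F z)) {0..1}"
        using h unfolding has_contour_integral_def
        by (rule has_integral_eq[rotated]) (use r in \<open>auto simp: vd cp G_def\<close>)
      from has_integral_mult_right[OF this, of "1 / (2 * of_real pi * \<i>)"]
      have 1: "(G has_integral F z) {0..1}" by simp
      have "((\<lambda>t. 2 * of_real pi * \<i> / of_real r * (G t * cnj (e t))) has_integral (2 * of_real pi * \<i> * deriv F z)) {0..1}"
        using h1 unfolding has_contour_integral_def
        by (rule has_integral_eq[rotated]) (use r in \<open>auto simp: vd cp G_def cnje power2_eq_square field_simps\<close>)
      note * = has_integral_mult_right[OF this, of "of_real r / (2 * of_real pi * \<i>)"]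
      have 2: "((\<lambda>t. G t * cnj (e t)) has_integral (of_real r * deriv F z)) {0..1}" 
      proof -
        have "of_real r / (2 * of_real pi * \<i>) * (2 * of_real pi * \<i> / of_real r * w) = w"
          "of_real r / (2 * of_real pi * \<i>) * (2 * of_real pi * \<i> * w) = of_real r * w" for w
          using r by (simp_all add: divide_simps mult.left_commute[of "of_real r" \<i>])
        then show ?thesis using * by (simp only:)
      qed
      show ?thesis using 1 2 by simp
    qed
    then show "(G has_integral F z) {0..1}" "((\<lambda>t. G t * cnj (e t)) has_integral (of_real r * deriv F z)) {0..1}" by auto
  qed
  define a b where "a = F z" and "b = of_real r * deriv F z"
  define f where "f t = (cmod (G t))\<^sup>2" for t
  have contf: "continuous_on S f" for S unfolding f_def by (intro continuous_intros contG)
  have fi: "f integrable_on {0..1}" by (intro integrable_continuous_interval contf)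
  have e1: "(e has_integral 0) {0..1}"
  proof -
    have "((\<lambda>t. exp (2 * of_real pi * \<i> * of_real t)) has_integral
       (exp (2 * of_real pi * \<i> * of_real 1) / (2 * of_real pi * \<i>) - exp (2 * of_real pi * \<i> * of_real 0) / (2 * of_real pi * \<i>))) {0..1::real}"
      by (rule fundamental_theorem_of_calculus)
         (auto intro!: derivative_eq_intros has_vector_derivative_real_field simp: field_simps)
    then show ?thesis by (simp add: e_def[abs_def])
  qed
  have expand: "(cmod (G t - a - b * e t))\<^sup>2
     = f t + (cmod a)\<^sup>2 + (cmod b)\<^sup>2 - 2 * Re (cnj a * G t) - 2 * Re (cnj b * (G t * cnj (e t))) + 2 * Re (cnj a * b * e t)" for t
  proof -
    have "(cmod (e t))\<^sup>2 = 1" by simp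
    then have ee: "(Re (e t))\<^sup>2 + (Im (e t))\<^sup>2 = 1" by (simp only: cmod_power2)
    have "(cmod (G t - a - b * e t))\<^sup>2
     = f t + (cmod a)\<^sup>2 + (cmod b)\<^sup>2 * ((Re (e t))\<^sup>2 + (Im (e t))\<^sup>2) - 2 * Re (cnj a * G t) - 2 * Re (cnj b * (G t * cnj (e t))) + 2 * Re (cnj a * b * e t)"
      unfolding f_def cmod_power2 by (simp add: power2_eq_square algebra_simps)
    then show ?thesis by (simp add: ee)
  qed
  have "((\<lambda>t. f t + (cmod a)\<^sup>2 + (cmod b)\<^sup>2 - 2 * Re (cnj a * G t) - 2 * Re (cnj b * (G t * cnj (e t))) + 2 * Re (cnj a * b * e t))
     has_integral (integral {0..1} f + (cmod a)\<^sup>2 + (cmod b)\<^sup>2 - 2 * Re (cnj a * a) - 2 * Re (cnj b * b) + 2 * Re (cnj a * b * 0))) {0..1}"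
    using has_integral_const_real[of "(cmod a)\<^sup>2" 0 1] has_integral_const_real[of "(cmod b)\<^sup>2" 0 1]
    by (intro has_integral_add has_integral_diff integrable_integral[OF fi] has_integral_mult_right
      has_integral_linear[OF _ bounded_linear_Re, unfolded comp_def] G0[folded a_def] G1[folded b_def] e1) auto
  then have "0 \<le> integral {0..1} f + (cmod a)\<^sup>2 + (cmod b)\<^sup>2 - 2 * Re (cnj a * a) - 2 * Re (cnj b * b) + 2 * Re (cnj a * b * 0)"
    by (rule has_integral_nonneg) (simp only: expand[symmetric] zero_le_power2)
  then have main: "(cmod a)\<^sup>2 + (cmod b)\<^sup>2 \<le> integral {0..1} f"
    unfolding cmod_power2 by (simp add: power2_eq_square)
  have "(\<integral>\<^sup>+t\<in>{0..1}. ennreal (f t) \<partial>lborel) = ennreal (integral {0..1} f)"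
    by (rule nn_integral_has_integral_lebesgue') (simp add: f_def, rule integrable_integral[OF fi])
  then show ?thesis using main
    by (simp add: f_def G_def e_def a_def b_def norm_mult power_mult_distrib ennreal_leI del: ennreal_plus)
qed

text \<open>
  A complex radius lets the parametrization start at an arbitrary point of the circle, which is how
  circles arise when the plane is averaged over all rotations.
\<close>

lemma circle_mean_square_lower_bound_complex:
  fixes F :: "complex \<Rightarrow> complex"
  assumes F: "F holomorphic_on UNIV"
  shows "(\<integral>\<^sup>+t\<in>{0..1}. ennreal ((cmod (F (z + \<zeta> * cis (2 * pi * t))))\<^sup>2) \<partial>lborel)
     \<ge> ennreal ((cmod (F z))\<^sup>2 + (cmod \<zeta>)\<^sup>2 * (cmod (deriv F z))\<^sup>2)"
proof -
  define G where "G w = F (z + \<zeta> * w)" for w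
  have G: "G holomorphic_on UNIV"
  proof -
    have "(\<lambda>w. z + \<zeta> * w) holomorphic_on UNIV" by (intro holomorphic_intros)
    from holomorphic_on_compose_gen[OF this F] show ?thesis unfolding G_def comp_def by simp
  qed
  have "(F has_field_derivative deriv F z) (at z)"
    using F by (metis UNIV_I holomorphic_derivI open_UNIV)
  then have "(G has_field_derivative deriv F z * \<zeta>) (at 0)"
    unfolding G_def by (auto intro!: derivative_eq_intros DERIV_chain2[where f=F])
  then have "deriv G 0 = deriv F z * \<zeta>" by (rule DERIV_imp_deriv)
  moreover have "cis (2 * pi * t) = exp (2 * of_real pi * \<i> * of_real t)" for t
    by (simp add: cis_conv_exp algebra_simps)
  ultimately show ?thesis
    using circle_mean_square_lower_bound[OF G, of 1 0]
    by (simp add: G_def norm_mult power_mult_distrib mult.commute)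
qed

lemma measurable_Complex[measurable]:
  assumes [measurable]: "f \<in> borel_measurable M" "g \<in> borel_measurable M"
  shows "(\<lambda>x. Complex (f x) (g x)) \<in> borel_measurable M"
  unfolding Complex_eq by measurable

text \<open>
  The Gaussian weight is invariant under rotations, so the integrand may be replaced by its mean over
  the circle through the point, to which the bound on circles applies. This replaces
  polar coordinates. The constants are the zeroth and second moments of the weight.
\<close>

lemma gaussian_mean_square_lower_bound:
  fixes F :: "complex \<Rightarrow> complex"
  assumes F: "F holomorphic_on UNIV" and c: "c > 0"
  shows "(\<integral>\<^sup>+x. \<integral>\<^sup>+y. ennreal ((cmod (F (z + Complex x y)))\<^sup>2 * exp (- c * (x\<^sup>2 + y\<^sup>2))) \<partial>lborel \<partial>lborel)
     \<ge> ennreal (pi / c * (cmod (F z))\<^sup>2 + pi / c\<^sup>2 * (cmod (deriv F z))\<^sup>2)"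
proof -
  have [measurable]: "F \<in> borel_measurable borel"
    using F by (intro borel_measurable_continuous_onI holomorphic_on_imp_continuous_on)
  define h where "h x y = ennreal ((cmod (F (z + Complex x y)))\<^sup>2 * exp (- c * (x\<^sup>2 + y\<^sup>2)))" for x y
  define I where "I = (\<integral>\<^sup>+x. \<integral>\<^sup>+y. h x y \<partial>lborel \<partial>lborel)"
  define k where "k t x y = ennreal ((cmod (F (z + Complex x y * cis (2 * pi * t))))\<^sup>2) * ennreal (exp (- c * (x\<^sup>2 + y\<^sup>2)))
      * indicator {0..1} t" for t x y
  have cism[measurable]: "(\<lambda>x. cis (f x)) \<in> borel_measurable M" if [measurable]: "f \<in> borel_measurable M" for f and M :: "'z measure"
    unfolding cis_conv_exp by measurable
  have hm: "case_prod h \<in> borel_measurable borel"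
    unfolding h_def borel_prod[symmetric] by measurable
  have rot: "(\<integral>\<^sup>+x. \<integral>\<^sup>+y. k t x y \<partial>lborel \<partial>lborel) = I * indicator {0..1} t" for t
  proof -
    have "k t x y = h (cos (2*pi*t) * x - sin (2*pi*t) * y) (sin (2*pi*t) * x + cos (2*pi*t) * y) * indicator {0..1} t" for x y
    proof -
      have 1: "Complex x y * cis (2 * pi * t) = Complex (cos (2*pi*t) * x - sin (2*pi*t) * y) (sin (2*pi*t) * x + cos (2*pi*t) * y)"
        by (simp add: complex_eq_iff algebra_simps)
      have "(C * x - S * y)\<^sup>2 + (S * x + C * y)\<^sup>2 = (S\<^sup>2 + C\<^sup>2) * (x\<^sup>2 + y\<^sup>2)" for C S :: real
        by (simp add: power2_eq_square algebra_simps)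
      then show ?thesis
        by (simp only: k_def h_def 1 sin_cos_squared_add ennreal_mult[OF zero_le_power2 exp_ge_zero] mult_1)
    qed
    moreover have "(\<integral>\<^sup>+x. \<integral>\<^sup>+y. h (cos (2*pi*t) * x - sin (2*pi*t) * y) (sin (2*pi*t) * x + cos (2*pi*t) * y) \<partial>lborel \<partial>lborel) = I"
      unfolding I_def by (rule nn_integral_rotation[OF hm]) simp
    ultimately show ?thesis
      by (cases "t \<in> {0..1}") simp_all
  qed
  have "I = (\<integral>\<^sup>+t. \<integral>\<^sup>+x. \<integral>\<^sup>+y. k t x y \<partial>lborel \<partial>lborel \<partial>lborel)"
    unfolding rot by (simp add: nn_integral_cmult)
  also have "\<dots> = (\<integral>\<^sup>+x. \<integral>\<^sup>+t. \<integral>\<^sup>+y. k t x y \<partial>lborel \<partial>lborel \<partial>lborel)"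
    unfolding k_def by (rule lborel_pair.Fubini') measurable
  also have "\<dots> = (\<integral>\<^sup>+x. \<integral>\<^sup>+y. \<integral>\<^sup>+t. k t x y \<partial>lborel \<partial>lborel \<partial>lborel)"
    unfolding k_def by (intro nn_integral_cong lborel_pair.Fubini') measurable
  finally have I: "I = \<dots>" .
  define A where "A = (cmod (F z))\<^sup>2"
  define B where "B = (cmod (deriv F z))\<^sup>2"
  have AB: "0 \<le> A" "0 \<le> B" by (auto simp: A_def B_def)
  have lower: "(\<integral>\<^sup>+t. k t x y \<partial>lborel) \<ge> ennreal ((A + (x\<^sup>2 + y\<^sup>2) * B) * exp (- c * (x\<^sup>2 + y\<^sup>2)))" for x y
  proof -
    have "(\<integral>\<^sup>+t. k t x y \<partial>lborel) = (\<integral>\<^sup>+t. ennreal (exp (- c * (x\<^sup>2 + y\<^sup>2))) *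
       (ennreal ((cmod (F (z + Complex x y * cis (2 * pi * t))))\<^sup>2) * indicator {0..1} t) \<partial>lborel)"
      by (intro nn_integral_cong) (simp add: k_def mult_ac)
    also have "\<dots> = ennreal (exp (- c * (x\<^sup>2 + y\<^sup>2))) *
       (\<integral>\<^sup>+t. ennreal ((cmod (F (z + Complex x y * cis (2 * pi * t))))\<^sup>2) * indicator {0..1} t \<partial>lborel)"
      by (rule nn_integral_cmult) measurable
    also have "\<dots> \<ge> ennreal (exp (- c * (x\<^sup>2 + y\<^sup>2))) * ennreal (A + (x\<^sup>2 + y\<^sup>2) * B)"
      using circle_mean_square_lower_bound_complex[OF F, of z "Complex x y"]
      by (intro mult_left_mono) (auto simp: A_def B_def cmod_power2)
    finally show ?thesis by (simp only: ennreal_mult''[OF exp_ge_zero] mult.commute)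
  qed
  have expand: "(A + (x\<^sup>2 + y\<^sup>2) * B) * exp (- c * (x\<^sup>2 + y\<^sup>2))
      = (A + x\<^sup>2 * B) * exp (- c * x\<^sup>2) * exp (- c * y\<^sup>2) + exp (- c * x\<^sup>2) * B * (y\<^sup>2 * exp (- c * y\<^sup>2))" for x y
    by (simp add: distrib_left exp_add[symmetric] distrib_right algebra_simps)
  have inner: "(\<integral>\<^sup>+y. ennreal ((A + (x\<^sup>2 + y\<^sup>2) * B) * exp (- c * (x\<^sup>2 + y\<^sup>2))) \<partial>lborel)
     = ennreal (sqrt (pi / c) * (A + B / (2 * c)) * exp (- c * x\<^sup>2) + sqrt (pi / c) * B * (x\<^sup>2 * exp (- c * x\<^sup>2)))" for x
  proof -
    have "has_bochner_integral lborel (\<lambda>y. (A + (x\<^sup>2 + y\<^sup>2) * B) * exp (- c * (x\<^sup>2 + y\<^sup>2)))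
       ((A + x\<^sup>2 * B) * exp (- c * x\<^sup>2) * sqrt (pi / c) + exp (- c * x\<^sup>2) * B * (sqrt (pi / c) / (2 * c)))"
      unfolding expand
      using has_bochner_integral_gaussian[OF c, of 0] has_bochner_integral_gaussian_square[OF c]
      by (intro has_bochner_integral_add has_bochner_integral_mult_right) simp_all
    then have "(\<integral>\<^sup>+y. ennreal ((A + (x\<^sup>2 + y\<^sup>2) * B) * exp (- c * (x\<^sup>2 + y\<^sup>2))) \<partial>lborel)
       = ennreal ((A + x\<^sup>2 * B) * exp (- c * x\<^sup>2) * sqrt (pi / c) + exp (- c * x\<^sup>2) * B * (sqrt (pi / c) / (2 * c)))"
      using AB by (subst nn_integral_eq_integral) (auto simp: has_bochner_integral_iff)
    then show ?thesis by (simp add: algebra_simps)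
  qed
  have sq: "sqrt (pi / c) * sqrt (pi / c) = pi / c" using c by simp
  have "has_bochner_integral lborel (\<lambda>x. sqrt (pi / c) * (A + B / (2 * c)) * exp (- c * x\<^sup>2) + sqrt (pi / c) * B * (x\<^sup>2 * exp (- c * x\<^sup>2)))
       (sqrt (pi / c) * (A + B / (2 * c)) * sqrt (pi / c) + sqrt (pi / c) * B * (sqrt (pi / c) / (2 * c)))"
    using has_bochner_integral_gaussian[OF c, of 0] has_bochner_integral_gaussian_square[OF c]
    by (intro has_bochner_integral_add has_bochner_integral_mult_right) simp_all
  also have "sqrt (pi / c) * (A + B / (2 * c)) * sqrt (pi / c) + sqrt (pi / c) * B * (sqrt (pi / c) / (2 * c))
     = sqrt (pi / c) * sqrt (pi / c) * (A + B / c)" 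
  proof -
    have "s * (A + B / (2 * c)) * s + s * B * (s / (2 * c)) = s * s * (A + B / c)" for s
      using c by (simp add: field_simps)
    then show ?thesis .
  qed
  also have "\<dots> = pi / c * A + pi / c\<^sup>2 * B" unfolding sq by (simp add: power2_eq_square distrib_left)
  finally have "(\<integral>\<^sup>+x. ennreal (sqrt (pi / c) * (A + B / (2 * c)) * exp (- c * x\<^sup>2) + sqrt (pi / c) * B * (x\<^sup>2 * exp (- c * x\<^sup>2))) \<partial>lborel)
       = ennreal (pi / c * A + pi / c\<^sup>2 * B)"
    using AB c by (subst nn_integral_eq_integral) (auto simp: has_bochner_integral_iff)
  then have "ennreal (pi / c * A + pi / c\<^sup>2 * B) = (\<integral>\<^sup>+x. \<integral>\<^sup>+y. ennreal ((A + (x\<^sup>2 + y\<^sup>2) * B) * exp (- c * (x\<^sup>2 + y\<^sup>2))) \<partial>lborel \<partial>lborel)"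
    unfolding inner by simp
  also have "\<dots> \<le> I" unfolding I by (intro nn_integral_mono lower)
  finally show ?thesis unfolding I_def h_def A_def B_def .
qed

section \<open>Second moments across a strip\<close>

abbreviation strip_density :: "real \<Rightarrow> (complex \<Rightarrow> complex) \<Rightarrow> real \<Rightarrow> real \<Rightarrow> real" where
  "strip_density a F x y \<equiv> (cmod (F (Complex x y)))\<^sup>2 * exp (- a * y\<^sup>2)"

text \<open>
  For \<open>a = 2 pi\<close> this is the squared \<open>L\<^sup>2\<close> norm of the lowest Landau level function that
  belongs to \<open>F\<close>; other widths of the weight arise from Gaussian averaging.
\<close>

definition strip_mass :: "real \<Rightarrow> (complex \<Rightarrow> complex) \<Rightarrow> ennreal" where
  "strip_mass a F = (\<integral>\<^sup>+(x, y). ennreal (strip_density a F x y) \<partial>lborel)"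

lemma nn_integral_plane_iterated:
  fixes f :: "real \<times> real \<Rightarrow> ennreal"
  assumes "f \<in> borel_measurable borel"
  shows "(\<integral>\<^sup>+p. f p \<partial>lborel) = (\<integral>\<^sup>+x. \<integral>\<^sup>+y. f (x, y) \<partial>lborel \<partial>lborel)"
  using assms lborel.nn_integral_fst[of f lborel] by (simp add: lborel_prod)

lemma holomorphic_borel_measurable:
  "F holomorphic_on UNIV \<Longrightarrow> F \<in> borel_measurable borel"
  by (intro borel_measurable_continuous_onI holomorphic_on_imp_continuous_on)

lemma strip_mass_iterated:
  assumes [measurable]: "F \<in> borel_measurable borel"
  shows "strip_mass a F = (\<integral>\<^sup>+x. \<integral>\<^sup>+y. ennreal (strip_density a F x y) \<partial>lborel \<partial>lborel)"
proof -
  have "(\<lambda>(x, y). ennreal (strip_density a F x y)) \<in> borel_measurable (borel :: (real \<times> real) measure)"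
    unfolding borel_prod[symmetric] by measurable
  from nn_integral_plane_iterated[OF this] show ?thesis by (simp add: strip_mass_def)
qed

lemma nn_integral_translation:
  fixes f :: "real \<Rightarrow> ennreal"
  assumes "f \<in> borel_measurable borel"
  shows "(\<integral>\<^sup>+x. f (x + t) \<partial>lborel) = (\<integral>\<^sup>+x. f x \<partial>lborel)"
  using nn_integral_real_affine[OF assms, of 1 t] by (simp add: add.commute)

text \<open>
  The horizontal shift disappears by translation invariance in \<open>x\<close>; the vertical one can be
  moved onto the weight, where two Gaussians are convolved.
\<close>

lemma strip_mass_gaussian_average:
  fixes F :: "complex \<Rightarrow> complex"
  assumes F: "F \<in> borel_measurable borel" and a: "a > 0" and c: "c > 0"
  shows "(\<integral>\<^sup>+x. \<integral>\<^sup>+y. (\<integral>\<^sup>+v. \<integral>\<^sup>+w. ennreal ((cmod (F (Complex x y + Complex v w)))\<^sup>2 * exp (- c * (v\<^sup>2 + w\<^sup>2))) \<partial>lborel \<partial>lborel)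
            * ennreal (exp (- a * y\<^sup>2)) \<partial>lborel \<partial>lborel)
       = ennreal (sqrt (pi / c) * sqrt (pi / (a + c))) * strip_mass (a * c / (a + c)) F"
proof -
  note [measurable] = F
  define \<phi> where "\<phi> x y = ennreal ((cmod (F (Complex x y)))\<^sup>2)" for x y
  have \<phi>m[measurable]: "(\<lambda>p. \<phi> (f p) (g p)) \<in> borel_measurable M"
    if [measurable]: "f \<in> borel_measurable M" "g \<in> borel_measurable M" for f g and M :: "'z measure"
    unfolding \<phi>_def by measurable
  define e where "e d y = ennreal (exp (- d * y\<^sup>2))" for d y :: real
  have em[measurable]: "(\<lambda>p. e d (f p)) \<in> borel_measurable M"
    if [measurable]: "f \<in> borel_measurable M" for f d and M :: "'z measure"
    unfolding e_def by measurable
  have split: "ennreal ((cmod (F (Complex x y + Complex v w)))\<^sup>2 * exp (- c * (v\<^sup>2 + w\<^sup>2))) = e c v * (\<phi> (x + v) (y + w) * e c w)" for x y v w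
  proof -
    have 1: "Complex x y + Complex v w = Complex (x + v) (y + w)" by (simp add: complex_eq_iff)
    have 2: "exp (- c * (v\<^sup>2 + w\<^sup>2)) = exp (- c * v\<^sup>2) * exp (- c * w\<^sup>2)"
      by (simp add: exp_add[symmetric] algebra_simps)
    show ?thesis unfolding \<phi>_def e_def 1 2 by (simp add: ennreal_mult[symmetric] mult_ac)
  qed
  have "(\<integral>\<^sup>+x. \<integral>\<^sup>+y. (\<integral>\<^sup>+v. \<integral>\<^sup>+w. ennreal ((cmod (F (Complex x y + Complex v w)))\<^sup>2 * exp (- c * (v\<^sup>2 + w\<^sup>2))) \<partial>lborel \<partial>lborel)
            * ennreal (exp (- a * y\<^sup>2)) \<partial>lborel \<partial>lborel)
      = (\<integral>\<^sup>+x. \<integral>\<^sup>+y. \<integral>\<^sup>+v. e c v * (\<integral>\<^sup>+w. \<phi> (x + v) (y + w) * e c w * e a y \<partial>lborel) \<partial>lborel \<partial>lborel \<partial>lborel)"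
    unfolding split e_def[of a, symmetric]
    by (intro nn_integral_cong) (simp add: nn_integral_multc[symmetric] nn_integral_cmult[symmetric] mult_ac)
  also have "\<dots> = (\<integral>\<^sup>+x. \<integral>\<^sup>+v. \<integral>\<^sup>+y. e c v * (\<integral>\<^sup>+w. \<phi> (x + v) (y + w) * e c w * e a y \<partial>lborel) \<partial>lborel \<partial>lborel \<partial>lborel)"
    by (intro nn_integral_cong lborel_pair.Fubini') measurable
  also have "\<dots> = (\<integral>\<^sup>+v. \<integral>\<^sup>+x. \<integral>\<^sup>+y. e c v * (\<integral>\<^sup>+w. \<phi> (x + v) (y + w) * e c w * e a y \<partial>lborel) \<partial>lborel \<partial>lborel \<partial>lborel)"
    by (rule lborel_pair.Fubini') measurable
  also have "\<dots> = (\<integral>\<^sup>+v. e c v * (\<integral>\<^sup>+x. \<integral>\<^sup>+y. \<integral>\<^sup>+w. \<phi> (x + v) (y + w) * e c w * e a y \<partial>lborel \<partial>lborel \<partial>lborel) \<partial>lborel)"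
    by (simp add: nn_integral_cmult)
  also have "\<dots> = (\<integral>\<^sup>+v. e c v * (\<integral>\<^sup>+x. \<integral>\<^sup>+y. \<integral>\<^sup>+w. \<phi> x (y + w) * e c w * e a y \<partial>lborel \<partial>lborel \<partial>lborel) \<partial>lborel)"
    by (subst nn_integral_translation) auto
  also have "\<dots> = ennreal (sqrt (pi / c)) * (\<integral>\<^sup>+x. \<integral>\<^sup>+y. \<integral>\<^sup>+w. \<phi> x (y + w) * e c w * e a y \<partial>lborel \<partial>lborel \<partial>lborel)"
    using nn_integral_gaussian[OF c, of 0] by (simp add: nn_integral_multc e_def)
  also have "(\<integral>\<^sup>+x. \<integral>\<^sup>+y. \<integral>\<^sup>+w. \<phi> x (y + w) * e c w * e a y \<partial>lborel \<partial>lborel \<partial>lborel)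
     = (\<integral>\<^sup>+x. \<integral>\<^sup>+y. \<phi> x y * ennreal (sqrt (pi / (a + c)) * exp (- (a * c / (a + c)) * y\<^sup>2)) \<partial>lborel \<partial>lborel)"
  proof (rule nn_integral_cong)
    fix x :: real
    have "(\<integral>\<^sup>+y. \<integral>\<^sup>+w. \<phi> x (y + w) * e c w * e a y \<partial>lborel \<partial>lborel) = (\<integral>\<^sup>+w. \<integral>\<^sup>+y. \<phi> x (y + w) * e c w * e a y \<partial>lborel \<partial>lborel)"
      by (rule lborel_pair.Fubini') measurable
    also have "\<dots> = (\<integral>\<^sup>+w. \<integral>\<^sup>+y. \<phi> x y * e c w * e a (y - w) \<partial>lborel \<partial>lborel)"
    proof (rule nn_integral_cong)
      fix w :: real
      show "(\<integral>\<^sup>+y. \<phi> x (y + w) * e c w * e a y \<partial>lborel) = (\<integral>\<^sup>+y. \<phi> x y * e c w * e a (y - w) \<partial>lborel)"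
        using nn_integral_translation[of "\<lambda>y. \<phi> x y * e c w * e a (y - w)" w] by simp
    qed
    also have "\<dots> = (\<integral>\<^sup>+y. \<integral>\<^sup>+w. \<phi> x y * e c w * e a (y - w) \<partial>lborel \<partial>lborel)"
      by (rule lborel_pair.Fubini') measurable
    also have "\<dots> = (\<integral>\<^sup>+y. \<phi> x y * (\<integral>\<^sup>+w. e c w * e a (y - w) \<partial>lborel) \<partial>lborel)"
      by (intro nn_integral_cong) (simp add: nn_integral_cmult mult.assoc)
    also have "\<dots> = (\<integral>\<^sup>+y. \<phi> x y * ennreal (sqrt (pi / (a + c)) * exp (- (a * c / (a + c)) * y\<^sup>2)) \<partial>lborel)"
      unfolding nn_integral_gaussian_convolution[OF a c, symmetric]
      by (simp add: e_def ennreal_mult)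
    finally show "(\<integral>\<^sup>+y. \<integral>\<^sup>+w. \<phi> x (y + w) * e c w * e a y \<partial>lborel \<partial>lborel) = \<dots>" .
  qed
  also have "\<dots> = (\<integral>\<^sup>+x. \<integral>\<^sup>+y. ennreal (sqrt (pi / (a + c))) * ennreal ((cmod (F (Complex x y)))\<^sup>2 * exp (- (a * c / (a + c)) * y\<^sup>2)) \<partial>lborel \<partial>lborel)"
    using a c by (intro nn_integral_cong) (simp add: \<phi>_def ennreal_mult[symmetric] mult_ac)
  also have "\<dots> = ennreal (sqrt (pi / (a + c))) * strip_mass (a * c / (a + c)) F"
    unfolding strip_mass_iterated[OF F] by (simp add: nn_integral_cmult)
  finally show ?thesis using a c by (simp add: ennreal_mult mult.assoc)
qed

text \<open>
  An integrated form of \<open>\<Delta> |F|\<^sup>2 = 4 |F'|\<^sup>2\<close>: running the heat flow on \<open>|F|\<^sup>2\<close> widens the weight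
  from \<open>a\<close> to \<open>a c / (a + c)\<close>, and the mass gained dominates the mass of the derivative.
\<close>

lemma strip_mass_derivative_bound:
  fixes F :: "complex \<Rightarrow> complex"
  assumes F: "F holomorphic_on UNIV" and a: "a > 0" and c: "c > 0"
  shows "ennreal (pi / c) * strip_mass a F + ennreal (pi / c\<^sup>2) * strip_mass a (deriv F)
       \<le> ennreal (sqrt (pi / c) * sqrt (pi / (a + c))) * strip_mass (a * c / (a + c)) F"
proof -
  note Fm[measurable] = holomorphic_borel_measurable[OF F]
  have "deriv F holomorphic_on UNIV" using F by (rule holomorphic_deriv) simp
  note F'm[measurable] = holomorphic_borel_measurable[OF this]
  have "ennreal (pi / c) * strip_mass a F + ennreal (pi / c\<^sup>2) * strip_mass a (deriv F)
    = (\<integral>\<^sup>+x. \<integral>\<^sup>+y. ennreal (pi / c) * ennreal (strip_density a F x y)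
        + ennreal (pi / c\<^sup>2) * ennreal (strip_density a (deriv F) x y) \<partial>lborel \<partial>lborel)"
    unfolding strip_mass_iterated[OF Fm] strip_mass_iterated[OF F'm]
    by (simp add: nn_integral_add nn_integral_cmult)
  also have "\<dots> = (\<integral>\<^sup>+x. \<integral>\<^sup>+y. ennreal (pi / c * (cmod (F (Complex x y)))\<^sup>2 + pi / c\<^sup>2 * (cmod (deriv F (Complex x y)))\<^sup>2) * ennreal (exp (- a * y\<^sup>2)) \<partial>lborel \<partial>lborel)"
    using c by (intro nn_integral_cong) (simp add: ennreal_mult[symmetric] ennreal_plus[symmetric] del: ennreal_plus, simp add: field_simps)
  also have "\<dots> \<le> (\<integral>\<^sup>+x. \<integral>\<^sup>+y. (\<integral>\<^sup>+v. \<integral>\<^sup>+w. ennreal ((cmod (F (Complex x y + Complex v w)))\<^sup>2 * exp (- c * (v\<^sup>2 + w\<^sup>2))) \<partial>lborel \<partial>lborel)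
            * ennreal (exp (- a * y\<^sup>2)) \<partial>lborel \<partial>lborel)"
    by (intro nn_integral_mono mult_right_mono gaussian_mean_square_lower_bound F c) simp
  also have "\<dots> = ennreal (sqrt (pi / c) * sqrt (pi / (a + c))) * strip_mass (a * c / (a + c)) F"
    by (rule strip_mass_gaussian_average[OF Fm a c])
  finally show ?thesis .
qed

lemma borel_measurable_strip_density:
  assumes [measurable]: "F \<in> borel_measurable borel"
  shows "(\<lambda>(x, y). strip_density a F x y) \<in> borel_measurable (borel :: (real \<times> real) measure)"
  unfolding borel_prod[symmetric] by measurable

text \<open>
  The finite difference version of the next lemma. The bound on \<open>F'\<close> compares the width \<open>2 pi\<close> with
  \<open>2 pi b\<close>, and convexity of the exponential bounds the mass at width \<open>2 pi b\<close> from below by the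
  mass and the second moment at width \<open>2 pi\<close>.
\<close>

lemma strip_mass_derivative_le_approx:
  fixes F :: "complex \<Rightarrow> complex"
  assumes F: "F holomorphic_on UNIV" and mass: "strip_mass (2 * pi) F = 1"
    and moment: "(\<integral>\<^sup>+(x, y). ennreal (y\<^sup>2 * (strip_density (2 * pi) F x y)) \<partial>lborel) = ennreal v"
    and v: "0 \<le> v" and b: "b > 1"
  shows "\<exists>k\<ge>0. strip_mass (2 * pi * b) (deriv F) = ennreal k \<and> k \<le> 4 * pi\<^sup>2 * b * v - 2 * pi * sqrt b / (sqrt b + 1)"
proof -
  note Fm[measurable] = holomorphic_borel_measurable[OF F]
  note sm[measurable] = borel_measurable_strip_density[OF Fm]
  define a where "a = 2 * pi * b"
  \<comment> \<open>The choice of \<open>c\<close> makes \<open>a c / (a + c)\<close> equal to \<open>2 pi\<close>.\<close>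
  define c where "c = 2 * pi * b / (b - 1)"
  have a: "a > 0" and c: "c > 0" using b by (auto simp: a_def c_def)
  have ac: "a + c = c * b" using b by (simp add: a_def c_def field_simps)
  have aca: "a * c / (a + c) = 2 * pi" unfolding ac using b c by (simp add: a_def)
  have "sqrt (pi / c) * sqrt (pi / (a + c)) = sqrt ((pi / c)\<^sup>2 / b)"
    unfolding ac by (simp add: real_sqrt_mult[symmetric] power2_eq_square mult.assoc)
  also have "\<dots> = pi / c / sqrt b" using c by (simp add: real_sqrt_divide)
  finally have root: "sqrt (pi / c) * sqrt (pi / (a + c)) = pi / c / sqrt b" .
  have main: "ennreal (pi / c) * strip_mass a F + ennreal (pi / c\<^sup>2) * strip_mass a (deriv F) \<le> ennreal (pi / c / sqrt b)"
    using strip_mass_derivative_bound[OF F a c] unfolding root aca mass by simp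
  have fin: "ennreal (pi / c) * strip_mass a F + ennreal (pi / c\<^sup>2) * strip_mass a (deriv F) < \<infinity>"
    by (rule le_less_trans[OF main]) simp
  have "strip_mass a F < \<infinity>" "strip_mass a (deriv F) < \<infinity>"
    using fin c by (auto simp: ennreal_mult_less_top less_top ennreal_zero_less_divide divide_le_0_iff)
  then obtain m k where m: "strip_mass a F = ennreal m" "0 \<le> m" and k: "strip_mass a (deriv F) = ennreal k" "0 \<le> k"
    by (cases "strip_mass a F"; cases "strip_mass a (deriv F)") auto
  have "ennreal (pi / c * m + pi / c\<^sup>2 * k) \<le> ennreal (pi / c / sqrt b)"
    using main m k c by (simp add: ennreal_mult' del: times_divide_eq_left times_divide_eq_right)
  then have "pi / c * m + pi / c\<^sup>2 * k \<le> pi / c / sqrt b"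
    using b c by (subst (asm) ennreal_le_iff) auto
  also have "pi / c * m + pi / c\<^sup>2 * k = pi / c * (m + k / c)" by (simp add: distrib_left power2_eq_square)
  finally have "pi / c * (m + k / c) \<le> pi / c * (1 / sqrt b)" by simp
  then have mk: "m + k / c \<le> 1 / sqrt b" using c by (subst (asm) mult_le_cancel_left_pos) auto
  have "1 \<le> ennreal m + ennreal (2 * pi * (b - 1)) * ennreal v"
  proof -
    have "1 = (\<integral>\<^sup>+p. (case p of (x, y) \<Rightarrow> ennreal (strip_density (2 * pi) F x y)) \<partial>lborel)"
      using mass by (simp add: strip_mass_def)
    also have "\<dots> \<le> (\<integral>\<^sup>+p. (case p of (x, y) \<Rightarrow> ennreal (strip_density a F x y)) +
       ennreal (2 * pi * (b - 1)) * (case p of (x, y) \<Rightarrow> ennreal (y\<^sup>2 * (strip_density (2 * pi) F x y))) \<partial>lborel)"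
    proof (intro nn_integral_mono, simp only: split_paired_all split_conv)
      fix x y :: real
      have "1 + (- (2 * pi * (b - 1) * y\<^sup>2)) \<le> exp (- (2 * pi * (b - 1) * y\<^sup>2))" by (rule exp_ge_add_one_self)
      then have "exp (- (2 * pi) * y\<^sup>2) * (1 - 2 * pi * (b - 1) * y\<^sup>2) \<le> exp (- (2 * pi) * y\<^sup>2) * exp (- (2 * pi * (b - 1) * y\<^sup>2))"
        by (intro mult_left_mono) auto
      also have "\<dots> = exp (- a * y\<^sup>2)" unfolding exp_add[symmetric] a_def by (simp add: algebra_simps)
      finally have "strip_density (2 * pi) F x y \<le> (cmod (F (Complex x y)))\<^sup>2 * (exp (- a * y\<^sup>2) + 2 * pi * (b - 1) * (y\<^sup>2 * exp (- (2 * pi) * y\<^sup>2)))"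
        by (intro mult_left_mono) (auto simp: algebra_simps)
      then show "ennreal (strip_density (2 * pi) F x y) \<le> ennreal (strip_density a F x y) +
         ennreal (2 * pi * (b - 1)) * ennreal (y\<^sup>2 * (strip_density (2 * pi) F x y))"
        using b by (subst ennreal_mult[symmetric], simp, simp, subst ennreal_plus[symmetric], simp, simp)
          (intro ennreal_leI, simp add: algebra_simps)
    qed
    also have "\<dots> = ennreal m + ennreal (2 * pi * (b - 1)) * ennreal v"
      unfolding m(1)[symmetric] moment[symmetric] strip_mass_def
    proof (subst nn_integral_add)
      show m1: "(\<lambda>(x, y). ennreal (strip_density a F x y)) \<in> borel_measurable (lborel :: (real \<times> real) measure)"
        unfolding lborel_prod[symmetric] by measurable
      have m2: "(\<lambda>(x, y). ennreal (y\<^sup>2 * (strip_density (2 * pi) F x y))) \<in> borel_measurable (lborel :: (real \<times> real) measure)"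
        unfolding lborel_prod[symmetric] by measurable
      show "(\<lambda>p. ennreal (2 * pi * (b - 1)) * (case p of (x, y) \<Rightarrow> ennreal (y\<^sup>2 * (strip_density (2 * pi) F x y)))) \<in> borel_measurable (lborel :: (real \<times> real) measure)"
        using m2 by measurable
    qed (subst nn_integral_cmult, unfold lborel_prod[symmetric], measurable)
    finally show ?thesis .
  qed
  then have "ennreal 1 \<le> ennreal (m + 2 * pi * (b - 1) * v)"
    using b v m(2) by (simp add: ennreal_mult)
  then have m1: "1 \<le> m + 2 * pi * (b - 1) * v"
    using b v m(2) by (subst (asm) ennreal_le_iff) auto
  have "k / c \<le> 1 / sqrt b - 1 + 2 * pi * (b - 1) * v" using mk m1 by simp
  then have "k \<le> c * (1 / sqrt b - 1 + 2 * pi * (b - 1) * v)" using c by (simp add: field_simps)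
  also have "\<dots> = c * (b - 1) * (2 * pi * v) + c * (1 / sqrt b - 1)" by (simp add: algebra_simps)
  also have "c * (b - 1) = 2 * pi * b" using b by (simp add: c_def)
  also have "c * (1 / sqrt b - 1) = - (2 * pi * sqrt b / (sqrt b + 1))"
  proof -
    define s where "s = sqrt b"
    have s: "s > 1" and bs: "b = s * s" using b by (auto simp: s_def)
    have nz: "s * s - 1 \<noteq> 0" "s + 1 \<noteq> 0" "s \<noteq> 0" using s by (auto simp: less_1_mult less_imp_neq[THEN not_sym])
    have "c * (1 / s - 1) = - (2 * pi * s / (s + 1))"
      unfolding c_def bs using nz by (simp add: divide_simps) (simp add: algebra_simps)
    then show ?thesis by (simp add: s_def)
  qed
  finally have "k \<le> 4 * pi\<^sup>2 * b * v - 2 * pi * sqrt b / (sqrt b + 1)" by (simp add: power2_eq_square algebra_simps)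
  then show ?thesis using k unfolding a_def by blast
qed

text \<open>
  The variance in \<open>y\<close> of a lowest Landau level function of mass one is at least \<open>1 / (4 pi)\<close>,
  and its excess controls the derivative. This is the limit \<open>b \<rightarrow> 1\<close> of the preceding bound; Fatou's
  lemma suffices on the left-hand side.
\<close>

lemma strip_mass_derivative_le_variance:
  fixes F :: "complex \<Rightarrow> complex"
  assumes F: "F holomorphic_on UNIV" and mass: "strip_mass (2 * pi) F = 1"
    and moment: "(\<integral>\<^sup>+(x, y). ennreal (y\<^sup>2 * (strip_density (2 * pi) F x y)) \<partial>lborel) = ennreal v"
    and v: "0 \<le> v"
  shows "strip_mass (2 * pi) (deriv F) \<le> ennreal (4 * pi\<^sup>2 * v - pi)" and "0 \<le> 4 * pi\<^sup>2 * v - pi"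
proof -
  let ?r = "\<lambda>b. 4 * pi\<^sup>2 * b * v - 2 * pi * sqrt b / (sqrt b + 1)"
  have "deriv F holomorphic_on UNIV" using F by (rule holomorphic_deriv) simp
  note F'm = holomorphic_borel_measurable[OF this]
  define b where "b n = 1 + 1 / real (Suc n)" for n
  have b: "b \<longlonglongrightarrow> 1" unfolding b_def by real_asymp
  have b1: "b n > 1" for n by (simp add: b_def)
  have r: "strip_mass (2 * pi * b n) (deriv F) \<le> ennreal (?r (b n))" "0 \<le> ?r (b n)" for n
    using strip_mass_derivative_le_approx[OF F mass moment v b1[of n]] by (auto intro: ennreal_leI)
  have "(\<lambda>n. ?r (b n)) \<longlonglongrightarrow> 4 * pi\<^sup>2 * 1 * v - 2 * pi * sqrt 1 / (sqrt 1 + 1)"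
    by (intro tendsto_intros b) simp
  then have rlim: "(\<lambda>n. ?r (b n)) \<longlonglongrightarrow> 4 * pi\<^sup>2 * v - pi" by simp
  show "0 \<le> 4 * pi\<^sup>2 * v - pi" by (rule LIMSEQ_le_const[OF rlim]) (use r(2) in blast)
  define u where "u n p = (case p of (x, y) \<Rightarrow> ennreal ((cmod (deriv F (Complex x y)))\<^sup>2 * exp (- (2 * pi * b n) * y\<^sup>2)))" for n and p :: "real \<times> real"
  have lim: "(\<lambda>n. u n (x, y)) \<longlonglongrightarrow> ennreal (strip_density (2 * pi) (deriv F) x y)" for x y
  proof -
    have "(\<lambda>n. (cmod (deriv F (Complex x y)))\<^sup>2 * exp (- (2 * pi * b n) * y\<^sup>2)) \<longlonglongrightarrow> (cmod (deriv F (Complex x y)))\<^sup>2 * exp (- (2 * pi * 1) * y\<^sup>2)"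
      by (intro tendsto_intros b)
    from tendsto_ennrealI[OF this] show ?thesis by (simp add: u_def)
  qed
  have "strip_mass (2 * pi) (deriv F) = (\<integral>\<^sup>+p. liminf (\<lambda>n. u n p) \<partial>lborel)"
    unfolding strip_mass_def
    by (intro nn_integral_cong, simp only: split_paired_all split_conv) (rule lim_imp_Liminf[symmetric, OF _ lim], simp)
  also have "\<dots> \<le> liminf (\<lambda>n. \<integral>\<^sup>+p. u n p \<partial>lborel)"
    using measurable_compose[OF borel_measurable_strip_density[OF F'm] measurable_ennreal]
    by (intro nn_integral_liminf) (simp add: u_def[abs_def] split_beta')
  also have "\<dots> = liminf (\<lambda>n. strip_mass (2 * pi * b n) (deriv F))"
    by (simp add: strip_mass_def u_def)
  also have "\<dots> \<le> liminf (\<lambda>n. ennreal (4 * pi\<^sup>2 * b n * v - 2 * pi * sqrt (b n) / (sqrt (b n) + 1)))"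
    by (intro Liminf_mono always_eventually allI r(1))
  also have "\<dots> = ennreal (4 * pi\<^sup>2 * v - pi)"
  proof (rule lim_imp_Liminf)
    show "(\<lambda>n. ennreal (4 * pi\<^sup>2 * b n * v - 2 * pi * sqrt (b n) / (sqrt (b n) + 1))) \<longlonglongrightarrow> ennreal (4 * pi\<^sup>2 * v - pi)"
      by (rule tendsto_ennrealI[OF rlim])
  qed simp
  finally show "strip_mass (2 * pi) (deriv F) \<le> ennreal (4 * pi\<^sup>2 * v - pi)" .
qed

section \<open>Comparing Gaussian weights of different widths\<close>

lemma increment_le_nn_integral:
  fixes h h' H :: "real \<Rightarrow> real"
  assumes d: "\<And>s. (h has_real_derivative h' s) (at s)" and H: "\<And>s. \<bar>h' s\<bar> \<le> H s"
    and cont: "continuous_on UNIV H" and y: "0 \<le> y"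
  shows "ennreal \<bar>h y - h 0\<bar> \<le> (\<integral>\<^sup>+s. ennreal (H s) * indicator {0..y} s \<partial>lborel)"
proof -
  have h': "(h' has_integral (h y - h 0)) {0..y}"
    using y by (intro fundamental_theorem_of_calculus)
      (auto simp: has_real_derivative_iff_has_vector_derivative[symmetric] intro: has_field_derivative_at_within d)
  have Hi: "(H has_integral integral {0..y} H) {0..y}"
    by (intro integrable_integral integrable_continuous_interval continuous_on_subset[OF cont]) simp
  have "h y - h 0 \<le> integral {0..y} H"
    by (rule has_integral_le[OF h' Hi]) (use H abs_le_D1 in blast)
  moreover have "- (h y - h 0) \<le> integral {0..y} H"
    by (rule has_integral_le[OF has_integral_neg[OF h'] Hi]) (use H abs_le_D2 in blast)
  ultimately have "\<bar>h y - h 0\<bar> \<le> integral {0..y} H" by simp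
  moreover have "(\<integral>\<^sup>+s. ennreal (H s) * indicator {0..y} s \<partial>lborel) = ennreal (integral {0..y} H)"
    by (rule nn_integral_has_integral_lebesgue'[OF _ Hi]) (use H order_trans[OF abs_ge_zero] in blast)
  ultimately show ?thesis by (simp add: ennreal_leI)
qed

definition segment_from_0 :: "real \<Rightarrow> real set" where
  "segment_from_0 y = (if 0 \<le> y then {0..y} else {y..0})"

lemma increment_le_nn_integral_signed:
  fixes h h' H :: "real \<Rightarrow> real"
  assumes d: "\<And>s. (h has_real_derivative h' s) (at s)" and H: "\<And>s. \<bar>h' s\<bar> \<le> H s"
    and cont: "continuous_on UNIV H"
  shows "ennreal \<bar>h y - h 0\<bar> \<le> (\<integral>\<^sup>+s. ennreal (H s) * indicator (segment_from_0 y) s \<partial>lborel)"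
proof (cases "0 \<le> y")
  case True
  then show ?thesis using increment_le_nn_integral[OF d H cont, of y] by (simp add: segment_from_0_def)
next
  case False
  have Hm[measurable]: "H \<in> borel_measurable borel" by (rule borel_measurable_continuous_onI[OF cont])
  have d': "((\<lambda>s. h (- s)) has_real_derivative - h' (- s)) (at s)" for s
    using DERIV_chain2[where f=h and g=uminus and Da="h' (- s)" and Db="-1" and x=s and s=UNIV, OF d DERIV_minus[OF DERIV_ident]] by simp
  have "ennreal \<bar>h y - h 0\<bar> \<le> (\<integral>\<^sup>+s. ennreal (H (- s)) * indicator {0..-y} s \<partial>lborel)"
    using increment_le_nn_integral[OF d' _ _, of "\<lambda>s. H (- s)" "- y"] H False
    by (simp add: continuous_on_compose2[OF cont] continuous_on_minus)
  also have "\<dots> = (\<integral>\<^sup>+s. ennreal (H s) * indicator (segment_from_0 y) s \<partial>lborel)"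
    using False by (subst (2) nn_integral_real_affine[where c="-1" and t=0])
      (auto simp: segment_from_0_def indicator_def intro!: nn_integral_cong)
  finally show ?thesis .
qed

text \<open>
  The weights \<open>exp (- 2 pi y\<^sup>2)\<close> and \<open>\<surd>2 exp (- 4 pi y\<^sup>2)\<close> have equal mass, so only the
  oscillation of \<open>h\<close> enters the difference of the two averages. A derivative at \<open>s\<close> is felt only
  by points \<open>y\<close> beyond \<open>s\<close>, and the Gaussian mass of these is at most a multiple of
  \<open>exp (- 2 pi s\<^sup>2)\<close>.
\<close>

lemma gaussian_width_comparison:
  fixes h h' H :: "real \<Rightarrow> real"
  assumes d: "\<And>s. (h has_real_derivative h' s) (at s)" and H: "\<And>s. \<bar>h' s\<bar> \<le> H s"
    and cont: "continuous_on UNIV H" and h0: "\<And>s. 0 \<le> h s"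
  shows "(\<integral>\<^sup>+y. ennreal (h y * exp (- (2 * pi) * y\<^sup>2)) \<partial>lborel)
     \<le> (\<integral>\<^sup>+y. ennreal (sqrt 2 * h y * exp (- (4 * pi) * y\<^sup>2)) \<partial>lborel) + (\<integral>\<^sup>+y. ennreal (H y * exp (- (2 * pi) * y\<^sup>2)) \<partial>lborel)"
proof -
  have Hm[measurable]: "H \<in> borel_measurable borel" by (rule borel_measurable_continuous_onI[OF cont])
  have "continuous_on UNIV h" using d DERIV_isCont continuous_at_imp_continuous_on by blast
  then have hm[measurable]: "h \<in> borel_measurable borel" by (rule borel_measurable_continuous_onI)
  define e2 e4 where "e2 y = exp (- (2 * pi) * y\<^sup>2)" and "e4 y = sqrt 2 * exp (- (4 * pi) * y\<^sup>2)" for y :: real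
  have e2m[measurable]: "e2 \<in> borel_measurable borel" and e4m[measurable]: "e4 \<in> borel_measurable borel"
    unfolding e2_def[abs_def] e4_def[abs_def] by measurable
  have e24: "0 \<le> e2 y" "0 \<le> e4 y" "\<bar>e2 y - e4 y\<bar> \<le> e2 y" for y
  proof -
    have "exp (- (4 * pi) * y\<^sup>2) = exp (- (2 * pi) * y\<^sup>2) * e2 y"
      by (simp add: e2_def exp_add[symmetric])
    then have *: "e4 y = sqrt 2 * exp (- (2 * pi) * y\<^sup>2) * e2 y" by (simp add: e4_def)
    have "exp (- (2 * pi) * y\<^sup>2) \<le> 1" by simp
    moreover have "sqrt 2 < 2" by (simp add: sqrt2_less_2)
    ultimately have "sqrt 2 * exp (- (2 * pi) * y\<^sup>2) \<le> 2 * 1" by (intro mult_mono) auto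
    from mult_right_mono[OF this, of "e2 y"]
    have "e4 y \<le> 2 * e2 y" unfolding * by (simp add: e2_def)
    moreover show "0 \<le> e2 y" "0 \<le> e4 y" by (auto simp: e2_def e4_def)
    ultimately show "\<bar>e2 y - e4 y\<bar> \<le> e2 y" by simp
  qed
  define A where "A y = (\<integral>\<^sup>+s. ennreal (H s) * indicator (segment_from_0 y) s \<partial>lborel)" for y
  have bet: "indicator (segment_from_0 y) s = (if (0 \<le> s \<and> s \<le> y) \<or> (y < 0 \<and> y \<le> s \<and> s \<le> 0) then 1 else 0 :: ennreal)" for y s
    by (auto simp: segment_from_0_def indicator_def)
  have betm[measurable]: "(\<lambda>p. indicator (segment_from_0 (f p)) (g p) :: ennreal) \<in> borel_measurable M"
    if [measurable]: "f \<in> borel_measurable M" "g \<in> borel_measurable M" for f g and M :: "'z measure"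
    unfolding bet by measurable
  have Am[measurable]: "A \<in> borel_measurable borel" unfolding A_def by measurable
  have I2: "(\<integral>\<^sup>+y. ennreal (e2 y) \<partial>lborel) = ennreal (1 / sqrt 2)"
    using nn_integral_gaussian[of "2 * pi" 0] by (simp add: e2_def real_sqrt_divide)
  have I4: "(\<integral>\<^sup>+y. ennreal (e4 y) \<partial>lborel) = ennreal (1 / sqrt 2)"
  proof -
    have "(\<integral>\<^sup>+y. ennreal (e4 y) \<partial>lborel) = ennreal (sqrt 2) * ennreal (1 / 2)"
      using nn_integral_gaussian[of "4 * pi" 0]
      by (simp add: e4_def ennreal_mult nn_integral_cmult real_sqrt_divide)
    also have "\<dots> = ennreal (sqrt 2 * (1 / 2))" by (rule ennreal_mult[symmetric]) auto
    also have "sqrt 2 * (1 / 2) = 1 / sqrt 2" by (simp add: field_simps)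
    finally show ?thesis .
  qed
  \<comment> \<open>Both sides are increased by \<open>h 0\<close> times the common mass of the weights, so that no difference of
    possibly infinite integrals is formed.\<close>
  have "(\<integral>\<^sup>+y. ennreal (h y * e2 y) \<partial>lborel) + ennreal (h 0) * ennreal (1 / sqrt 2)
     = (\<integral>\<^sup>+y. ennreal (h y * e2 y) + ennreal (h 0) * ennreal (e4 y) \<partial>lborel)"
    unfolding I4[symmetric] by (simp add: nn_integral_add nn_integral_cmult)
  also have "\<dots> \<le> (\<integral>\<^sup>+y. ennreal (h y * e4 y) + ennreal (h 0) * ennreal (e2 y) + A y * ennreal (e2 y) \<partial>lborel)"
  proof (rule nn_integral_mono)
    fix y :: real
    have "(h y - h 0) * (e2 y - e4 y) \<le> \<bar>h y - h 0\<bar> * \<bar>e2 y - e4 y\<bar>"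
      using abs_ge_self[of "(h y - h 0) * (e2 y - e4 y)"] by (simp add: abs_mult)
    also have "\<dots> \<le> \<bar>h y - h 0\<bar> * e2 y" using e24 by (intro mult_left_mono) auto
    finally have "h y * e2 y + h 0 * e4 y \<le> h y * e4 y + h 0 * e2 y + \<bar>h y - h 0\<bar> * e2 y"
      by (simp add: algebra_simps)
    then have "ennreal (h y * e2 y) + ennreal (h 0) * ennreal (e4 y)
        \<le> ennreal (h y * e4 y) + ennreal (h 0) * ennreal (e2 y) + ennreal \<bar>h y - h 0\<bar> * ennreal (e2 y)"
      using h0 e24 by (simp add: ennreal_mult[symmetric] ennreal_plus[symmetric] ennreal_leI del: ennreal_plus)
    also have "\<dots> \<le> ennreal (h y * e4 y) + ennreal (h 0) * ennreal (e2 y) + A y * ennreal (e2 y)"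
      unfolding A_def by (intro add_left_mono mult_right_mono increment_le_nn_integral_signed[OF d H cont]) simp
    finally show "ennreal (h y * e2 y) + ennreal (h 0) * ennreal (e4 y)
        \<le> ennreal (h y * e4 y) + ennreal (h 0) * ennreal (e2 y) + A y * ennreal (e2 y)" .
  qed
  also have "\<dots> = (\<integral>\<^sup>+y. ennreal (h y * e4 y) \<partial>lborel) + (\<integral>\<^sup>+y. A y * ennreal (e2 y) \<partial>lborel) + ennreal (h 0) * ennreal (1 / sqrt 2)"
  proof -
    have "(\<integral>\<^sup>+y. ennreal (h y * e4 y) + ennreal (h 0) * ennreal (e2 y) + A y * ennreal (e2 y) \<partial>lborel)
      = (\<integral>\<^sup>+y. ennreal (h y * e4 y) + ennreal (h 0) * ennreal (e2 y) \<partial>lborel) + (\<integral>\<^sup>+y. A y * ennreal (e2 y) \<partial>lborel)"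
      by (rule nn_integral_add) measurable
    also have "(\<integral>\<^sup>+y. ennreal (h y * e4 y) + ennreal (h 0) * ennreal (e2 y) \<partial>lborel)
      = (\<integral>\<^sup>+y. ennreal (h y * e4 y) \<partial>lborel) + (\<integral>\<^sup>+y. ennreal (h 0) * ennreal (e2 y) \<partial>lborel)"
      by (rule nn_integral_add) measurable
    also have "(\<integral>\<^sup>+y. ennreal (h 0) * ennreal (e2 y) \<partial>lborel) = ennreal (h 0) * ennreal (1 / sqrt 2)"
      unfolding I2[symmetric] by (rule nn_integral_cmult) measurable
    finally show ?thesis by (simp only: ac_simps)
  qed
  finally have "ennreal (h 0) * ennreal (1 / sqrt 2) + (\<integral>\<^sup>+y. ennreal (h y * e2 y) \<partial>lborel)
     \<le> ennreal (h 0) * ennreal (1 / sqrt 2) + ((\<integral>\<^sup>+y. ennreal (h y * e4 y) \<partial>lborel) + (\<integral>\<^sup>+y. A y * ennreal (e2 y) \<partial>lborel))"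
    by (simp only: add.commute add.left_commute)
  then have 1: "(\<integral>\<^sup>+y. ennreal (h y * e2 y) \<partial>lborel) \<le> (\<integral>\<^sup>+y. ennreal (h y * e4 y) \<partial>lborel) + (\<integral>\<^sup>+y. A y * ennreal (e2 y) \<partial>lborel)"
    by (simp only: ennreal_add_left_cancel_le) (simp add: ennreal_mult_eq_top_iff)
  have "(\<integral>\<^sup>+y. A y * ennreal (e2 y) \<partial>lborel)
     = (\<integral>\<^sup>+y. \<integral>\<^sup>+s. ennreal (H s) * indicator (segment_from_0 y) s * ennreal (e2 y) \<partial>lborel \<partial>lborel)"
    unfolding A_def by (simp add: nn_integral_multc)
  also have "\<dots> = (\<integral>\<^sup>+s. \<integral>\<^sup>+y. ennreal (H s) * indicator (segment_from_0 y) s * ennreal (e2 y) \<partial>lborel \<partial>lborel)"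
    by (rule lborel_pair.Fubini') measurable
  also have "\<dots> \<le> (\<integral>\<^sup>+s. ennreal (H s * e2 s) \<partial>lborel)"
  proof (rule nn_integral_mono)
    fix s :: real
    have "(\<integral>\<^sup>+y. ennreal (H s) * indicator (segment_from_0 y) s * ennreal (e2 y) \<partial>lborel)
       \<le> (\<integral>\<^sup>+y. ennreal (H s) * (ennreal (e2 s) * ennreal (exp (- (2 * pi) * (y - s)\<^sup>2))) \<partial>lborel)"
    proof (rule nn_integral_mono)
      fix y :: real
      have "e2 y \<le> e2 s * exp (- (2 * pi) * (y - s)\<^sup>2)" if "s \<in> segment_from_0 y"
      proof -
        have "0 \<le> s * (y - s)" using that by (auto simp: segment_from_0_def zero_le_mult_iff split: if_splits)
        then have "pi * 0 \<le> pi * (s * (y - s))" by (intro mult_left_mono) auto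
        then have "- (2 * pi) * y\<^sup>2 \<le> - (2 * pi) * s\<^sup>2 + - (2 * pi) * (y - s)\<^sup>2"
          by (simp add: power2_eq_square algebra_simps)
        then show ?thesis by (simp only: e2_def exp_add[symmetric] exp_le_cancel_iff)
      qed
      then show "ennreal (H s) * indicator (segment_from_0 y) s * ennreal (e2 y) \<le> ennreal (H s) * (ennreal (e2 s) * ennreal (exp (- (2 * pi) * (y - s)\<^sup>2)))"
        using e24 by (cases "s \<in> segment_from_0 y") (auto simp: ennreal_mult[symmetric] intro!: mult_left_mono ennreal_leI)
    qed
    also have "\<dots> = ennreal (H s) * (ennreal (e2 s) * ennreal (1 / sqrt 2))"
      using nn_integral_gaussian[of "2 * pi" s] by (simp add: nn_integral_cmult real_sqrt_divide)
    also have "\<dots> \<le> ennreal (H s) * (ennreal (e2 s) * ennreal 1)"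
      by (intro mult_left_mono ennreal_leI) auto
    also have "\<dots> = ennreal (H s * e2 s)" using e24 by (simp add: ennreal_mult'')
    finally show "(\<integral>\<^sup>+y. ennreal (H s) * indicator (segment_from_0 y) s * ennreal (e2 y) \<partial>lborel) \<le> ennreal (H s * e2 s)" .
  qed
  finally have "(\<integral>\<^sup>+y. A y * ennreal (e2 y) \<partial>lborel) \<le> (\<integral>\<^sup>+s. ennreal (H s * e2 s) \<partial>lborel)" .
  with 1 have "(\<integral>\<^sup>+y. ennreal (h y * e2 y) \<partial>lborel) \<le> (\<integral>\<^sup>+y. ennreal (h y * e4 y) \<partial>lborel) + (\<integral>\<^sup>+s. ennreal (H s * e2 s) \<partial>lborel)"
    by (meson add_left_mono order_trans)
  then show ?thesis by (simp add: e2_def e4_def mult_ac)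
qed

text \<open>
  The preceding comparison on every vertical line, with \<open>h = |F|\<^sup>2\<close> and \<open>|h'| \<le> 2 |F| |F'|\<close>. The free
  parameter \<open>\<theta>\<close> of the arithmetic-geometric mean inequality will be fitted to the energy that is
  available for \<open>F'\<close>.
\<close>

lemma strip_weight_comparison:
  fixes F :: "complex \<Rightarrow> complex" and V :: "real \<Rightarrow> real"
  assumes F: "F holomorphic_on UNIV" and V[measurable]: "V \<in> borel_measurable borel"
    and V0: "\<And>x. 0 \<le> V x" and VB: "\<And>x. V x \<le> B" and \<theta>: "\<theta> > 0"
  shows "(\<integral>\<^sup>+(x, y). ennreal (V x * (strip_density (2 * pi) F x y)) \<partial>lborel)
     \<le> (\<integral>\<^sup>+(x, y). ennreal (V x * (sqrt 2 * (cmod (F (Complex x y)))\<^sup>2 * exp (- (4 * pi) * y\<^sup>2))) \<partial>lborel)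
      + ennreal B * (ennreal \<theta> * strip_mass (2 * pi) F + ennreal (1 / \<theta>) * strip_mass (2 * pi) (deriv F))"
proof -
  note Fm[measurable] = holomorphic_borel_measurable[OF F]
  have F': "deriv F holomorphic_on UNIV" using F by (rule holomorphic_deriv) simp
  note F'm[measurable] = holomorphic_borel_measurable[OF F']
  have B0: "0 \<le> B" using V0 VB order_trans by blast
  have "(\<integral>\<^sup>+(x, y). ennreal (V x * (strip_density (2 * pi) F x y)) \<partial>lborel)
    = (\<integral>\<^sup>+x. \<integral>\<^sup>+y. ennreal (V x * (strip_density (2 * pi) F x y)) \<partial>lborel \<partial>lborel)"
  proof -
    have "(\<lambda>(x, y). ennreal (V x * (strip_density (2 * pi) F x y))) \<in> borel_measurable (borel :: (real \<times> real) measure)"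
      unfolding borel_prod[symmetric] by measurable
    from nn_integral_plane_iterated[OF this] show ?thesis by simp
  qed
  also have "\<dots> \<le> (\<integral>\<^sup>+x. (\<integral>\<^sup>+y. ennreal (V x * (sqrt 2 * (cmod (F (Complex x y)))\<^sup>2 * exp (- (4 * pi) * y\<^sup>2))) \<partial>lborel)
      + ennreal B * (ennreal \<theta> * (\<integral>\<^sup>+y. ennreal (strip_density (2 * pi) F x y) \<partial>lborel)
         + ennreal (1 / \<theta>) * (\<integral>\<^sup>+y. ennreal (strip_density (2 * pi) (deriv F) x y) \<partial>lborel)) \<partial>lborel)"
  proof (rule nn_integral_mono)
    fix x :: real
    define h where "h y = (cmod (F (Complex x y)))\<^sup>2" for y
    define h' where "h' y = 2 * (F (Complex x y) \<bullet> (\<i> * deriv F (Complex x y)))" for y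
    define H where "H y = \<theta> * (cmod (F (Complex x y)))\<^sup>2 + 1 / \<theta> * (cmod (deriv F (Complex x y)))\<^sup>2" for y
    have hd: "(h has_real_derivative h' y) (at y)" for y
    proof -
      have "((\<lambda>y. Complex x y) has_vector_derivative \<i>) (at y)"
        unfolding Complex_eq by (auto intro!: derivative_eq_intros simp: has_vector_derivative_real_field)
      moreover have "(F has_field_derivative deriv F (Complex x y)) (at (Complex x y))"
        using F by (metis UNIV_I holomorphic_derivI open_UNIV)
      ultimately have "((\<lambda>y. F (Complex x y)) has_vector_derivative \<i> * deriv F (Complex x y)) (at y)"
        using field_vector_diff_chain_at[of "Complex x" \<i> y F] by (simp add: comp_def)
      then have "((\<lambda>y. F (Complex x y)) has_derivative (\<lambda>t. t *\<^sub>R (\<i> * deriv F (Complex x y)))) (at y)"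
        by (simp add: has_vector_derivative_def)
      from has_derivative_inner[OF this this]
      have "((\<lambda>y. F (Complex x y) \<bullet> F (Complex x y)) has_derivative (\<lambda>t. t * h' y)) (at y)"
        by (simp add: h'_def inner_commute algebra_simps)
      then show ?thesis
        unfolding has_field_derivative_def h_def power2_norm_eq_inner by (simp add: mult.commute[of _ "h' y"])
    qed
    have Hh: "\<bar>h' y\<bar> \<le> H y" for y
    proof -
      define a b where "a = cmod (F (Complex x y))" and "b = cmod (deriv F (Complex x y))"
      have "\<bar>h' y\<bar> \<le> 2 * (a * b)"
        using Cauchy_Schwarz_ineq2[of "F (Complex x y)" "\<i> * deriv F (Complex x y)"] by (simp add: h'_def a_def b_def norm_mult)
      also have "\<dots> \<le> \<theta> * a\<^sup>2 + 1 / \<theta> * b\<^sup>2"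
      proof -
        have "0 \<le> (\<theta> * a - b)\<^sup>2 / \<theta>" using \<theta> by simp
        also have "\<dots> = \<theta> * a\<^sup>2 + 1 / \<theta> * b\<^sup>2 - 2 * (a * b)"
          using \<theta> by (simp add: field_simps power2_eq_square)
        finally show ?thesis by simp
      qed
      finally show ?thesis by (simp add: H_def a_def b_def)
    qed
    have contC: "continuous_on UNIV (Complex x)" unfolding Complex_eq by (intro continuous_intros)
    have cont: "continuous_on UNIV H"
      unfolding H_def by (intro continuous_intros continuous_on_compose2[OF holomorphic_on_imp_continuous_on[OF F] contC]
        continuous_on_compose2[OF holomorphic_on_imp_continuous_on[OF F'] contC]) auto
    have "(\<integral>\<^sup>+y. ennreal (V x * (strip_density (2 * pi) F x y)) \<partial>lborel)
        = ennreal (V x) * (\<integral>\<^sup>+y. ennreal (h y * exp (- (2 * pi) * y\<^sup>2)) \<partial>lborel)"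
      unfolding h_def by (simp add: ennreal_mult V0 nn_integral_cmult)
    also have "\<dots> \<le> ennreal (V x) * ((\<integral>\<^sup>+y. ennreal (sqrt 2 * h y * exp (- (4 * pi) * y\<^sup>2)) \<partial>lborel) + (\<integral>\<^sup>+y. ennreal (H y * exp (- (2 * pi) * y\<^sup>2)) \<partial>lborel))"
      by (intro mult_left_mono gaussian_width_comparison[OF hd Hh cont]) (auto simp: h_def)
    also have "\<dots> \<le> ennreal (V x) * (\<integral>\<^sup>+y. ennreal (sqrt 2 * h y * exp (- (4 * pi) * y\<^sup>2)) \<partial>lborel)
       + ennreal B * (\<integral>\<^sup>+y. ennreal (H y * exp (- (2 * pi) * y\<^sup>2)) \<partial>lborel)"
      unfolding distrib_left by (intro add_left_mono mult_right_mono ennreal_leI VB) simp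
    also have "(\<integral>\<^sup>+y. ennreal (H y * exp (- (2 * pi) * y\<^sup>2)) \<partial>lborel)
       = ennreal \<theta> * (\<integral>\<^sup>+y. ennreal (strip_density (2 * pi) F x y) \<partial>lborel)
         + ennreal (1 / \<theta>) * (\<integral>\<^sup>+y. ennreal (strip_density (2 * pi) (deriv F) x y) \<partial>lborel)"
    proof -
      have "ennreal (H y * exp (- (2 * pi) * y\<^sup>2)) = ennreal \<theta> * ennreal (strip_density (2 * pi) F x y)
         + ennreal (1 / \<theta>) * ennreal (strip_density (2 * pi) (deriv F) x y)" for y
        using \<theta> by (simp add: H_def ennreal_mult[symmetric] ennreal_plus[symmetric] distrib_right mult.assoc del: ennreal_plus)
      then show ?thesis by (simp add: nn_integral_add nn_integral_cmult)
    qed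
    also have "ennreal (V x) * (\<integral>\<^sup>+y. ennreal (sqrt 2 * h y * exp (- (4 * pi) * y\<^sup>2)) \<partial>lborel)
      = (\<integral>\<^sup>+y. ennreal (V x * (sqrt 2 * (cmod (F (Complex x y)))\<^sup>2 * exp (- (4 * pi) * y\<^sup>2))) \<partial>lborel)"
      unfolding h_def by (simp add: ennreal_mult V0 nn_integral_cmult)
    finally show "(\<integral>\<^sup>+y. ennreal (V x * (strip_density (2 * pi) F x y)) \<partial>lborel)
     \<le> (\<integral>\<^sup>+y. ennreal (V x * (sqrt 2 * (cmod (F (Complex x y)))\<^sup>2 * exp (- (4 * pi) * y\<^sup>2))) \<partial>lborel)
      + ennreal B * (ennreal \<theta> * (\<integral>\<^sup>+y. ennreal (strip_density (2 * pi) F x y) \<partial>lborel)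
         + ennreal (1 / \<theta>) * (\<integral>\<^sup>+y. ennreal (strip_density (2 * pi) (deriv F) x y) \<partial>lborel))" .
  qed
  also have "\<dots> = (\<integral>\<^sup>+x. \<integral>\<^sup>+y. ennreal (V x * (sqrt 2 * (cmod (F (Complex x y)))\<^sup>2 * exp (- (4 * pi) * y\<^sup>2))) \<partial>lborel \<partial>lborel)
      + ennreal B * (ennreal \<theta> * strip_mass (2 * pi) F + ennreal (1 / \<theta>) * strip_mass (2 * pi) (deriv F))"
    unfolding strip_mass_iterated[OF Fm] strip_mass_iterated[OF F'm]
    by (simp add: nn_integral_add nn_integral_cmult)
  also have "(\<integral>\<^sup>+x. \<integral>\<^sup>+y. ennreal (V x * (sqrt 2 * (cmod (F (Complex x y)))\<^sup>2 * exp (- (4 * pi) * y\<^sup>2))) \<partial>lborel \<partial>lborel)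
    = (\<integral>\<^sup>+(x, y). ennreal (V x * (sqrt 2 * (cmod (F (Complex x y)))\<^sup>2 * exp (- (4 * pi) * y\<^sup>2))) \<partial>lborel)"
  proof -
    have "(\<lambda>(x, y). ennreal (V x * (sqrt 2 * (cmod (F (Complex x y)))\<^sup>2 * exp (- (4 * pi) * y\<^sup>2)))) \<in> borel_measurable (borel :: (real \<times> real) measure)"
      unfolding borel_prod[symmetric] by measurable
    from nn_integral_plane_iterated[OF this] show ?thesis by simp
  qed
  finally show ?thesis .
qed

section \<open>The one-dimensional problem and its Thomas--Fermi profile\<close>

text \<open>
  This radius gives the density below total mass one.
\<close>

definition tf_radius :: "real \<Rightarrow> real" where
  "tf_radius G = root 3 (3 * G / 2)"

definition tf_density :: "real \<Rightarrow> real \<Rightarrow> real" where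
  "tf_density G t = max 0 ((tf_radius G)\<^sup>2 - t\<^sup>2) / (2 * G)"

text \<open>
  The minimal one-dimensional energy, in the form in which it appears when the square is completed:
  \<open>T\<^sup>2 / 2\<close> is the Lagrange multiplier of the mass constraint.
\<close>

definition tf_energy :: "real \<Rightarrow> real" where
  "tf_energy G = (tf_radius G)\<^sup>2 / 2 - G / 2 * (LINT t|lborel. (tf_density G t)\<^sup>2)"

lemma tf_radius_pos: "G > 0 \<Longrightarrow> tf_radius G > 0"
  by (simp add: tf_radius_def)

lemma tf_radius_cube: "G > 0 \<Longrightarrow> tf_radius G ^ 3 = 3 * G / 2"
  by (simp add: tf_radius_def)

lemma tf_density_nonneg: "G > 0 \<Longrightarrow> 0 \<le> tf_density G t"
  by (simp add: tf_density_def)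

lemma tf_density_le: "G > 0 \<Longrightarrow> G * tf_density G t \<le> (tf_radius G)\<^sup>2 / 2"
  by (simp add: tf_density_def max_def)

lemma tf_density_outside: "G > 0 \<Longrightarrow> \<bar>t\<bar> > tf_radius G \<Longrightarrow> tf_density G t = 0"
  using power_strict_mono[of "tf_radius G" "\<bar>t\<bar>" 2] tf_radius_pos[of G] by (simp add: tf_density_def max_def)

lemma continuous_tf_density: "continuous_on S (tf_density G)"
  unfolding tf_density_def[abs_def] divide_inverse by (intro continuous_intros)

lemma borel_measurable_tf_density[measurable]: "tf_density G \<in> borel_measurable borel"
  by (rule borel_measurable_continuous_onI[OF continuous_tf_density])

text \<open>
  The Euler equation of the one-dimensional problem, which is an inequality outside the support.
\<close>

lemma tf_equilibrium:
  assumes "G > 0"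
  shows "(tf_radius G)\<^sup>2 / 2 \<le> t\<^sup>2 / 2 + G * tf_density G t"
    and "(t\<^sup>2 / 2 + G * tf_density G t) * tf_density G t = (tf_radius G)\<^sup>2 / 2 * tf_density G t"
proof -
  have "G * (max 0 ((tf_radius G)\<^sup>2 - t\<^sup>2) / (2 * G)) = max 0 ((tf_radius G)\<^sup>2 - t\<^sup>2) / 2"
    using assms by simp
  then show "(tf_radius G)\<^sup>2 / 2 \<le> t\<^sup>2 / 2 + G * tf_density G t"
    "(t\<^sup>2 / 2 + G * tf_density G t) * tf_density G t = (tf_radius G)\<^sup>2 / 2 * tf_density G t"
    unfolding tf_density_def by (auto simp: max_def add_divide_distrib[symmetric])
qed

lemma integrable_continuous_compact_support:
  fixes f :: "real \<Rightarrow> real"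
  assumes "continuous_on UNIV f" "\<And>t. \<bar>t\<bar> > T \<Longrightarrow> f t = 0"
  shows "integrable lborel f"
proof -
  have "integrable lborel (\<lambda>x. indicator {-T..T} x *\<^sub>R f x)"
    by (intro borel_integrable_compact continuous_on_subset[OF assms(1)]) auto
  moreover have "(\<lambda>x. indicator {-T..T} x *\<^sub>R f x) = f"
  proof
    fix x
    show "indicator {-T..T} x *\<^sub>R f x = f x" by (cases "\<bar>x\<bar> > T") (auto simp: assms(2) indicator_def)
  qed
  ultimately show ?thesis by simp
qed

lemma integrable_mult_tf_density:
  assumes "G > 0" "continuous_on UNIV f"
  shows "integrable lborel (\<lambda>t. f t * tf_density G t)"
  by (rule integrable_continuous_compact_support[where T="tf_radius G"])
    (auto intro!: continuous_intros assms continuous_tf_density simp: tf_density_outside assms(1))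

lemma integrable_tf_density: "G > 0 \<Longrightarrow> integrable lborel (tf_density G)"
  using integrable_mult_tf_density[of G "\<lambda>_. 1"] by simp

lemma integrable_tf_density_square: "G > 0 \<Longrightarrow> integrable lborel (\<lambda>t. (tf_density G t)\<^sup>2)"
  using integrable_mult_tf_density[of G "tf_density G"] continuous_tf_density by (simp add: power2_eq_square)

lemma integral_tf_density:
  assumes G: "G > 0" shows "(LINT t|lborel. tf_density G t) = 1"
proof -
  define T where "T = tf_radius G"
  have T: "T > 0" "T ^ 3 = 3 * G / 2" using tf_radius_pos[OF G] tf_radius_cube[OF G] by (auto simp: T_def)
  define P where "P t = (T\<^sup>2 * t - t ^ 3 / 3) / (2 * G)" for t
  have "has_bochner_integral lborel (\<lambda>t. (T\<^sup>2 - t\<^sup>2) / (2 * G) * indicator {-T..T} t) (P T - P (- T))"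
    using T G unfolding P_def
    by (intro has_bochner_integral_FTC_Icc_real)
      (auto intro!: derivative_eq_intros continuous_intros simp: field_simps power2_eq_square)
  moreover have "(\<lambda>t. (T\<^sup>2 - t\<^sup>2) / (2 * G) * indicator {-T..T} t) = tf_density G"
  proof
    fix t
    show "(T\<^sup>2 - t\<^sup>2) / (2 * G) * indicator {-T..T} t = tf_density G t"
    proof (cases "\<bar>t\<bar> \<le> T")
      case True
      then have "t\<^sup>2 \<le> T\<^sup>2" using abs_le_square_iff[of t T] T by simp
      then show ?thesis using True by (auto simp: tf_density_def T_def[symmetric] max_def indicator_def)
    next
      case False
      then show ?thesis using tf_density_outside[OF G, of t] by (auto simp: T_def indicator_def)
    qed
  qed
  moreover have "P T - P (- T) = 1"
  proof -
    have "P T - P (- T) = (2 * (T ^ 3 - T ^ 3 / 3)) / (2 * G)"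
      unfolding P_def by (simp add: power2_eq_square power3_eq_cube diff_divide_distrib[symmetric])
    also have "\<dots> = 1" using G T by simp
    finally show ?thesis .
  qed
  ultimately have "has_bochner_integral lborel (tf_density G) 1" by (simp only:)
  then show ?thesis by (rule has_bochner_integral_integral_eq)
qed

lemma tf_energy_eq:
  assumes G: "G > 0"
  shows "tf_energy G = (LINT t|lborel. t\<^sup>2 / 2 * tf_density G t) + G / 2 * (LINT t|lborel. (tf_density G t)\<^sup>2)"
proof -
  have "(LINT t|lborel. t\<^sup>2 / 2 * tf_density G t) + G * (LINT t|lborel. (tf_density G t)\<^sup>2)
     = (LINT t|lborel. t\<^sup>2 / 2 * tf_density G t + G * (tf_density G t)\<^sup>2)"
    by (subst Bochner_Integration.integral_add)
      (auto intro!: integrable_mult_tf_density integrable_tf_density_square G continuous_intros)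
  also have "\<dots> = (LINT t|lborel. (tf_radius G)\<^sup>2 / 2 * tf_density G t)"
    unfolding tf_equilibrium(2)[OF G, symmetric] by (intro Bochner_Integration.integral_cong) (auto simp: power2_eq_square algebra_simps)
  also have "\<dots> = (tf_radius G)\<^sup>2 / 2" by (simp add: integral_tf_density[OF G])
  finally show ?thesis by (simp add: tf_energy_def)
qed

lemma tf_energy_nonneg: "G > 0 \<Longrightarrow> 0 \<le> tf_energy G"
  unfolding tf_energy_eq by (intro add_nonneg_nonneg mult_nonneg_nonneg Bochner_Integration.integral_nonneg)
    (auto simp: tf_density_nonneg)

lemma Lnorm_eq_1_iff:
  "q > 0 \<Longrightarrow> Lnorm q u = 1 \<longleftrightarrow> (LINT x|lborel. norm (u x) ^ q) = 1"
  by (simp add: Lnorm_def)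

lemma J_energy_eq:
  assumes G: "G > 0" and p: "p \<in> Lspace 4" and i: "integrable lborel (\<lambda>t. t\<^sup>2 * (p t)\<^sup>2)"
  shows "J_energy G p = ennreal (1 / 2 * (LINT t|lborel. t\<^sup>2 * (p t)\<^sup>2) + G / 2 * (LINT t|lborel. p t ^ 4))"
proof -
  have p4: "integrable lborel (\<lambda>t. p t ^ 4)" using p by (simp add: Lspace_def)
  have "ennreal (1 / 2 * a + G / 2 * b) = ennreal (1 / 2) * ennreal a + ennreal (G / 2) * ennreal b" if "0 \<le> a" "0 \<le> b" for a b
  proof -
    have "ennreal (1 / 2 * a + G / 2 * b) = ennreal (1 / 2 * a) + ennreal (G / 2 * b)"
      using that G by (intro ennreal_plus) simp_all
    then show ?thesis using ennreal_mult'[of "1 / 2" a] ennreal_mult'[of "G / 2" b] G by (simp only:)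
  qed
  then show ?thesis unfolding J_energy_def nn_integral_eq_integral[OF i AE_I2, simplified]
    nn_integral_eq_integral[OF p4 AE_I2, simplified]
    by (simp add: Bochner_Integration.integral_nonneg del: times_divide_eq_left)
qed

text \<open>
  Completing the square in the density: the part linear in \<open>p\<^sup>2\<close> has the coefficient
  \<open>t\<^sup>2 / 2 + G \<rho>(t)\<close>, where \<open>\<rho>\<close> is the Thomas--Fermi density, and by the Euler inequality this is
  at least \<open>T\<^sup>2 / 2\<close>.
\<close>

lemma J_energy_ge:
  assumes G: "G > 0" and p: "p \<in> Lspace 2 \<inter> Lspace 4" "Lnorm 2 p = 1"
  shows "integrable lborel (\<lambda>t. ((p t)\<^sup>2 - tf_density G t)\<^sup>2)"
    and "ennreal (tf_energy G + G / 2 * (LINT t|lborel. ((p t)\<^sup>2 - tf_density G t)\<^sup>2)) \<le> J_energy G p"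
proof -
  have pm[measurable]: "p \<in> borel_measurable borel" and p2: "integrable lborel (\<lambda>t. (p t)\<^sup>2)" and p4: "integrable lborel (\<lambda>t. p t ^ 4)"
    using p by (auto simp: Lspace_def)
  have mass: "(LINT t|lborel. (p t)\<^sup>2) = 1" using p(2) by (simp add: Lnorm_eq_1_iff)
  have r2: "integrable lborel (\<lambda>t. (tf_density G t)\<^sup>2)" by (rule integrable_tf_density_square[OF G])
  show int: "integrable lborel (\<lambda>t. ((p t)\<^sup>2 - tf_density G t)\<^sup>2)"
  proof (rule Bochner_Integration.integrable_bound)
    show "integrable lborel (\<lambda>t. 2 * p t ^ 4 + 2 * (tf_density G t)\<^sup>2)" using p4 r2 by simp
    show "AE t in lborel. norm (((p t)\<^sup>2 - tf_density G t)\<^sup>2) \<le> norm (2 * p t ^ 4 + 2 * (tf_density G t)\<^sup>2)"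
    proof (rule AE_I2)
      fix t
      have "0 \<le> ((p t)\<^sup>2 + tf_density G t)\<^sup>2" by simp
      then have "((p t)\<^sup>2 - tf_density G t)\<^sup>2 \<le> 2 * p t ^ 4 + 2 * (tf_density G t)\<^sup>2"
        by (simp add: power2_eq_square power4_eq_xxxx algebra_simps)
      then show "norm (((p t)\<^sup>2 - tf_density G t)\<^sup>2) \<le> norm (2 * p t ^ 4 + 2 * (tf_density G t)\<^sup>2)" by simp
    qed
  qed measurable
  show "ennreal (tf_energy G + G / 2 * (LINT t|lborel. ((p t)\<^sup>2 - tf_density G t)\<^sup>2)) \<le> J_energy G p"
  proof (cases "J_energy G p = \<infinity>")
    case False
    have "(\<integral>\<^sup>+t. ennreal (t\<^sup>2 * (p t)\<^sup>2) \<partial>lborel) \<noteq> \<infinity>"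
      using False by (auto simp: J_energy_def ennreal_mult_eq_top_iff)
    then have i: "integrable lborel (\<lambda>t. t\<^sup>2 * (p t)\<^sup>2)"
      by (intro integrableI_nonneg) (auto simp: less_top)
    have "tf_energy G + G / 2 * (LINT t|lborel. ((p t)\<^sup>2 - tf_density G t)\<^sup>2)
       = (LINT t|lborel. (tf_radius G)\<^sup>2 / 2 * (p t)\<^sup>2 - G / 2 * (tf_density G t)\<^sup>2 + G / 2 * ((p t)\<^sup>2 - tf_density G t)\<^sup>2)"
      using p2 r2 int mass by (simp add: tf_energy_def)
    also have "\<dots> \<le> (LINT t|lborel. 1 / 2 * (t\<^sup>2 * (p t)\<^sup>2) + G / 2 * p t ^ 4)"
    proof (rule integral_mono)
      fix t
      have "(tf_radius G)\<^sup>2 / 2 * (p t)\<^sup>2 \<le> (t\<^sup>2 / 2 + G * tf_density G t) * (p t)\<^sup>2"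
        by (intro mult_right_mono tf_equilibrium G) simp
      then show "(tf_radius G)\<^sup>2 / 2 * (p t)\<^sup>2 - G / 2 * (tf_density G t)\<^sup>2 + G / 2 * ((p t)\<^sup>2 - tf_density G t)\<^sup>2
          \<le> 1 / 2 * (t\<^sup>2 * (p t)\<^sup>2) + G / 2 * p t ^ 4"
        by (simp add: power2_eq_square power4_eq_xxxx algebra_simps)
    qed (use p2 p4 r2 i int in auto)
    also have "\<dots> = 1 / 2 * (LINT t|lborel. t\<^sup>2 * (p t)\<^sup>2) + G / 2 * (LINT t|lborel. p t ^ 4)"
      using i p4 by simp
    finally show ?thesis using J_energy_eq[OF G _ i] p by (simp add: ennreal_leI)
  qed simp
qed

definition tf_profile :: "real \<Rightarrow> real \<Rightarrow> real" where
  "tf_profile G t = sqrt (tf_density G t)"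

lemma borel_measurable_tf_profile[measurable]: "tf_profile G \<in> borel_measurable borel"
  unfolding tf_profile_def[abs_def] by measurable

lemma tf_profile_square: "G > 0 \<Longrightarrow> (tf_profile G t)\<^sup>2 = tf_density G t"
  by (simp add: tf_profile_def tf_density_nonneg)

lemma tf_profile_power4: "G > 0 \<Longrightarrow> tf_profile G t ^ 4 = (tf_density G t)\<^sup>2"
  using tf_profile_square[of G t] by (metis mult_2 numeral_Bit0 power2_eq_square power_add)

lemma tf_profile_in_Lspace:
  assumes G: "G > 0"
  shows "tf_profile G \<in> Lspace 2 \<inter> Lspace 4" "Lnorm 2 (tf_profile G) = 1"
  using integrable_tf_density[OF G] integrable_tf_density_square[OF G] integral_tf_density[OF G]
  by (simp_all add: Lspace_def Lnorm_eq_1_iff tf_profile_square tf_profile_power4 G)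

lemma J_energy_tf_profile:
  assumes G: "G > 0" shows "J_energy G (tf_profile G) = ennreal (tf_energy G)"
proof -
  have "integrable lborel (\<lambda>t. t\<^sup>2 * (tf_profile G t)\<^sup>2)"
    unfolding tf_profile_square[OF G] by (intro integrable_mult_tf_density G continuous_intros)
  from J_energy_eq[OF G _ this] show ?thesis
    using tf_profile_in_Lspace[OF G] by (simp add: tf_profile_square tf_profile_power4 G tf_energy_eq)
qed

lemma J_inf_eq:
  assumes G: "G > 0" shows "J_inf G = ennreal (tf_energy G)"
proof (rule antisym)
  show "J_inf G \<le> ennreal (tf_energy G)"
    unfolding J_inf_def J_energy_tf_profile[OF G, symmetric]
    by (rule INF_lower) (use tf_profile_in_Lspace[OF G] in auto)
  show "ennreal (tf_energy G) \<le> J_inf G"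
    unfolding J_inf_def
  proof (rule INF_greatest)
    fix p :: "real \<Rightarrow> real" assume p: "p \<in> {p \<in> Lspace 2 \<inter> Lspace 4. Lnorm 2 p = 1}"
    have "ennreal (tf_energy G) \<le> ennreal (tf_energy G + G / 2 * (LINT t|lborel. ((p t)\<^sup>2 - tf_density G t)\<^sup>2))"
      using G by (intro ennreal_leI) (simp add: Bochner_Integration.integral_nonneg)
    also have "\<dots> \<le> J_energy G p" using J_energy_ge(2)[OF G] p by blast
    finally show "ennreal (tf_energy G) \<le> J_energy G p" .
  qed
qed

lemma J_nonneg_minimizer_tf_profile: "G > 0 \<Longrightarrow> J_nonneg_minimizer G (tf_profile G)"
  using tf_profile_in_Lspace[of G] J_energy_tf_profile[of G] J_inf_eq[of G]
  by (simp add: J_nonneg_minimizer_def tf_profile_def tf_density_nonneg)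

lemma J_nonneg_minimizer_unique:
  assumes G: "G > 0" and q: "J_nonneg_minimizer G q"
  shows "AE t in lborel. q t = tf_profile G t"
proof -
  let ?I = "LINT t|lborel. ((q t)\<^sup>2 - tf_density G t)\<^sup>2"
  have q': "q \<in> Lspace 2 \<inter> Lspace 4" "Lnorm 2 q = 1" "J_energy G q = ennreal (tf_energy G)" "AE t in lborel. 0 \<le> q t"
    using q J_inf_eq[OF G] by (auto simp: J_nonneg_minimizer_def)
  have "tf_energy G + G / 2 * ?I \<le> tf_energy G"
    using J_energy_ge(2)[OF G q'(1,2)] unfolding q'(3) using tf_energy_nonneg[OF G] by (simp add: ennreal_le_iff)
  then have "?I \<le> 0" using G by (simp add: mult_le_0_iff)
  moreover have "0 \<le> ?I" by (simp add: Bochner_Integration.integral_nonneg)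
  ultimately have "?I = 0" by simp
  then have "AE t in lborel. ((q t)\<^sup>2 - tf_density G t)\<^sup>2 = 0"
    using integral_nonneg_eq_0_iff_AE[OF J_energy_ge(1)[OF G q'(1,2)]] by simp
  then show ?thesis using q'(4)
  proof eventually_elim
    case (elim t)
    then have "tf_density G t = (q t)\<^sup>2" by simp
    then show ?case using elim by (simp add: tf_profile_def)
  qed
qed

section \<open>Product densities in the plane\<close>

lemma nn_integral_plane_product:
  fixes f g :: "real \<Rightarrow> ennreal"
  assumes [measurable]: "f \<in> borel_measurable borel" "g \<in> borel_measurable borel"
  shows "(\<integral>\<^sup>+(x, y). f x * g y \<partial>lborel) = (\<integral>\<^sup>+x. f x \<partial>lborel) * (\<integral>\<^sup>+y. g y \<partial>lborel)"
proof -
  have "(\<lambda>(x, y). f x * g y) \<in> borel_measurable (borel :: (real \<times> real) measure)"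
    unfolding borel_prod[symmetric] by measurable
  from nn_integral_plane_iterated[OF this] show ?thesis
    by (simp add: nn_integral_cmult nn_integral_multc)
qed

lemma has_bochner_integral_plane_product:
  fixes f g :: "real \<Rightarrow> real"
  assumes f: "has_bochner_integral lborel f a" "\<And>x. 0 \<le> f x" and g: "has_bochner_integral lborel g b" "\<And>x. 0 \<le> g x"
  shows "has_bochner_integral lborel (\<lambda>(x, y). f x * g y) (a * b)"
proof -
  have [measurable]: "f \<in> borel_measurable borel" "g \<in> borel_measurable borel"
    using f(1) g(1) by (auto simp: has_bochner_integral_iff)
  have ab: "0 \<le> a" "0 \<le> b"
    using f g by (auto simp: has_bochner_integral_iff intro!: Bochner_Integration.integral_nonneg)
  have If: "(\<integral>\<^sup>+x. ennreal (f x) \<partial>lborel) = ennreal a"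
    using f by (subst nn_integral_eq_integral) (auto simp: has_bochner_integral_iff)
  have Ig: "(\<integral>\<^sup>+x. ennreal (g x) \<partial>lborel) = ennreal b"
    using g by (subst nn_integral_eq_integral) (auto simp: has_bochner_integral_iff)
  show ?thesis
  proof (rule has_bochner_integral_nn_integral)
    show "(\<lambda>(x, y). f x * g y) \<in> borel_measurable (lborel :: (real \<times> real) measure)"
      unfolding lborel_prod[symmetric] by measurable
    have "(\<integral>\<^sup>+p. ennreal (case p of (x, y) \<Rightarrow> f x * g y) \<partial>lborel) = (\<integral>\<^sup>+(x, y). ennreal (f x) * ennreal (g y) \<partial>lborel)"
      using f(2) g(2) by (intro nn_integral_cong) (auto simp: ennreal_mult)
    then show "(\<integral>\<^sup>+p. ennreal (case p of (x, y) \<Rightarrow> f x * g y) \<partial>lborel) = ennreal (a * b)"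
      using ab by (simp add: nn_integral_plane_product If Ig ennreal_mult)
  qed (use f(2) g(2) ab in auto)
qed

lemma has_bochner_integral_dilation:
  fixes f :: "real \<Rightarrow> real"
  assumes "has_bochner_integral lborel f a" "L > 0"
  shows "has_bochner_integral lborel (\<lambda>x. f (L * x)) (a / L)"
  using assms lborel_has_bochner_integral_real_affine_iff[of L f a 0] by (simp add: divide_inverse mult.commute)

section \<open>The lowest Landau level as weighted entire functions\<close>

lemma cmod_exp_square:
  "cmod (exp (of_real c * (Complex x y)\<^sup>2)) = exp (c * (x\<^sup>2 - y\<^sup>2))"
  by (simp add: power2_eq_square)

text \<open>
  Since \<open>|exp (- pi z\<^sup>2 / 2)| = exp (- pi (x\<^sup>2 - y\<^sup>2) / 2)\<close>, multiplying the holomorphic factor by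
  this exponential moves the whole Gaussian onto the second variable.
\<close>

lemma Lambda0_strip_representation:
  assumes "u \<in> Lambda0"
  obtains F where "F holomorphic_on UNIV" "\<And>x y. cmod (u (x, y)) = cmod (F (Complex x y)) * exp (- pi * y\<^sup>2)"
proof -
  obtain f where f: "f holomorphic_on UNIV"
    and u: "\<And>x1 x2. u (x1, x2) = f (Complex x1 x2) * of_real (exp (- pi * (cmod (Complex x1 x2))\<^sup>2 / 2))"
    using assms by (auto simp: Lambda0_def)
  define F where "F z = f z * exp (of_real (- pi / 2) * z\<^sup>2)" for z
  have "F holomorphic_on UNIV" unfolding F_def by (intro holomorphic_intros f)
  moreover have "cmod (u (x, y)) = cmod (F (Complex x y)) * exp (- pi * y\<^sup>2)" for x y
  proof -
    have "- pi * (cmod (Complex x y))\<^sup>2 / 2 = - pi / 2 * (x\<^sup>2 - y\<^sup>2) + - pi * y\<^sup>2"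
      by (simp add: cmod_power2 field_simps)
    then show ?thesis unfolding u F_def norm_mult cmod_exp_square
      by (simp only: exp_add norm_of_real abs_mult abs_exp_cancel mult.assoc)
  qed
  ultimately show ?thesis by (rule that)
qed

lemma Lambda0_from_strip:
  fixes F :: "complex \<Rightarrow> complex"
  assumes F: "F holomorphic_on UNIV" and fin: "strip_mass (2 * pi) F < \<infinity>"
  obtains u where "u \<in> Lambda0" "\<And>x y. cmod (u (x, y)) = cmod (F (Complex x y)) * exp (- pi * y\<^sup>2)"
proof -
  note [measurable] = holomorphic_borel_measurable[OF F]
  define f where "f z = F z * exp (of_real (pi / 2) * z\<^sup>2)" for z
  define u where "u = (\<lambda>(x, y). f (Complex x y) * of_real (exp (- pi * (cmod (Complex x y))\<^sup>2 / 2)))"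
  have f: "f holomorphic_on UNIV" unfolding f_def by (intro holomorphic_intros F)
  note [measurable] = holomorphic_borel_measurable[OF f]
  have um: "u \<in> borel_measurable (borel :: (real \<times> real) measure)"
    unfolding u_def borel_prod[symmetric] by measurable
  have c: "cmod (u (x, y)) = cmod (F (Complex x y)) * exp (- pi * y\<^sup>2)" for x y
  proof -
    have "- pi * (cmod (Complex x y))\<^sup>2 / 2 = - (pi / 2 * (x\<^sup>2 - y\<^sup>2)) + - pi * y\<^sup>2"
      by (simp add: cmod_power2 field_simps)
    then show ?thesis unfolding u_def f_def prod.case norm_mult cmod_exp_square
      by (simp only: exp_add norm_of_real abs_mult abs_exp_cancel mult.assoc) (simp add: exp_minus)
  qed
  have "(cmod (u (x, y)))\<^sup>2 = strip_density (2 * pi) F x y" for x y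
    by (simp add: c power_mult_distrib exp_double[symmetric] mult.assoc)
  then have "(\<integral>\<^sup>+p. ennreal ((cmod (u p))\<^sup>2) \<partial>lborel) = strip_mass (2 * pi) F"
    unfolding strip_mass_def by (intro nn_integral_cong) auto
  then have "integrable lborel (\<lambda>p. (cmod (u p))\<^sup>2)"
    using um fin by (intro integrableI_nonneg) auto
  then have "u \<in> Lspace 2" using um by (simp add: Lspace_def)
  then have "u \<in> Lambda0" using f by (auto simp: Lambda0_def u_def)
  then show ?thesis using c by (rule that)
qed

section \<open>The lower bound for the planar energy\<close>

text \<open>
  The square of the limit profile in the original variables; \<open>L\<close> stands for \<open>\<epsilon>\<^bsup>2/3\<^esup>\<close>.
\<close>

definition planar_profile :: "real \<Rightarrow> real \<Rightarrow> real \<times> real \<Rightarrow> real" where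
  "planar_profile G L = (\<lambda>(x, y). L * tf_density G (L * x) * (sqrt 2 * exp (- (2 * pi) * y\<^sup>2)))"

lemma planar_profile_nonneg: "G > 0 \<Longrightarrow> L > 0 \<Longrightarrow> 0 \<le> planar_profile G L p"
  by (cases p) (simp add: planar_profile_def tf_density_nonneg)

lemma has_bochner_integral_planar_profile:
  assumes G: "G > 0" and L: "L > 0"
  shows "has_bochner_integral lborel (planar_profile G L) 1"
proof -
  have "has_bochner_integral lborel (tf_density G) 1"
    using integrable_tf_density[OF G] integral_tf_density[OF G] by (simp add: has_bochner_integral_iff)
  then have "has_bochner_integral lborel (\<lambda>x. L * tf_density G (L * x)) (L * (1 / L))"
    by (intro has_bochner_integral_mult_right has_bochner_integral_dilation L)
  moreover have "has_bochner_integral lborel (\<lambda>y. sqrt 2 * exp (- (2 * pi) * y\<^sup>2)) (sqrt 2 * sqrt (pi / (2 * pi)))"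
    using has_bochner_integral_gaussian[of "2 * pi" 0] by (intro has_bochner_integral_mult_right) simp
  ultimately have "has_bochner_integral lborel (planar_profile G L) (L * (1 / L) * (sqrt 2 * sqrt (pi / (2 * pi))))"
    unfolding planar_profile_def using G L by (intro has_bochner_integral_plane_product) (auto simp: tf_density_nonneg)
  then show ?thesis using L by (simp add: real_sqrt_divide)
qed

lemma has_bochner_integral_planar_profile_square:
  assumes G: "G > 0" and L: "L > 0"
  shows "has_bochner_integral lborel (\<lambda>p. (planar_profile G L p)\<^sup>2) (L * (LINT t|lborel. (tf_density G t)\<^sup>2))"
proof -
  define I where "I = (LINT t|lborel. (tf_density G t)\<^sup>2)"
  have "has_bochner_integral lborel (\<lambda>t. (tf_density G t)\<^sup>2) I"
    using integrable_tf_density_square[OF G] by (simp add: has_bochner_integral_iff I_def)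
  then have "has_bochner_integral lborel (\<lambda>x. L\<^sup>2 * (tf_density G (L * x))\<^sup>2) (L\<^sup>2 * (I / L))"
    by (intro has_bochner_integral_mult_right has_bochner_integral_dilation[where f="\<lambda>t. (tf_density G t)\<^sup>2"] L)
  moreover have "has_bochner_integral lborel (\<lambda>y. 2 * exp (- (4 * pi) * y\<^sup>2)) (2 * sqrt (pi / (4 * pi)))"
    using has_bochner_integral_gaussian[of "4 * pi" 0] by (intro has_bochner_integral_mult_right) simp
  ultimately have "has_bochner_integral lborel (\<lambda>(x, y). L\<^sup>2 * (tf_density G (L * x))\<^sup>2 * (2 * exp (- (4 * pi) * y\<^sup>2))) (L\<^sup>2 * (I / L) * (2 * sqrt (pi / (4 * pi))))"
    using G L by (intro has_bochner_integral_plane_product) auto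
  moreover have "(\<lambda>(x, y). L\<^sup>2 * (tf_density G (L * x))\<^sup>2 * (2 * exp (- (4 * pi) * y\<^sup>2))) = (\<lambda>p. (planar_profile G L p)\<^sup>2)"
    by (auto simp: planar_profile_def fun_eq_iff power_mult_distrib exp_double[symmetric])
  moreover have "L\<^sup>2 * (I / L) * (2 * sqrt (pi / (4 * pi))) = L * I"
    using L by (simp add: power2_eq_square real_sqrt_divide)
  ultimately show ?thesis by (simp only: I_def)
qed

lemma borel_measurable_planar_profile[measurable]: "planar_profile G L \<in> borel_measurable borel"
  unfolding planar_profile_def borel_prod[symmetric] by measurable

lemma energy_integrable:
  assumes e: "\<epsilon> > 0" "\<kappa> > 0" "G > 0" and um[measurable]: "u \<in> borel_measurable borel" and fin: "energy \<epsilon> \<kappa> G u < \<infinity>"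
  shows "integrable lborel (\<lambda>p. (fst p)\<^sup>2 * (cmod (u p))\<^sup>2)" "integrable lborel (\<lambda>p. (snd p)\<^sup>2 * (cmod (u p))\<^sup>2)"
    "integrable lborel (\<lambda>p. cmod (u p) ^ 4)"
    "energy \<epsilon> \<kappa> G u = ennreal (\<epsilon>\<^sup>2 / 2 * (LINT p|lborel. (fst p)\<^sup>2 * (cmod (u p))\<^sup>2)
        + \<kappa>\<^sup>2 / 2 * (LINT p|lborel. (snd p)\<^sup>2 * (cmod (u p))\<^sup>2) + G / 2 * (LINT p|lborel. cmod (u p) ^ 4))"
proof -
  define W where "W p = \<epsilon>\<^sup>2 / 2 * ((fst p)\<^sup>2 * (cmod (u p))\<^sup>2) + \<kappa>\<^sup>2 / 2 * ((snd p)\<^sup>2 * (cmod (u p))\<^sup>2) + G / 2 * cmod (u p) ^ 4" for p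
  have fsm[measurable]: "fst \<in> borel_measurable (borel :: (real \<times> real) measure)" "snd \<in> borel_measurable (borel :: (real \<times> real) measure)"
    by (auto intro!: borel_measurable_continuous_onI continuous_intros)
  have W0: "0 \<le> W p" for p unfolding W_def using e by (intro add_nonneg_nonneg mult_nonneg_nonneg) auto
  have Wm[measurable]: "W \<in> borel_measurable borel" unfolding W_def[abs_def] by measurable
  have eW: "energy \<epsilon> \<kappa> G u = (\<integral>\<^sup>+p. ennreal (W p) \<partial>lborel)"
    unfolding energy_def by (intro nn_integral_cong) (auto simp: W_def algebra_simps add_divide_distrib)
  have Wi: "integrable lborel W"
    using fin W0 unfolding eW by (intro integrableI_nonneg) auto
  have bound: "integrable lborel f" if [measurable]: "f \<in> borel_measurable borel" and f: "\<And>p. 0 \<le> f p" "\<And>p. c * f p \<le> W p" and c: "c > 0"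
    for f :: "real \<times> real \<Rightarrow> real" and c
  proof (rule Bochner_Integration.integrable_bound)
    show "integrable lborel (\<lambda>p. W p / c)" using Wi by simp
    show "AE p in lborel. norm (f p) \<le> norm (W p / c)"
      using f c W0 by (intro AE_I2) (simp add: field_simps)
  qed simp
  show i1: "integrable lborel (\<lambda>p. (fst p)\<^sup>2 * (cmod (u p))\<^sup>2)"
    by (rule bound[of _ "\<epsilon>\<^sup>2 / 2"]) (use e in \<open>auto simp: W_def\<close>)
  show i2: "integrable lborel (\<lambda>p. (snd p)\<^sup>2 * (cmod (u p))\<^sup>2)"
    by (rule bound[of _ "\<kappa>\<^sup>2 / 2"]) (use e in \<open>auto simp: W_def\<close>)
  show i3: "integrable lborel (\<lambda>p. cmod (u p) ^ 4)"
    by (rule bound[of _ "G / 2"]) (use e in \<open>auto simp: W_def\<close>)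
  have "energy \<epsilon> \<kappa> G u = ennreal (LINT p|lborel. W p)"
    unfolding eW by (rule nn_integral_eq_integral[OF Wi]) (simp add: W0)
  also have "(LINT p|lborel. W p) = \<epsilon>\<^sup>2 / 2 * (LINT p|lborel. (fst p)\<^sup>2 * (cmod (u p))\<^sup>2)
        + \<kappa>\<^sup>2 / 2 * (LINT p|lborel. (snd p)\<^sup>2 * (cmod (u p))\<^sup>2) + G / 2 * (LINT p|lborel. cmod (u p) ^ 4)"
    unfolding W_def using i1 i2 i3 by simp
  finally show "energy \<epsilon> \<kappa> G u = ennreal (\<epsilon>\<^sup>2 / 2 * (LINT p|lborel. (fst p)\<^sup>2 * (cmod (u p))\<^sup>2)
        + \<kappa>\<^sup>2 / 2 * (LINT p|lborel. (snd p)\<^sup>2 * (cmod (u p))\<^sup>2) + G / 2 * (LINT p|lborel. cmod (u p) ^ 4))" .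
qed

text \<open>
  The square is completed around \<open>planar_profile\<close>, whose quartic term couples to \<open>|u|\<^sup>2\<close> through the
  narrow weight \<open>\<surd>2 exp (- 4 pi y\<^sup>2)\<close>. Once this is replaced by the weight of \<open>u\<close>
  itself, the Euler inequality applies on every vertical line. Replacing it costs a multiple of
  \<open>F'\<close>, which the variance in \<open>y\<close> pays for.
\<close>

lemma energy_lower_bound:
  assumes e: "\<epsilon> > 0" "\<kappa> > 0" "G > 0" and u: "u \<in> Lambda0" "Lnorm 2 u = 1" and fin: "energy \<epsilon> \<kappa> G u < \<infinity>"
    and L: "L > 0" "L ^ 3 = \<epsilon>\<^sup>2"
  shows "integrable lborel (\<lambda>p. ((cmod (u p))\<^sup>2 - planar_profile G L p)\<^sup>2)"
    and "ennreal (\<kappa>\<^sup>2 / (8 * pi) + L * tf_energy G - 2 * pi\<^sup>2 * L\<^sup>2 * tf_radius G ^ 4 / \<kappa>\<^sup>2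
        + G / 2 * (LINT p|lborel. ((cmod (u p))\<^sup>2 - planar_profile G L p)\<^sup>2)) \<le> energy \<epsilon> \<kappa> G u"
proof -
  define \<rho> where "\<rho> p = (cmod (u p))\<^sup>2" for p
  define R where "R = planar_profile G L"
  define T where "T = tf_radius G"
  have T: "T > 0" using e tf_radius_pos by (simp add: T_def)
  have um[measurable]: "u \<in> borel_measurable borel" using u by (simp add: Lambda0_def Lspace_def)
  have \<rho>m[measurable]: "\<rho> \<in> borel_measurable borel" unfolding \<rho>_def[abs_def] by measurable
  have Rm[measurable]: "R \<in> borel_measurable borel" unfolding R_def by measurable
  have i\<rho>: "integrable lborel \<rho>" and mass: "(LINT p|lborel. \<rho> p) = 1"
    using u unfolding \<rho>_def[abs_def] by (auto simp: Lambda0_def Lspace_def Lnorm_eq_1_iff)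
  have \<rho>0: "0 \<le> \<rho> p" for p by (simp add: \<rho>_def)
  have R0: "0 \<le> R p" for p using e L by (simp add: R_def planar_profile_nonneg)
  have \<rho>4: "cmod (u p) ^ 4 = (\<rho> p)\<^sup>2" for p by (simp add: \<rho>_def flip: power_mult)
  note ei = energy_integrable[OF e um fin, folded \<rho>_def, unfolded \<rho>4]
  have iR2: "integrable lborel (\<lambda>p. (R p)\<^sup>2)" and IR2: "(LINT p|lborel. (R p)\<^sup>2) = L * (LINT t|lborel. (tf_density G t)\<^sup>2)"
    using has_bochner_integral_planar_profile_square[OF e(3) L(1)] by (auto simp: R_def has_bochner_integral_iff)
  have int: "integrable lborel (\<lambda>p. (\<rho> p - R p)\<^sup>2)"
  proof (rule Bochner_Integration.integrable_bound)
    show "integrable lborel (\<lambda>p. 2 * (\<rho> p)\<^sup>2 + 2 * (R p)\<^sup>2)" using ei(3) iR2 by simp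
    show "AE p in lborel. norm ((\<rho> p - R p)\<^sup>2) \<le> norm (2 * (\<rho> p)\<^sup>2 + 2 * (R p)\<^sup>2)"
    proof (rule AE_I2)
      fix p
      have "0 \<le> (\<rho> p + R p)\<^sup>2" by simp
      then have "(\<rho> p - R p)\<^sup>2 \<le> 2 * (\<rho> p)\<^sup>2 + 2 * (R p)\<^sup>2"
        by (simp add: power2_eq_square algebra_simps)
      then show "norm ((\<rho> p - R p)\<^sup>2) \<le> norm (2 * (\<rho> p)\<^sup>2 + 2 * (R p)\<^sup>2)" by simp
    qed
  qed measurable
  then show "integrable lborel (\<lambda>p. ((cmod (u p))\<^sup>2 - planar_profile G L p)\<^sup>2)" by (simp add: \<rho>_def R_def)
  have i\<rho>R: "integrable lborel (\<lambda>p. \<rho> p * R p)"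
  proof (rule Bochner_Integration.integrable_bound)
    show "integrable lborel (\<lambda>p. (\<rho> p)\<^sup>2 + (R p)\<^sup>2)" using ei(3) iR2 by simp
    show "AE p in lborel. norm (\<rho> p * R p) \<le> norm ((\<rho> p)\<^sup>2 + (R p)\<^sup>2)"
    proof (rule AE_I2)
      fix p
      have "0 \<le> (\<rho> p - R p)\<^sup>2" "0 \<le> \<rho> p * R p" using \<rho>0 R0 by simp_all
      then have "\<rho> p * R p \<le> (\<rho> p)\<^sup>2 + (R p)\<^sup>2"
        by (simp add: power2_eq_square algebra_simps)
      then show "norm (\<rho> p * R p) \<le> norm ((\<rho> p)\<^sup>2 + (R p)\<^sup>2)" using \<rho>0 R0 by simp
    qed
  qed measurable
  obtain F where F: "F holomorphic_on UNIV" and uF: "\<And>x y. cmod (u (x, y)) = cmod (F (Complex x y)) * exp (- pi * y\<^sup>2)"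
    using Lambda0_strip_representation[OF u(1)] by blast
  have \<rho>F: "\<rho> (x, y) = strip_density (2 * pi) F x y" for x y
    by (simp add: \<rho>_def uF power_mult_distrib exp_double[symmetric] mult.assoc)
  have massF: "strip_mass (2 * pi) F = 1"
    unfolding strip_mass_def \<rho>F[symmetric] using nn_integral_eq_integral[OF i\<rho>] \<rho>0 mass by (simp add: case_prod_unfold)
  define X where "X = (LINT p|lborel. (fst p)\<^sup>2 * \<rho> p)"
  define Y where "Y = (LINT p|lborel. (snd p)\<^sup>2 * \<rho> p)"
  have Y0: "0 \<le> Y" unfolding Y_def by (intro Bochner_Integration.integral_nonneg) (simp add: \<rho>0)
  have moment: "(\<integral>\<^sup>+(x, y). ennreal (y\<^sup>2 * (strip_density (2 * pi) F x y)) \<partial>lborel) = ennreal Y"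
    unfolding \<rho>F[symmetric] Y_def using nn_integral_eq_integral[OF ei(2)] \<rho>0 by (simp add: case_prod_unfold)
  \<comment> \<open>\<open>Q\<close> is the excess of the second moment over its minimum, in the normalization in which it
    bounds the mass of \<open>F'\<close>.\<close>
  define Q where "Q = 4 * pi\<^sup>2 * Y - pi"
  have Q: "strip_mass (2 * pi) (deriv F) \<le> ennreal Q" "0 \<le> Q"
    using strip_mass_derivative_le_variance[OF F massF moment Y0] by (auto simp: Q_def)
  define V where "V x = G * (L * tf_density G (L * x))" for x
  define B where "B = L * T\<^sup>2 / 2"
  \<comment> \<open>With this \<open>\<theta>\<close> the derivative term \<open>B Q / \<theta>\<close> equals the part of \<open>\<kappa>\<^sup>2 Y / 2\<close> above \<open>\<kappa>\<^sup>2 / (8 pi)\<close>;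
    what remains is the loss \<open>B \<theta>\<close>.\<close>
  define \<theta> where "\<theta> = 8 * pi\<^sup>2 * B / \<kappa>\<^sup>2"
  have B: "B > 0" using L T by (simp add: B_def)
  have \<theta>: "\<theta> > 0" using B e by (simp add: \<theta>_def)
  have Vm[measurable]: "V \<in> borel_measurable borel" unfolding V_def[abs_def] by measurable
  have V0: "0 \<le> V x" for x using e L by (simp add: V_def tf_density_nonneg)
  have VB: "V x \<le> B" for x
    using mult_left_mono[OF tf_density_le[OF e(3), of "L * x"], of L] L by (simp add: V_def B_def T_def mult_ac)
  have VR: "V x * (sqrt 2 * (cmod (F (Complex x y)))\<^sup>2 * exp (- (4 * pi) * y\<^sup>2)) = G * (\<rho> (x, y) * R (x, y))" for x y
  proof -
    have "exp (- (4 * pi) * y\<^sup>2) = exp (- (2 * pi) * y\<^sup>2) * exp (- (2 * pi) * y\<^sup>2)" by (simp add: exp_add[symmetric])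
    then show ?thesis unfolding V_def \<rho>F R_def planar_profile_def prod.case by (simp only: mult_ac)
  qed
  have iV: "integrable lborel (\<lambda>p. V (fst p) * \<rho> p)"
  proof (rule Bochner_Integration.integrable_bound)
    show "integrable lborel (\<lambda>p. B * \<rho> p)" using i\<rho> by simp
    have "(\<lambda>p. V (fst p)) \<in> borel_measurable (borel :: (real \<times> real) measure)" unfolding borel_prod[symmetric] by measurable
    then show "(\<lambda>p. V (fst p) * \<rho> p) \<in> borel_measurable lborel" by simp
    show "AE p in lborel. norm (V (fst p) * \<rho> p) \<le> norm (B * \<rho> p)"
      using V0 VB \<rho>0 B by (intro AE_I2) (simp add: abs_mult mult_right_mono)
  qed
  have "ennreal (LINT p|lborel. V (fst p) * \<rho> p) \<le> ennreal (G * (LINT p|lborel. \<rho> p * R p)) + ennreal B * (ennreal \<theta> * 1 + ennreal (1 / \<theta>) * ennreal Q)"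
  proof -
    have "ennreal (LINT p|lborel. V (fst p) * \<rho> p) = (\<integral>\<^sup>+p. ennreal (V (fst p) * \<rho> p) \<partial>lborel)"
      using nn_integral_eq_integral[OF iV] V0 \<rho>0 by simp
    also have "\<dots> \<le> (\<integral>\<^sup>+p. ennreal (G * (\<rho> p * R p)) \<partial>lborel)
      + ennreal B * (ennreal \<theta> * strip_mass (2 * pi) F + ennreal (1 / \<theta>) * strip_mass (2 * pi) (deriv F))"
      using strip_weight_comparison[OF F Vm V0 VB \<theta>] unfolding \<rho>F[symmetric] VR by (simp add: case_prod_unfold)
    also have "(\<integral>\<^sup>+p. ennreal (G * (\<rho> p * R p)) \<partial>lborel) = ennreal (G * (LINT p|lborel. \<rho> p * R p))"
      using nn_integral_eq_integral[of lborel "\<lambda>p. G * (\<rho> p * R p)"] i\<rho>R \<rho>0 R0 e by simp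
    also have "ennreal (G * (LINT p|lborel. \<rho> p * R p)) + ennreal B * (ennreal \<theta> * strip_mass (2 * pi) F + ennreal (1 / \<theta>) * strip_mass (2 * pi) (deriv F))
      \<le> ennreal (G * (LINT p|lborel. \<rho> p * R p)) + ennreal B * (ennreal \<theta> * 1 + ennreal (1 / \<theta>) * ennreal Q)"
      unfolding massF by (intro add_left_mono mult_left_mono Q) auto
    finally show ?thesis .
  qed
  also have "\<dots> = ennreal (G * (LINT p|lborel. \<rho> p * R p) + B * (\<theta> + 1 / \<theta> * Q))"
  proof -
    have "0 \<le> G * (LINT p|lborel. \<rho> p * R p)" using e \<rho>0 R0 by (simp add: Bochner_Integration.integral_nonneg)
    moreover have "ennreal B * (ennreal \<theta> * 1 + ennreal (1 / \<theta>) * ennreal Q) = ennreal (B * (\<theta> + 1 / \<theta> * Q))"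
    proof -
      have "ennreal (1 / \<theta>) * ennreal Q = ennreal (1 / \<theta> * Q)" by (rule ennreal_mult'[symmetric]) (use \<theta> in simp)
      moreover have "ennreal \<theta> + ennreal (1 / \<theta> * Q) = ennreal (\<theta> + 1 / \<theta> * Q)" by (rule ennreal_plus[symmetric]) (use \<theta> Q(2) in auto)
      moreover have "ennreal B * ennreal (\<theta> + 1 / \<theta> * Q) = ennreal (B * (\<theta> + 1 / \<theta> * Q))" by (rule ennreal_mult'[symmetric]) (use B in simp)
      ultimately show ?thesis by (simp only: mult_1_right)
    qed
    moreover have "0 \<le> B * (\<theta> + 1 / \<theta> * Q)" using B \<theta> Q(2) by simp
    ultimately show ?thesis by (simp only: ennreal_plus)
  qed
  finally have main: "(LINT p|lborel. V (fst p) * \<rho> p) \<le> G * (LINT p|lborel. \<rho> p * R p) + B * (\<theta> + 1 / \<theta> * Q)"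
    using e \<rho>0 R0 B \<theta> Q(2) by (subst (asm) ennreal_le_iff) (auto intro!: add_nonneg_nonneg mult_nonneg_nonneg Bochner_Integration.integral_nonneg)
  have equil: "L * T\<^sup>2 / 2 \<le> \<epsilon>\<^sup>2 / 2 * X + (LINT p|lborel. V (fst p) * \<rho> p)"
  proof -
    have "L * T\<^sup>2 / 2 = (LINT p|lborel. L * T\<^sup>2 / 2 * \<rho> p)" using mass by simp
    also have "\<dots> \<le> (LINT p|lborel. \<epsilon>\<^sup>2 / 2 * ((fst p)\<^sup>2 * \<rho> p) + V (fst p) * \<rho> p)"
    proof (rule integral_mono)
      fix p :: "real \<times> real"
      have "L * (T\<^sup>2 / 2) \<le> L * ((L * fst p)\<^sup>2 / 2 + G * tf_density G (L * fst p))"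
        using L tf_equilibrium(1)[OF e(3)] by (intro mult_left_mono) (auto simp: T_def)
      also have "\<dots> = L ^ 3 / 2 * (fst p)\<^sup>2 + V (fst p)" by (simp add: V_def power2_eq_square power3_eq_cube algebra_simps)
      finally have "L * T\<^sup>2 / 2 * \<rho> p \<le> (\<epsilon>\<^sup>2 / 2 * (fst p)\<^sup>2 + V (fst p)) * \<rho> p"
        using \<rho>0 L(2) by (intro mult_right_mono) auto
      then show "L * T\<^sup>2 / 2 * \<rho> p \<le> \<epsilon>\<^sup>2 / 2 * ((fst p)\<^sup>2 * \<rho> p) + V (fst p) * \<rho> p" by (simp add: algebra_simps)
    qed (use i\<rho> iV ei(1) in auto)
    also have "\<dots> = \<epsilon>\<^sup>2 / 2 * X + (LINT p|lborel. V (fst p) * \<rho> p)" using iV ei(1) by (simp add: X_def)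
    finally show ?thesis .
  qed
  have quartic: "(LINT p|lborel. (\<rho> p)\<^sup>2) = (LINT p|lborel. (\<rho> p - R p)\<^sup>2) + 2 * (LINT p|lborel. \<rho> p * R p) - (LINT p|lborel. (R p)\<^sup>2)"
  proof -
    have "(LINT p|lborel. (\<rho> p)\<^sup>2) = (LINT p|lborel. (\<rho> p - R p)\<^sup>2 + 2 * (\<rho> p * R p) - (R p)\<^sup>2)"
      by (intro Bochner_Integration.integral_cong) (auto simp: power2_eq_square algebra_simps)
    then show ?thesis using int i\<rho>R iR2 by simp
  qed
  have Ysplit: "\<kappa>\<^sup>2 / 2 * Y = \<kappa>\<^sup>2 / (8 * pi) + B * (1 / \<theta> * Q)"
  proof -
    have "B * (1 / \<theta> * Q) = \<kappa>\<^sup>2 * Q / (8 * pi\<^sup>2)" using B e by (simp add: \<theta>_def)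
    also have "\<dots> = \<kappa>\<^sup>2 * (4 * pi\<^sup>2 * Y) / (8 * pi\<^sup>2) - \<kappa>\<^sup>2 * pi / (8 * pi\<^sup>2)"
      unfolding Q_def by (simp only: right_diff_distrib diff_divide_distrib)
    also have "\<kappa>\<^sup>2 * (4 * pi\<^sup>2 * Y) / (8 * pi\<^sup>2) = \<kappa>\<^sup>2 / 2 * Y" by simp
    also have "\<kappa>\<^sup>2 * pi / (8 * pi\<^sup>2) = \<kappa>\<^sup>2 / (8 * pi)" by (simp add: power2_eq_square)
    finally show ?thesis by simp
  qed
  have Bth: "B * \<theta> = 2 * pi\<^sup>2 * L\<^sup>2 * T ^ 4 / \<kappa>\<^sup>2"
    by (simp add: B_def \<theta>_def power2_eq_square power4_eq_xxxx)
  have "\<kappa>\<^sup>2 / (8 * pi) + L * tf_energy G - B * \<theta> + G / 2 * (LINT p|lborel. (\<rho> p - R p)\<^sup>2)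
     \<le> \<epsilon>\<^sup>2 / 2 * X + \<kappa>\<^sup>2 / 2 * Y + G / 2 * (LINT p|lborel. (\<rho> p)\<^sup>2)"
  proof -
    have gA: "G / 2 * (D + 2 * P - S) = G / 2 * D + G * P - G / 2 * S" for D P S by (simp add: algebra_simps)
    have gB: "L * (T\<^sup>2 / 2 - G / 2 * I) = L * T\<^sup>2 / 2 - G / 2 * (L * I)" for I by (simp add: algebra_simps)
    show ?thesis
      using main equil unfolding quartic Ysplit IR2 tf_energy_def T_def[symmetric] distrib_left[of B] gA gB by linarith
  qed
  then show "ennreal (\<kappa>\<^sup>2 / (8 * pi) + L * tf_energy G - 2 * pi\<^sup>2 * L\<^sup>2 * tf_radius G ^ 4 / \<kappa>\<^sup>2
        + G / 2 * (LINT p|lborel. ((cmod (u p))\<^sup>2 - planar_profile G L p)\<^sup>2)) \<le> energy \<epsilon> \<kappa> G u"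
    unfolding ei(4) \<rho>_def[symmetric] R_def[symmetric] T_def[symmetric] Bth[symmetric] X_def Y_def by (intro ennreal_leI)
qed

section \<open>Gaussian smoothing of the Thomas--Fermi profile\<close>

lemma normal_density_commute: "normal_density x \<tau> s = normal_density s \<tau> x"
  by (simp add: normal_density_def power2_commute)

lemma continuous_normal_density: "continuous_on S (normal_density x \<tau>)"
  unfolding normal_density_def[abs_def] by (cases "\<tau> = 0") (auto intro!: continuous_intros)

lemma borel_measurable_normal_density_joint[measurable]:
  assumes [measurable]: "f \<in> borel_measurable M" "g \<in> borel_measurable M"
  shows "(\<lambda>x. normal_density (f x) \<tau> (g x)) \<in> borel_measurable M"
  unfolding normal_density_def by measurable

lemma continuous_tf_profile: "continuous_on S (tf_profile G)"
  unfolding tf_profile_def[abs_def] by (intro continuous_on_real_sqrt continuous_tf_density)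

lemma tf_profile_nonneg: "G > 0 \<Longrightarrow> 0 \<le> tf_profile G t"
  by (simp add: tf_profile_def tf_density_nonneg)

lemma tf_profile_outside: "G > 0 \<Longrightarrow> \<bar>t\<bar> > tf_radius G \<Longrightarrow> tf_profile G t = 0"
  by (simp add: tf_profile_def tf_density_outside)

lemma normal_average_square_le:
  assumes \<tau>: "\<tau> > 0"
    and f: "integrable lborel (\<lambda>s. f s * normal_density x \<tau> s)" "integrable lborel (\<lambda>s. (f s)\<^sup>2 * normal_density x \<tau> s)"
  shows "(LINT s|lborel. f s * normal_density x \<tau> s)\<^sup>2 \<le> (LINT s|lborel. (f s)\<^sup>2 * normal_density x \<tau> s)"
proof -
  define m where "m = (LINT s|lborel. f s * normal_density x \<tau> s)"
  have n: "integrable lborel (normal_density x \<tau>)" "(LINT s|lborel. normal_density x \<tau> s) = 1"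
    using \<tau> by simp_all
  have "0 \<le> (LINT s|lborel. (f s - m)\<^sup>2 * normal_density x \<tau> s)" by (intro Bochner_Integration.integral_nonneg) simp
  also have "\<dots> = (LINT s|lborel. (f s)\<^sup>2 * normal_density x \<tau> s - 2 * m * (f s * normal_density x \<tau> s) + m\<^sup>2 * normal_density x \<tau> s)"
    by (intro Bochner_Integration.integral_cong) (auto simp: power2_eq_square algebra_simps)
  also have "\<dots> = (LINT s|lborel. (f s)\<^sup>2 * normal_density x \<tau> s) - 2 * m * m + m\<^sup>2"
    using f n by (simp add: m_def)
  finally show ?thesis by (simp add: m_def[symmetric] power2_eq_square)
qed

text \<open>
  The Gaussian kernel is symmetric, so an integral of an average is an average of integrals.
\<close>

lemma nn_integral_normal_average:
  assumes [measurable]: "f \<in> borel_measurable borel" "w \<in> borel_measurable borel"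
    and f: "\<And>s. 0 \<le> f s" "\<And>x. integrable lborel (\<lambda>s. f s * normal_density x \<tau> s)"
  shows "(\<integral>\<^sup>+x. w x * ennreal (LINT s|lborel. f s * normal_density x \<tau> s) \<partial>lborel)
    = (\<integral>\<^sup>+s. ennreal (f s) * (\<integral>\<^sup>+x. w x * ennreal (normal_density s \<tau> x) \<partial>lborel) \<partial>lborel)"
proof -
  have "(\<integral>\<^sup>+x. w x * ennreal (LINT s|lborel. f s * normal_density x \<tau> s) \<partial>lborel)
    = (\<integral>\<^sup>+x. \<integral>\<^sup>+s. w x * (ennreal (f s) * ennreal (normal_density x \<tau> s)) \<partial>lborel \<partial>lborel)"
    using f by (intro nn_integral_cong) (simp add: nn_integral_cmult nn_integral_eq_integral[symmetric] ennreal_mult[symmetric])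
  also have "\<dots> = (\<integral>\<^sup>+s. \<integral>\<^sup>+x. w x * (ennreal (f s) * ennreal (normal_density x \<tau> s)) \<partial>lborel \<partial>lborel)"
    by (rule lborel_pair.Fubini') measurable
  also have "\<dots> = (\<integral>\<^sup>+s. \<integral>\<^sup>+x. ennreal (f s) * (w x * ennreal (normal_density s \<tau> x)) \<partial>lborel \<partial>lborel)"
    by (simp only: normal_density_commute[of _ \<tau>] mult.left_commute)
  finally show ?thesis by (simp add: nn_integral_cmult)
qed

definition tf_smooth :: "real \<Rightarrow> real \<Rightarrow> real \<Rightarrow> real" where
  "tf_smooth G \<tau> x = (LINT s|lborel. tf_profile G s * normal_density x \<tau> s)"

lemma borel_measurable_tf_smooth[measurable]: "tf_smooth G \<tau> \<in> borel_measurable borel"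
  unfolding tf_smooth_def[abs_def] by measurable

lemma integrable_tf_profile_normal:
  assumes "G > 0" "k > 0"
  shows "integrable lborel (\<lambda>s. tf_profile G s ^ k * normal_density x \<tau> s)"
  by (rule integrable_continuous_compact_support[where T="tf_radius G"])
    (use assms in \<open>auto intro!: continuous_intros continuous_tf_profile continuous_normal_density simp: tf_profile_outside zero_power\<close>)

lemma tf_smooth_power_le:
  assumes G: "G > 0" and \<tau>: "\<tau> > 0"
  shows "(tf_smooth G \<tau> x)\<^sup>2 \<le> (LINT s|lborel. tf_density G s * normal_density x \<tau> s)"
    and "tf_smooth G \<tau> x ^ 4 \<le> (LINT s|lborel. (tf_density G s)\<^sup>2 * normal_density x \<tau> s)"
proof -
  note i = integrable_tf_profile_normal[OF G, of _ x \<tau>]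
  note i2 = i[of 2, simplified, unfolded tf_profile_square[OF G]]
  note i4 = i[of 4, simplified, unfolded tf_profile_power4[OF G]]
  show 1: "(tf_smooth G \<tau> x)\<^sup>2 \<le> (LINT s|lborel. tf_density G s * normal_density x \<tau> s)"
    using normal_average_square_le[OF \<tau>, of "tf_profile G" x] i[of 1] i2 by (simp add: tf_smooth_def tf_profile_square[OF G])
  have "tf_smooth G \<tau> x ^ 4 = ((tf_smooth G \<tau> x)\<^sup>2)\<^sup>2" by (simp flip: power_mult)
  also have "\<dots> \<le> (LINT s|lborel. tf_density G s * normal_density x \<tau> s)\<^sup>2" by (intro power_mono 1) simp
  also have "\<dots> \<le> (LINT s|lborel. (tf_density G s)\<^sup>2 * normal_density x \<tau> s)"
    by (rule normal_average_square_le[OF \<tau> i2 i4])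
  finally show "tf_smooth G \<tau> x ^ 4 \<le> (LINT s|lborel. (tf_density G s)\<^sup>2 * normal_density x \<tau> s)" .
qed

lemma nn_integral_normal_density:
  "\<tau> > 0 \<Longrightarrow> (\<integral>\<^sup>+x. ennreal (normal_density s \<tau> x) \<partial>lborel) = 1"
  by (subst nn_integral_eq_integral) auto

lemma nn_integral_normal_density_square:
  assumes \<tau>: "\<tau> > 0"
  shows "(\<integral>\<^sup>+x. ennreal (x\<^sup>2) * ennreal (normal_density s \<tau> x) \<partial>lborel) = ennreal (s\<^sup>2 + \<tau>\<^sup>2)"
proof -
  have "has_bochner_integral lborel (\<lambda>x. normal_density s \<tau> x * (x - s) ^ (2 * 1) + 2 * s * (normal_density s \<tau> x * x) - s\<^sup>2 * normal_density s \<tau> x)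
     (fact (2 * 1) / ((2 / \<tau>\<^sup>2) ^ 1 * fact 1) + 2 * s * s - s\<^sup>2 * 1)"
    using \<tau> by (intro has_bochner_integral_add has_bochner_integral_diff has_bochner_integral_mult_right normal_moment_even normal_moment_nz_1)
      (auto simp: has_bochner_integral_iff)
  also have "(\<lambda>x. normal_density s \<tau> x * (x - s) ^ (2 * 1) + 2 * s * (normal_density s \<tau> x * x) - s\<^sup>2 * normal_density s \<tau> x)
     = (\<lambda>x. x\<^sup>2 * normal_density s \<tau> x)" by (simp add: fun_eq_iff power2_eq_square algebra_simps)
  also have "fact (2 * 1) / ((2 / \<tau>\<^sup>2) ^ 1 * fact 1) + 2 * s * s - s\<^sup>2 * 1 = s\<^sup>2 + \<tau>\<^sup>2"
    by (simp add: fact_numeral power2_eq_square)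
  finally have h: "has_bochner_integral lborel (\<lambda>x. x\<^sup>2 * normal_density s \<tau> x) (s\<^sup>2 + \<tau>\<^sup>2)" .
  then have "(\<integral>\<^sup>+x. ennreal (x\<^sup>2 * normal_density s \<tau> x) \<partial>lborel) = ennreal (s\<^sup>2 + \<tau>\<^sup>2)"
    by (subst nn_integral_eq_integral) (auto simp: has_bochner_integral_iff)
  then show ?thesis by (simp add: ennreal_mult)
qed

lemma nn_integral_tf_smooth_bounds:
  assumes G: "G > 0" and \<tau>: "\<tau> > 0"
  shows "(\<integral>\<^sup>+x. ennreal ((tf_smooth G \<tau> x)\<^sup>2) \<partial>lborel) \<le> 1"
    and "(\<integral>\<^sup>+x. ennreal (x\<^sup>2 * (tf_smooth G \<tau> x)\<^sup>2) \<partial>lborel) \<le> ennreal ((LINT t|lborel. t\<^sup>2 * tf_density G t) + \<tau>\<^sup>2)"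
    and "(\<integral>\<^sup>+x. ennreal (tf_smooth G \<tau> x ^ 4) \<partial>lborel) \<le> ennreal (LINT t|lborel. (tf_density G t)\<^sup>2)"
proof -
  note i = integrable_tf_profile_normal[OF G, of _ _ \<tau>]
  note i2 = i[of 2, simplified, unfolded tf_profile_square[OF G]]
  note i4 = i[of 4, simplified, unfolded tf_profile_power4[OF G]]
  have \<rho>0: "0 \<le> tf_density G s" for s by (rule tf_density_nonneg[OF G])
  have im: "integrable lborel (\<lambda>s. s\<^sup>2 * tf_density G s)"
    by (intro integrable_mult_tf_density G continuous_intros)
  note swap2 = nn_integral_normal_average[OF borel_measurable_tf_density _ \<rho>0 i2]
  have swap4: "(\<integral>\<^sup>+x. w x * ennreal (LINT s|lborel. (tf_density G s)\<^sup>2 * normal_density x \<tau> s) \<partial>lborel)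
    = (\<integral>\<^sup>+s. ennreal ((tf_density G s)\<^sup>2) * (\<integral>\<^sup>+x. w x * ennreal (normal_density s \<tau> x) \<partial>lborel) \<partial>lborel)"
    if "w \<in> borel_measurable borel" for w
    using that by (intro nn_integral_normal_average i4) auto
  have "(\<integral>\<^sup>+x. ennreal ((tf_smooth G \<tau> x)\<^sup>2) \<partial>lborel) \<le> (\<integral>\<^sup>+x. 1 * ennreal (LINT s|lborel. tf_density G s * normal_density x \<tau> s) \<partial>lborel)"
    by (intro nn_integral_mono) (simp add: ennreal_leI tf_smooth_power_le[OF G \<tau>])
  also have "\<dots> = (\<integral>\<^sup>+s. ennreal (tf_density G s) \<partial>lborel)"
    by (subst swap2) (auto simp: nn_integral_normal_density[OF \<tau>])
  also have "\<dots> = 1"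
    using nn_integral_eq_integral[OF integrable_tf_density[OF G]] \<rho>0 by (simp add: integral_tf_density[OF G])
  finally show "(\<integral>\<^sup>+x. ennreal ((tf_smooth G \<tau> x)\<^sup>2) \<partial>lborel) \<le> 1" .
  have "(\<integral>\<^sup>+x. ennreal (tf_smooth G \<tau> x ^ 4) \<partial>lborel) \<le> (\<integral>\<^sup>+x. 1 * ennreal (LINT s|lborel. (tf_density G s)\<^sup>2 * normal_density x \<tau> s) \<partial>lborel)"
    by (intro nn_integral_mono) (simp add: ennreal_leI tf_smooth_power_le[OF G \<tau>])
  also have "\<dots> = (\<integral>\<^sup>+s. ennreal ((tf_density G s)\<^sup>2) \<partial>lborel)"
    by (subst swap4) (auto simp: nn_integral_normal_density[OF \<tau>])
  also have "\<dots> = ennreal (LINT t|lborel. (tf_density G t)\<^sup>2)"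
    using nn_integral_eq_integral[OF integrable_tf_density_square[OF G]] by simp
  finally show "(\<integral>\<^sup>+x. ennreal (tf_smooth G \<tau> x ^ 4) \<partial>lborel) \<le> ennreal (LINT t|lborel. (tf_density G t)\<^sup>2)" .
  have "(\<integral>\<^sup>+x. ennreal (x\<^sup>2 * (tf_smooth G \<tau> x)\<^sup>2) \<partial>lborel) \<le> (\<integral>\<^sup>+x. ennreal (x\<^sup>2) * ennreal (LINT s|lborel. tf_density G s * normal_density x \<tau> s) \<partial>lborel)"
    unfolding ennreal_mult[OF zero_le_power2 zero_le_power2]
    by (intro nn_integral_mono mult_left_mono ennreal_leI tf_smooth_power_le[OF G \<tau>]) simp
  also have "\<dots> = (\<integral>\<^sup>+s. ennreal (tf_density G s) * ennreal (s\<^sup>2 + \<tau>\<^sup>2) \<partial>lborel)"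
    by (subst swap2) (auto simp: nn_integral_normal_density_square[OF \<tau>])
  also have "\<dots> = (\<integral>\<^sup>+s. ennreal (s\<^sup>2 * tf_density G s + \<tau>\<^sup>2 * tf_density G s) \<partial>lborel)"
    using \<rho>0 by (intro nn_integral_cong) (simp add: ennreal_mult[symmetric] algebra_simps del: ennreal_plus)
  also have "\<dots> = ennreal (LINT s|lborel. s\<^sup>2 * tf_density G s + \<tau>\<^sup>2 * tf_density G s)"
    using \<rho>0 im integrable_tf_density[OF G] by (intro nn_integral_eq_integral) auto
  also have "(LINT s|lborel. s\<^sup>2 * tf_density G s + \<tau>\<^sup>2 * tf_density G s) = (LINT t|lborel. t\<^sup>2 * tf_density G t) + \<tau>\<^sup>2"
    using im integrable_tf_density[OF G] integral_tf_density[OF G] by simp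
  finally show "(\<integral>\<^sup>+x. ennreal (x\<^sup>2 * (tf_smooth G \<tau> x)\<^sup>2) \<partial>lborel) \<le> ennreal ((LINT t|lborel. t\<^sup>2 * tf_density G t) + \<tau>\<^sup>2)" .
qed

lemma tf_density_Lipschitz:
  assumes G: "G > 0"
  shows "\<bar>tf_density G s - tf_density G t\<bar> \<le> tf_radius G / G * \<bar>s - t\<bar>"
proof -
  define T where "T = tf_radius G"
  have T: "T > 0" using G tf_radius_pos by (simp add: T_def)
  have m: "max 0 (T\<^sup>2 - s\<^sup>2) = T\<^sup>2 - (min \<bar>s\<bar> T)\<^sup>2" for s
    using T abs_le_square_iff[of s T] by (auto simp: max_def min_def)
  define a b where "a = min \<bar>s\<bar> T" and "b = min \<bar>t\<bar> T"
  have ab: "0 \<le> a" "a \<le> T" "0 \<le> b" "b \<le> T" "\<bar>a - b\<bar> \<le> \<bar>s - t\<bar>" using T by (auto simp: a_def b_def)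
  have "tf_density G s - tf_density G t = (b - a) * (b + a) / (2 * G)"
    unfolding tf_density_def T_def[symmetric] m a_def[symmetric] b_def[symmetric]
    by (simp add: power2_eq_square algebra_simps diff_divide_distrib add_divide_distrib)
  then have "\<bar>tf_density G s - tf_density G t\<bar> = \<bar>a - b\<bar> * (b + a) / (2 * G)"
    using G ab by (simp add: abs_mult abs_minus_commute)
  also have "\<dots> \<le> \<bar>s - t\<bar> * (2 * T) / (2 * G)"
    using G ab by (intro divide_right_mono mult_mono) auto
  also have "\<dots> = T / G * \<bar>s - t\<bar>" using G by simp
  finally show ?thesis by (simp add: T_def)
qed

text \<open>
  The profile has square root singularities at the ends of its support, but the inequality \<open>(a - b)\<^sup>2 \<le> |a\<^sup>2 - b\<^sup>2|\<close>
  for nonnegative \<open>a\<close> and \<open>b\<close> reduces its modulus of continuity to that of the Lipschitz density.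
\<close>

lemma tf_profile_Hoelder:
  assumes G: "G > 0"
  shows "(tf_profile G s - tf_profile G t)\<^sup>2 \<le> tf_radius G / G * \<bar>s - t\<bar>"
proof -
  define a b where "a = tf_profile G s" and "b = tf_profile G t"
  have ab: "0 \<le> a" "0 \<le> b" using tf_profile_nonneg[OF G] by (auto simp: a_def b_def)
  have "(a - b)\<^sup>2 = \<bar>a - b\<bar> * \<bar>a - b\<bar>" by (simp add: power2_eq_square abs_mult[symmetric])
  also have "\<dots> \<le> \<bar>a - b\<bar> * (a + b)" using ab by (intro mult_left_mono) auto
  also have "\<dots> = \<bar>a\<^sup>2 - b\<^sup>2\<bar>" using ab by (simp add: power2_eq_square square_diff_square_factored abs_mult mult.commute)
  also have "\<dots> \<le> tf_radius G / G * \<bar>s - t\<bar>"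
    using tf_density_Lipschitz[OF G, of s t] by (simp add: a_def b_def tf_profile_square[OF G])
  finally show ?thesis by (simp add: a_def b_def)
qed

lemma tf_smooth_close:
  assumes G: "G > 0" and \<tau>: "\<tau> > 0"
  shows "(tf_smooth G \<tau> x - tf_profile G x)\<^sup>2 \<le> tf_radius G / G * \<tau>"
proof -
  define c where "c = tf_profile G x"
  have n: "integrable lborel (normal_density x \<tau>)" "(LINT s|lborel. normal_density x \<tau> s) = 1"
    using \<tau> by simp_all
  have i1: "integrable lborel (\<lambda>s. tf_profile G s * normal_density x \<tau> s)"
    and i2: "integrable lborel (\<lambda>s. (tf_profile G s)\<^sup>2 * normal_density x \<tau> s)"
    using integrable_tf_profile_normal[OF G, of 1 x \<tau>] integrable_tf_profile_normal[OF G, of 2 x \<tau>] by simp_all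
  have d1: "integrable lborel (\<lambda>s. (tf_profile G s - c) * normal_density x \<tau> s)"
    using i1 n by (simp add: left_diff_distrib)
  have "integrable lborel (\<lambda>s. (tf_profile G s)\<^sup>2 * normal_density x \<tau> s - 2 * c * (tf_profile G s * normal_density x \<tau> s) + c\<^sup>2 * normal_density x \<tau> s)"
    using i1 i2 n by simp
  then have d2: "integrable lborel (\<lambda>s. (tf_profile G s - c)\<^sup>2 * normal_density x \<tau> s)"
    by (rule Bochner_Integration.integrable_cong[THEN iffD1, rotated 2]) (auto simp: power2_eq_square algebra_simps)
  have abs: "has_bochner_integral lborel (\<lambda>s. normal_density x \<tau> s * \<bar>s - x\<bar> ^ (2 * 0 + 1)) (2 ^ 0 * \<tau> ^ (2 * 0 + 1) * fact 0 * sqrt (2 / pi))"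
    using \<tau> by (rule normal_moment_abs_odd)
  have "tf_smooth G \<tau> x - c = (LINT s|lborel. (tf_profile G s - c) * normal_density x \<tau> s)"
    using i1 n by (simp add: tf_smooth_def left_diff_distrib)
  then have "(tf_smooth G \<tau> x - c)\<^sup>2 \<le> (LINT s|lborel. (tf_profile G s - c)\<^sup>2 * normal_density x \<tau> s)"
    using normal_average_square_le[OF \<tau> d1 d2] by simp
  also have "\<dots> \<le> (LINT s|lborel. tf_radius G / G * (normal_density x \<tau> s * \<bar>s - x\<bar>))"
  proof (rule integral_mono[OF d2])
    show "integrable lborel (\<lambda>s. tf_radius G / G * (normal_density x \<tau> s * \<bar>s - x\<bar>))"
      using abs by (intro integrable_mult_right) (simp add: has_bochner_integral_iff)
    fix s
    show "(tf_profile G s - c)\<^sup>2 * normal_density x \<tau> s \<le> tf_radius G / G * (normal_density x \<tau> s * \<bar>s - x\<bar>)"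
      using mult_right_mono[OF tf_profile_Hoelder[OF G, of s x], of "normal_density x \<tau> s"] by (simp add: c_def mult_ac)
  qed
  also have "\<dots> = tf_radius G / G * (\<tau> * sqrt (2 / pi))" using abs by (simp add: has_bochner_integral_iff)
  also have "\<dots> \<le> tf_radius G / G * (\<tau> * 1)"
    using \<tau> G tf_radius_pos[OF G] pi_gt3 by (intro mult_left_mono) auto
  finally show ?thesis by (simp add: c_def)
qed

text \<open>
  Smoothing moves the profile by at most a multiple of \<open>\<surd>\<tau>\<close> uniformly, and only its values on the
  support of the profile are used.
\<close>

lemma tf_smooth_mass_lower_bound:
  assumes G: "G > 0" and \<tau>: "\<tau> > 0"
  shows "ennreal (1 - sqrt \<tau> * (1 + 2 * (tf_radius G)\<^sup>2 / G)) \<le> (\<integral>\<^sup>+x. ennreal ((tf_smooth G \<tau> x)\<^sup>2) \<partial>lborel)"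
proof -
  \<comment> \<open>The weight \<open>\<theta>\<close> in \<open>2 |a| |b - a| \<le> \<theta> a\<^sup>2 + (b - a)\<^sup>2 / \<theta>\<close> balances the two errors, as \<open>(b - a)\<^sup>2\<close> is
    of order \<open>\<tau>\<close>.\<close>
  define T \<theta> where "T = tf_radius G" and "\<theta> = sqrt \<tau>"
  have T: "T > 0" and \<theta>: "\<theta> > 0" "\<tau> = \<theta>\<^sup>2" using G tf_radius_pos \<tau> by (auto simp: T_def \<theta>_def)
  have pt: "(1 - \<theta>) * tf_density G x - T / G * \<theta> * indicator {-T..T} x \<le> (tf_smooth G \<tau> x)\<^sup>2" for x
  proof (cases "\<bar>x\<bar> \<le> T")
    case True
    define a b where "a = tf_profile G x" and "b = tf_smooth G \<tau> x"
    have "0 \<le> (\<theta> * a + (b - a))\<^sup>2 / \<theta>" using \<theta> by simp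
    also have "\<dots> = \<theta> * a\<^sup>2 + 2 * a * (b - a) + (b - a)\<^sup>2 / \<theta>" using \<theta> by (simp add: power2_eq_square field_simps)
    also have "(b - a)\<^sup>2 / \<theta> \<le> T / G * \<theta>\<^sup>2 / \<theta>"
      using tf_smooth_close[OF G \<tau>, of x] \<theta> by (intro divide_right_mono) (auto simp: a_def b_def T_def)
    also have "T / G * \<theta>\<^sup>2 / \<theta> = T / G * \<theta>" using \<theta> by (simp add: power2_eq_square)
    finally have "0 \<le> \<theta> * a\<^sup>2 + 2 * a * (b - a) + T / G * \<theta> + (b - a)\<^sup>2"
      by (simp add: add_nonneg_nonneg)
    then have "(1 - \<theta>) * a\<^sup>2 - T / G * \<theta> \<le> b\<^sup>2" by (simp add: power2_eq_square algebra_simps)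
    then show ?thesis using True by (simp add: a_def b_def tf_profile_square[OF G] abs_le_iff indicator_def)
  next
    case False
    then show ?thesis using tf_density_outside[OF G, of x] by (auto simp: T_def indicator_def)
  qed
  have fin: "integrable lborel (\<lambda>x. (tf_smooth G \<tau> x)\<^sup>2)"
    using nn_integral_tf_smooth_bounds(1)[OF G \<tau>] by (intro integrableI_nonneg) (auto intro: le_less_trans)
  have ind: "integrable lborel (indicator {-T..T} :: real \<Rightarrow> real)" by (simp add: emeasure_lborel_Icc_eq)
  have "1 - \<theta> * (1 + 2 * T\<^sup>2 / G) = (LINT x|lborel. (1 - \<theta>) * tf_density G x - T / G * \<theta> * indicator {-T..T} x)"
    using ind integrable_tf_density[OF G] T
    by (subst Bochner_Integration.integral_diff) (auto simp: integral_tf_density[OF G] power2_eq_square algebra_simps)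
  also have "\<dots> \<le> (LINT x|lborel. (tf_smooth G \<tau> x)\<^sup>2)"
    using ind integrable_tf_density[OF G] fin pt by (intro integral_mono) auto
  finally show ?thesis
    unfolding T_def[symmetric] \<theta>_def[symmetric] using nn_integral_eq_integral[OF fin] by (simp add: ennreal_leI)
qed

section \<open>The trial functions\<close>

text \<open>
  The heat kernel is entire in its space variable, and
  \<open>|exp (- (x + i y - s)\<^sup>2 / (2 \<tau>\<^sup>2))| = exp (y\<^sup>2 / (2 \<tau>\<^sup>2)) exp (- (x - s)\<^sup>2 / (2 \<tau>\<^sup>2))\<close>; the growth in \<open>y\<close> does
  not depend on \<open>s\<close> and factors out of the integral.
\<close>

lemma tf_smooth_entire_extension:
  assumes G: "G > 0" and \<tau>: "\<tau> > 0"
  obtains F where "F holomorphic_on UNIV" "\<And>x y. cmod (F (Complex x y)) \<le> exp (y\<^sup>2 / (2 * \<tau>\<^sup>2)) * tf_smooth G \<tau> x"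
    "\<And>x. F (of_real x) = of_real (tf_smooth G \<tau> x)"
proof -
  define T where "T = tf_radius G"
  define p where "p = tf_profile G"
  define q where "q = 1 / sqrt (2 * pi * \<tau>\<^sup>2)"
  define k where "k z = of_real q * exp (of_real (- 1 / (2 * \<tau>\<^sup>2)) * z\<^sup>2)" for z :: complex
  define f where "f z s = of_real (p s) * k (z - of_real s)" for z s
  define f' where "f' z s = of_real (p s) * (k (z - of_real s) * (of_real (- 1 / (2 * \<tau>\<^sup>2)) * (2 * (z - of_real s))))" for z s
  define F where "F z = integral (cbox (-T) T) (f z)" for z
  have q: "q > 0" using \<tau> by (simp add: q_def)
  have contp: "continuous_on S p" for S unfolding p_def by (rule continuous_tf_profile)
  have contf: "continuous_on S (f z)" for S z
    unfolding f_def k_def by (intro continuous_intros contp)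
  have F: "F holomorphic_on UNIV"
    unfolding F_def
  proof (rule leibniz_rule_holomorphic)
    show "((\<lambda>z. f z s) has_field_derivative f' z s) (at z within UNIV)" for z s
      unfolding f_def f'_def k_def
      using \<tau> by (auto intro!: derivative_eq_intros simp: algebra_simps power2_eq_square)
    show "f z integrable_on cbox (- T) T" for z
      by (intro integrable_continuous contf)
    have "continuous_on (UNIV \<times> cbox (- T) T) (\<lambda>x :: complex \<times> real. p (snd x))"
      by (rule continuous_on_compose2[OF contp[of UNIV]]) (auto intro: continuous_intros)
    then show "continuous_on (UNIV \<times> cbox (- T) T) (\<lambda>(z, s). f' z s)"
      unfolding f'_def k_def case_prod_unfold by (intro continuous_intros)
  qed simp
  have kn: "cmod (k (Complex x y - of_real s)) = exp (y\<^sup>2 / (2 * \<tau>\<^sup>2)) * normal_density x \<tau> s" for x y s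
  proof -
    have "Complex x y - of_real s = Complex (x - s) y" by (simp add: complex_eq_iff)
    moreover have "- 1 / (2 * \<tau>\<^sup>2) * ((x - s)\<^sup>2 - y\<^sup>2) = y\<^sup>2 / (2 * \<tau>\<^sup>2) + (- (s - x)\<^sup>2 / (2 * \<tau>\<^sup>2))"
      by (simp add: power2_commute[of x s] diff_divide_distrib)
    ultimately have "cmod (k (Complex x y - of_real s)) = q * exp (y\<^sup>2 / (2 * \<tau>\<^sup>2) + (- (s - x)\<^sup>2 / (2 * \<tau>\<^sup>2)))"
      unfolding k_def norm_mult by (simp only: cmod_exp_square norm_of_real) (use q in simp)
    then show ?thesis by (simp only: exp_add normal_density_def q_def) (simp add: mult_ac)
  qed
  have kr: "k (of_real x - of_real s) = of_real (normal_density x \<tau> s)" for x s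
  proof -
    have "k (of_real x - of_real s) = of_real (q * exp (- 1 / (2 * \<tau>\<^sup>2) * (x - s)\<^sup>2))"
      unfolding k_def by (simp only: of_real_mult of_real_power of_real_diff exp_of_real[symmetric])
    also have "q * exp (- 1 / (2 * \<tau>\<^sup>2) * (x - s)\<^sup>2) = normal_density x \<tau> s"
      by (simp add: normal_density_def q_def power2_commute[of x s])
    finally show ?thesis .
  qed
  have P: "((\<lambda>s. p s * normal_density x \<tau> s) has_integral tf_smooth G \<tau> x) (cbox (-T) T)" for x
  proof -
    have i: "integrable lborel (\<lambda>s. p s * normal_density x \<tau> s)"
      using integrable_tf_profile_normal[OF G, of 1 x \<tau>] by (simp add: p_def)
    have h: "((\<lambda>s. p s * normal_density x \<tau> s) has_integral tf_smooth G \<tau> x) UNIV"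
      using has_integral_integral_lborel[OF i] by (simp add: tf_smooth_def p_def)
    have eq: "(\<lambda>s. p s * normal_density x \<tau> s) = (\<lambda>s. if s \<in> cbox (-T) T then p s * normal_density x \<tau> s else 0)"
      using tf_profile_outside[OF G] by (fastforce simp: fun_eq_iff p_def T_def)
    have "((\<lambda>s. if s \<in> cbox (-T) T then p s * normal_density x \<tau> s else 0) has_integral tf_smooth G \<tau> x) UNIV"
      using h by (subst eq[symmetric])
    then show ?thesis by (simp only: has_integral_restrict_UNIV)
  qed
  have 1: "cmod (F (Complex x y)) \<le> exp (y\<^sup>2 / (2 * \<tau>\<^sup>2)) * tf_smooth G \<tau> x" for x y
  proof -
    have h: "((\<lambda>s. exp (y\<^sup>2 / (2 * \<tau>\<^sup>2)) * (p s * normal_density x \<tau> s)) has_integral exp (y\<^sup>2 / (2 * \<tau>\<^sup>2)) * tf_smooth G \<tau> x) (cbox (-T) T)"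
      by (intro has_integral_mult_right P)
    have "cmod (F (Complex x y)) \<le> integral (cbox (-T) T) (\<lambda>s. exp (y\<^sup>2 / (2 * \<tau>\<^sup>2)) * (p s * normal_density x \<tau> s))"
      unfolding F_def
    proof (rule integral_norm_bound_integral)
      show "f (Complex x y) integrable_on cbox (- T) T" by (intro integrable_continuous contf)
      show "(\<lambda>s. exp (y\<^sup>2 / (2 * \<tau>\<^sup>2)) * (p s * normal_density x \<tau> s)) integrable_on cbox (- T) T" using h by blast
      show "cmod (f (Complex x y) s) \<le> exp (y\<^sup>2 / (2 * \<tau>\<^sup>2)) * (p s * normal_density x \<tau> s)" for s
        unfolding f_def norm_mult kn using tf_profile_nonneg[OF G, of s] by (simp add: p_def mult_ac)
    qed
    then show ?thesis using integral_unique[OF h] by simp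
  qed
  have 2: "F (of_real x) = of_real (tf_smooth G \<tau> x)" for x
  proof -
    have eq: "f (of_real x) = (\<lambda>s. complex_of_real (p s * normal_density x \<tau> s))"
      by (simp add: f_def kr fun_eq_iff)
    have "((\<lambda>s. complex_of_real (p s * normal_density x \<tau> s)) has_integral complex_of_real (tf_smooth G \<tau> x)) (cbox (-T) T)"
      by (rule has_integral_linear[OF P bounded_linear_of_real, unfolded comp_def])
    then show ?thesis unfolding F_def eq by (rule integral_unique)
  qed
  show ?thesis using F 1 2 by (rule that)
qed

text \<open>
  The mean value inequality with the weight \<open>exp (- 2 pi |w|\<^sup>2)\<close>, integrated over centres on the real
  axis. It keeps the trial function from losing mass when it is extended off the axis.
\<close>

lemma strip_mass_ge_axis_mass:
  fixes F :: "complex \<Rightarrow> complex"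
  assumes F: "F holomorphic_on UNIV"
  shows "(\<integral>\<^sup>+x. ennreal ((cmod (F (of_real x)))\<^sup>2) \<partial>lborel) \<le> ennreal (sqrt 2) * strip_mass (2 * pi) F"
proof -
  note Fm[measurable] = holomorphic_borel_measurable[OF F]
  define e where "e y = ennreal (exp (- (2 * pi) * y\<^sup>2))" for y :: real
  have em[measurable]: "e \<in> borel_measurable borel" unfolding e_def by measurable
  define \<phi> where "\<phi> x y = ennreal ((cmod (F (Complex x y)))\<^sup>2)" for x y
  have \<phi>m[measurable]: "(\<lambda>p. \<phi> (f p) (g p)) \<in> borel_measurable M"
    if [measurable]: "f \<in> borel_measurable M" "g \<in> borel_measurable M" for f g and M :: "'z measure"
    unfolding \<phi>_def by measurable
  have split: "ennreal ((cmod (F (of_real x + Complex v w)))\<^sup>2 * exp (- (2 * pi) * (v\<^sup>2 + w\<^sup>2))) = e v * (\<phi> (x + v) w * e w)" for x v w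
  proof -
    have 1: "of_real x + Complex v w = Complex (x + v) w" by (simp add: complex_eq_iff)
    have 2: "exp (- (2 * pi) * (v\<^sup>2 + w\<^sup>2)) = exp (- (2 * pi) * v\<^sup>2) * exp (- (2 * pi) * w\<^sup>2)"
      by (simp add: exp_add[symmetric] algebra_simps)
    show ?thesis unfolding \<phi>_def e_def 1 2 by (simp add: ennreal_mult[symmetric] mult_ac)
  qed
  have "ennreal (1 / 2) * (\<integral>\<^sup>+x. ennreal ((cmod (F (of_real x)))\<^sup>2) \<partial>lborel) = (\<integral>\<^sup>+x. ennreal (1 / 2) * ennreal ((cmod (F (of_real x)))\<^sup>2) \<partial>lborel)"
    by (rule nn_integral_cmult[symmetric]) measurable
  also have "\<dots> \<le> (\<integral>\<^sup>+x. \<integral>\<^sup>+v. \<integral>\<^sup>+w. e v * (\<phi> (x + v) w * e w) \<partial>lborel \<partial>lborel \<partial>lborel)"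
  proof (rule nn_integral_mono)
    fix x :: real
    have "ennreal (1 / 2) * ennreal ((cmod (F (of_real x)))\<^sup>2) = ennreal (1 / 2 * (cmod (F (of_real x)))\<^sup>2)"
      by (rule ennreal_mult'[symmetric]) simp
    also have "\<dots> \<le> ennreal (pi / (2 * pi) * (cmod (F (of_real x)))\<^sup>2 + pi / (2 * pi)\<^sup>2 * (cmod (deriv F (of_real x)))\<^sup>2)"
      by (intro ennreal_leI) simp
    also have "\<dots> \<le> (\<integral>\<^sup>+v. \<integral>\<^sup>+w. ennreal ((cmod (F (of_real x + Complex v w)))\<^sup>2 * exp (- (2 * pi) * (v\<^sup>2 + w\<^sup>2))) \<partial>lborel \<partial>lborel)"
      by (rule gaussian_mean_square_lower_bound[OF F]) simp
    finally show "ennreal (1 / 2) * ennreal ((cmod (F (of_real x)))\<^sup>2) \<le> (\<integral>\<^sup>+v. \<integral>\<^sup>+w. e v * (\<phi> (x + v) w * e w) \<partial>lborel \<partial>lborel)"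
      unfolding split .
  qed
  also have "\<dots> = (\<integral>\<^sup>+x. \<integral>\<^sup>+v. e v * (\<integral>\<^sup>+w. \<phi> (x + v) w * e w \<partial>lborel) \<partial>lborel \<partial>lborel)"
    by (simp add: nn_integral_cmult)
  also have "\<dots> = (\<integral>\<^sup>+v. \<integral>\<^sup>+x. e v * (\<integral>\<^sup>+w. \<phi> (x + v) w * e w \<partial>lborel) \<partial>lborel \<partial>lborel)"
    by (rule lborel_pair.Fubini') measurable
  also have "\<dots> = (\<integral>\<^sup>+v. e v * (\<integral>\<^sup>+x. \<integral>\<^sup>+w. \<phi> (x + v) w * e w \<partial>lborel \<partial>lborel) \<partial>lborel)"
    by (simp add: nn_integral_cmult)
  also have "\<dots> = (\<integral>\<^sup>+v. e v * (\<integral>\<^sup>+x. \<integral>\<^sup>+w. \<phi> x w * e w \<partial>lborel \<partial>lborel) \<partial>lborel)"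
    by (subst nn_integral_translation) auto
  also have "(\<integral>\<^sup>+x. \<integral>\<^sup>+w. \<phi> x w * e w \<partial>lborel \<partial>lborel) = strip_mass (2 * pi) F"
    unfolding strip_mass_iterated[OF Fm] \<phi>_def e_def by (simp add: ennreal_mult)
  also have "(\<integral>\<^sup>+v. e v * strip_mass (2 * pi) F \<partial>lborel) = ennreal (1 / sqrt 2) * strip_mass (2 * pi) F"
    using nn_integral_gaussian[of "2 * pi" 0] by (simp add: nn_integral_multc e_def real_sqrt_divide)
  finally have "ennreal 2 * (ennreal (1 / 2) * (\<integral>\<^sup>+x. ennreal ((cmod (F (of_real x)))\<^sup>2) \<partial>lborel))
      \<le> ennreal 2 * (ennreal (1 / sqrt 2) * strip_mass (2 * pi) F)"
    by (rule mult_left_mono) simp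
  moreover have "ennreal 2 * ennreal (1 / 2) = 1" by (subst ennreal_mult[symmetric]) auto
  moreover have "ennreal 2 * ennreal (1 / sqrt 2) = ennreal (sqrt 2)"
    by (subst ennreal_mult[symmetric]) (auto simp: real_div_sqrt)
  ultimately show ?thesis by (simp only: mult.assoc[symmetric] mult_1)
qed

text \<open>
  The normalized trial function has density at most \<open>\<surd>2 L P(L x)\<^sup>2 exp (- b y\<^sup>2) / m\<close>, where \<open>P\<close> is the
  smoothed profile and \<open>m\<close> the integral of \<open>P\<^sup>2\<close>. The same \<open>m\<close> arises in the numerator of the
  \<open>y\<^sup>2\<close> term and cancels there, so that the loss \<open>1 - m\<close> of mass under smoothing does not
  spoil the leading coefficient of \<open>\<kappa>\<^sup>2\<close>; it affects the terms of order \<open>L\<close> only.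
\<close>

lemma I_inf_upper_bound:
  assumes e: "\<epsilon> > 0" "G > 0" and L: "L > 0" "L ^ 3 = \<epsilon>\<^sup>2" and \<tau>: "\<tau> > 0"
    and b: "b = 2 * pi - L\<^sup>2 / \<tau>\<^sup>2" "b > 0" and N0: "N0 = 1 - sqrt \<tau> * (1 + 2 * (tf_radius G)\<^sup>2 / G)" "N0 > 0"
  shows "I_inf \<epsilon> \<kappa> G \<le> ennreal (sqrt (2 * pi / b) * (\<kappa>\<^sup>2 / (4 * b) + L * ((tf_energy G + \<tau>\<^sup>2 / 2) / N0\<^sup>2)))"
proof -
  define P where "P = tf_smooth G \<tau>"
  have Pm[measurable]: "P \<in> borel_measurable borel" unfolding P_def by measurable
  define D2 D4 where "D2 = (LINT t|lborel. t\<^sup>2 * tf_density G t)" and "D4 = (LINT t|lborel. (tf_density G t)\<^sup>2)"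
  have D0: "0 \<le> D2" "0 \<le> D4"
    unfolding D2_def D4_def using tf_density_nonneg[OF e(2)] by (auto intro!: Bochner_Integration.integral_nonneg)
  have tfE: "tf_energy G = D2 / 2 + G / 2 * D4"
    unfolding tf_energy_eq[OF e(2)] D2_def D4_def by simp
  note bounds = nn_integral_tf_smooth_bounds[OF e(2) \<tau>, folded P_def D2_def D4_def]
  obtain m where m: "(\<integral>\<^sup>+x. ennreal ((P x)\<^sup>2) \<partial>lborel) = ennreal m" "0 \<le> m" "m \<le> 1"
    using bounds(1) by (cases "\<integral>\<^sup>+x. ennreal ((P x)\<^sup>2) \<partial>lborel") (auto simp: top_unique)
  obtain M2 where M2: "(\<integral>\<^sup>+x. ennreal (x\<^sup>2 * (P x)\<^sup>2) \<partial>lborel) = ennreal M2" "0 \<le> M2" "M2 \<le> D2 + \<tau>\<^sup>2"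
    using bounds(2) D0 by (cases "\<integral>\<^sup>+x. ennreal (x\<^sup>2 * (P x)\<^sup>2) \<partial>lborel") (auto simp: top_unique simp del: ennreal_plus)
  obtain M4 where M4: "(\<integral>\<^sup>+x. ennreal (P x ^ 4) \<partial>lborel) = ennreal M4" "0 \<le> M4" "M4 \<le> D4"
    using bounds(3) D0 by (cases "\<integral>\<^sup>+x. ennreal (P x ^ 4) \<partial>lborel") (auto simp: top_unique)
  have mN: "N0 \<le> m"
    using tf_smooth_mass_lower_bound[OF e(2) \<tau>] m unfolding N0(1)[symmetric] P_def[symmetric] by simp
  have m0: "m > 0" using mN N0(2) by simp
  have h0: "has_bochner_integral lborel (\<lambda>x. (P x)\<^sup>2) m"
    using m by (intro has_bochner_integral_nn_integral) auto
  have h2: "has_bochner_integral lborel (\<lambda>x. x\<^sup>2 * (P x)\<^sup>2) M2"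
    using M2 by (intro has_bochner_integral_nn_integral) auto
  have h4: "has_bochner_integral lborel (\<lambda>x. P x ^ 4) M4"
    using M4 by (intro has_bochner_integral_nn_integral) auto
  obtain F0 where F0: "F0 holomorphic_on UNIV" and F0b: "\<And>x y. cmod (F0 (Complex x y)) \<le> exp (y\<^sup>2 / (2 * \<tau>\<^sup>2)) * P x"
    and F0r: "\<And>x. F0 (of_real x) = of_real (P x)"
    using tf_smooth_entire_extension[OF e(2) \<tau>] unfolding P_def by blast
  define c where "c = sqrt (sqrt 2 * L)"
  have c2: "c\<^sup>2 = sqrt 2 * L" using L by (simp add: c_def)
  define F where "F z = of_real c * F0 (of_real L * z)" for z
  have F: "F holomorphic_on UNIV"
  proof -
    have "(\<lambda>z. of_real L * z) holomorphic_on UNIV" by (intro holomorphic_intros)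
    from holomorphic_on_compose_gen[OF this F0] have "(\<lambda>z. F0 (of_real L * z)) holomorphic_on UNIV" by (simp add: comp_def)
    then show ?thesis unfolding F_def by (intro holomorphic_intros)
  qed
  define w where "w = (\<lambda>(x, y). sqrt 2 * L * ((P (L * x))\<^sup>2 * exp (- b * y\<^sup>2)))"
  have w0: "0 \<le> w p" for p using L by (cases p) (simp add: w_def)
  have Fw: "strip_density (2 * pi) F x y \<le> w (x, y)" for x y
  proof -
    have "of_real L * Complex x y = Complex (L * x) (L * y)" by (simp add: complex_eq_iff)
    then have "(cmod (F (Complex x y)))\<^sup>2 = sqrt 2 * L * (cmod (F0 (Complex (L * x) (L * y))))\<^sup>2"
      by (simp add: F_def norm_mult power_mult_distrib c2)
    also have "\<dots> \<le> sqrt 2 * L * (exp ((L * y)\<^sup>2 / (2 * \<tau>\<^sup>2)) * P (L * x))\<^sup>2"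
      using L by (intro mult_left_mono power_mono F0b) auto
    also have "(exp ((L * y)\<^sup>2 / (2 * \<tau>\<^sup>2)) * P (L * x))\<^sup>2 = exp (L\<^sup>2 / \<tau>\<^sup>2 * y\<^sup>2) * (P (L * x))\<^sup>2"
      by (simp add: power_mult_distrib exp_double[symmetric])
    finally have "strip_density (2 * pi) F x y \<le> sqrt 2 * L * (exp (L\<^sup>2 / \<tau>\<^sup>2 * y\<^sup>2) * (P (L * x))\<^sup>2) * exp (- (2 * pi) * y\<^sup>2)"
      by (rule mult_right_mono) simp
    also have "\<dots> = sqrt 2 * L * ((P (L * x))\<^sup>2 * (exp (L\<^sup>2 / \<tau>\<^sup>2 * y\<^sup>2) * exp (- (2 * pi) * y\<^sup>2)))" by (simp only: mult_ac)
    also have "exp (L\<^sup>2 / \<tau>\<^sup>2 * y\<^sup>2) * exp (- (2 * pi) * y\<^sup>2) = exp (- b * y\<^sup>2)"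
      unfolding exp_add[symmetric] b(1) by (simp add: algebra_simps)
    finally show ?thesis by (simp add: w_def)
  qed
  have gb: "has_bochner_integral lborel (\<lambda>y. exp (- b * y\<^sup>2)) (sqrt (pi / b))"
    using has_bochner_integral_gaussian[OF b(2), of 0] by simp
  have gb2: "has_bochner_integral lborel (\<lambda>y. exp (- (2 * b) * y\<^sup>2)) (sqrt (pi / (2 * b)))"
    using has_bochner_integral_gaussian[of "2 * b" 0] b(2) by simp
  have p0: "has_bochner_integral lborel (\<lambda>(x, y). (P (L * x))\<^sup>2 * exp (- b * y\<^sup>2)) (m / L * sqrt (pi / b))"
    by (intro has_bochner_integral_plane_product has_bochner_integral_dilation[OF h0 L(1)] gb) auto
  have p1: "has_bochner_integral lborel (\<lambda>(x, y). ((L * x)\<^sup>2 * (P (L * x))\<^sup>2) * exp (- b * y\<^sup>2)) (M2 / L * sqrt (pi / b))"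
    by (intro has_bochner_integral_plane_product has_bochner_integral_dilation[OF h2 L(1)] gb) auto
  have p2: "has_bochner_integral lborel (\<lambda>(x, y). (P (L * x))\<^sup>2 * (y\<^sup>2 * exp (- b * y\<^sup>2))) (m / L * (sqrt (pi / b) / (2 * b)))"
    by (intro has_bochner_integral_plane_product has_bochner_integral_dilation[OF h0 L(1)] has_bochner_integral_gaussian_square b) auto
  have p3: "has_bochner_integral lborel (\<lambda>(x, y). P (L * x) ^ 4 * exp (- (2 * b) * y\<^sup>2)) (M4 / L * sqrt (pi / (2 * b)))"
    by (intro has_bochner_integral_plane_product has_bochner_integral_dilation[OF h4 L(1)] gb2) auto
  have wi: "has_bochner_integral lborel w (sqrt 2 * L * (m / L * sqrt (pi / b)))"
    using has_bochner_integral_mult_right[OF p0, of "sqrt 2 * L"] by (simp add: w_def case_prod_unfold)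
  have "strip_mass (2 * pi) F \<le> (\<integral>\<^sup>+p. ennreal (w p) \<partial>lborel)"
    unfolding strip_mass_def
    by (intro nn_integral_mono, simp only: split_paired_all split_conv) (intro ennreal_leI Fw)
  also have "\<dots> < \<infinity>" using wi w0 by (subst nn_integral_eq_integral) (auto simp: has_bochner_integral_iff)
  finally have massfin: "strip_mass (2 * pi) F < \<infinity>" .
  then obtain n where n: "strip_mass (2 * pi) F = ennreal n" "0 \<le> n" by (cases "strip_mass (2 * pi) F") auto
  have nm: "m \<le> n"
  proof -
    have "(\<integral>\<^sup>+x. ennreal ((cmod (F (of_real x)))\<^sup>2) \<partial>lborel) = (\<integral>\<^sup>+x. ennreal (sqrt 2 * L * (P (L * x))\<^sup>2) \<partial>lborel)"
      using L by (intro nn_integral_cong) (simp add: F_def of_real_mult[symmetric] F0r norm_mult power_mult_distrib c2 del: of_real_mult)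
    also have "\<dots> = ennreal (sqrt 2 * L * (m / L))"
      using has_bochner_integral_mult_right[OF has_bochner_integral_dilation[OF h0 L(1)], of "sqrt 2 * L"] L
      by (subst nn_integral_eq_integral) (auto simp: has_bochner_integral_iff)
    finally have "ennreal (sqrt 2 * m) \<le> ennreal (sqrt 2 * n)"
      using strip_mass_ge_axis_mass[OF F] L n by (simp add: ennreal_mult)
    then show ?thesis using n by (subst (asm) ennreal_le_iff) auto
  qed
  have n0: "n > 0" using m0 nm by simp
  define F1 where "F1 z = F z / of_real (sqrt n)" for z
  have F1: "F1 holomorphic_on UNIV" unfolding F1_def using n0 by (intro holomorphic_intros F) simp
  have F1n: "(cmod (F1 z))\<^sup>2 = (cmod (F z))\<^sup>2 / n" for z
    using n0 by (simp add: F1_def norm_divide power_divide)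
  note Fm[measurable] = holomorphic_borel_measurable[OF F]
  have mass1: "strip_mass (2 * pi) F1 = 1"
  proof -
    have "strip_mass (2 * pi) F1 = (\<integral>\<^sup>+p. ennreal (1 / n) * (case p of (x, y) \<Rightarrow> ennreal (strip_density (2 * pi) F x y)) \<partial>lborel)"
      unfolding strip_mass_def F1n using n0 by (intro nn_integral_cong) (auto simp: ennreal_mult'[symmetric])
    also have "\<dots> = ennreal (1 / n) * strip_mass (2 * pi) F"
      unfolding strip_mass_def by (rule nn_integral_cmult) (unfold lborel_prod[symmetric], measurable)
    also have "\<dots> = ennreal (1 / n * n)" unfolding n(1) using n0 by (intro ennreal_mult'[symmetric]) simp
    finally show ?thesis using n0 by simp
  qed
  obtain u where u: "u \<in> Lambda0" and uF: "\<And>x y. cmod (u (x, y)) = cmod (F1 (Complex x y)) * exp (- pi * y\<^sup>2)"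
    using Lambda0_from_strip[OF F1] mass1 by auto
  have u2: "(cmod (u (x, y)))\<^sup>2 = (cmod (F1 (Complex x y)))\<^sup>2 * exp (- (2 * pi) * y\<^sup>2)" for x y
    by (simp add: uF power_mult_distrib exp_double[symmetric] mult.assoc)
  have "(\<integral>\<^sup>+p. ennreal ((cmod (u p))\<^sup>2) \<partial>lborel) = 1"
    unfolding mass1[symmetric] strip_mass_def by (intro nn_integral_cong) (auto simp: u2)
  then have "(LINT p|lborel. (cmod (u p))\<^sup>2) = 1"
    using u by (subst integral_eq_nn_integral) (auto simp: Lambda0_def Lspace_def)
  then have un: "Lnorm 2 u = 1" by (simp add: Lnorm_eq_1_iff)
  have uw: "(cmod (u p))\<^sup>2 \<le> w p / m" for p
  proof (cases p)
    case (Pair x y)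
    have "(cmod (u (x, y)))\<^sup>2 = strip_density (2 * pi) F x y / n"
      by (simp add: u2 F1n)
    also have "\<dots> \<le> w (x, y) / m" using Fw w0 nm m0 by (intro frac_le) auto
    finally show ?thesis using Pair by simp
  qed
  define A1 A2 A3 where "A1 = sqrt 2 * L\<^sup>2 / (2 * m)" and "A2 = \<kappa>\<^sup>2 / (2 * m) * (sqrt 2 * L)" and "A3 = G / (2 * m\<^sup>2) * (2 * L\<^sup>2)"
  define W where "W p = A1 * (case p of (x, y) \<Rightarrow> ((L * x)\<^sup>2 * (P (L * x))\<^sup>2) * exp (- b * y\<^sup>2))
     + A2 * (case p of (x, y) \<Rightarrow> (P (L * x))\<^sup>2 * (y\<^sup>2 * exp (- b * y\<^sup>2)))
     + A3 * (case p of (x, y) \<Rightarrow> P (L * x) ^ 4 * exp (- (2 * b) * y\<^sup>2))" for p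
  have W: "has_bochner_integral lborel W (A1 * (M2 / L * sqrt (pi / b)) + A2 * (m / L * (sqrt (pi / b) / (2 * b))) + A3 * (M4 / L * sqrt (pi / (2 * b))))"
    unfolding W_def[abs_def] by (intro has_bochner_integral_add has_bochner_integral_mult_right p1 p2 p3)
  have eW: "1 / 2 * (\<epsilon>\<^sup>2 * x\<^sup>2 + \<kappa>\<^sup>2 * y\<^sup>2) * (cmod (u (x, y)))\<^sup>2 + G / 2 * cmod (u (x, y)) ^ 4 \<le> W (x, y)" for x y
  proof -
    have "cmod (u (x, y)) ^ 4 = ((cmod (u (x, y)))\<^sup>2)\<^sup>2" by (simp flip: power_mult)
    also have "\<dots> \<le> (w (x, y) / m)\<^sup>2" by (intro power_mono uw) simp
    finally have "1 / 2 * (\<epsilon>\<^sup>2 * x\<^sup>2 + \<kappa>\<^sup>2 * y\<^sup>2) * (cmod (u (x, y)))\<^sup>2 + G / 2 * cmod (u (x, y)) ^ 4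
       \<le> 1 / 2 * (\<epsilon>\<^sup>2 * x\<^sup>2 + \<kappa>\<^sup>2 * y\<^sup>2) * (w (x, y) / m) + G / 2 * (w (x, y) / m)\<^sup>2"
      using e uw[of "(x, y)"] by (intro add_mono mult_left_mono) auto
    also have "\<dots> = W (x, y)"
    proof -
      have "exp (- (2 * b) * y\<^sup>2) = (exp (- b * y\<^sup>2))\<^sup>2" by (simp add: exp_double[symmetric])
      then show ?thesis
        unfolding W_def w_def prod.case L(2)[symmetric] A1_def A2_def A3_def using m0
        by (simp add: power_mult_distrib power_divide) (simp add: field_simps power2_eq_square power3_eq_cube power4_eq_xxxx)
    qed
    finally show ?thesis .
  qed
  have W0: "0 \<le> W p" for p
    using m0 e L unfolding W_def A1_def A2_def A3_def by (cases p) (auto intro!: add_nonneg_nonneg mult_nonneg_nonneg)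
  have "I_inf \<epsilon> \<kappa> G \<le> energy \<epsilon> \<kappa> G u"
    unfolding I_inf_def using u un by (intro INF_lower) simp
  also have "\<dots> \<le> (\<integral>\<^sup>+p. ennreal (W p) \<partial>lborel)"
    unfolding energy_def
    by (intro nn_integral_mono, simp only: split_paired_all split_conv) (intro ennreal_leI eW)
  also have "\<dots> = ennreal (A1 * (M2 / L * sqrt (pi / b)) + A2 * (m / L * (sqrt (pi / b) / (2 * b))) + A3 * (M4 / L * sqrt (pi / (2 * b))))"
    using W W0 by (subst nn_integral_eq_integral) (auto simp: has_bochner_integral_iff)
  also have "\<dots> \<le> ennreal (sqrt (2 * pi / b) * (\<kappa>\<^sup>2 / (4 * b) + L * ((tf_energy G + \<tau>\<^sup>2 / 2) / N0\<^sup>2)))"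
  proof (rule ennreal_leI)
    define s where "s = sqrt (2 * pi / b)"
    have s1: "sqrt (pi / b) = s / sqrt 2" and s2: "sqrt (pi / (2 * b)) = s / 2"
    proof -
      have "s = sqrt 2 * sqrt (pi / b)" by (simp add: s_def real_sqrt_mult[symmetric])
      then show "sqrt (pi / b) = s / sqrt 2" by simp
      have "s = sqrt (4 * (pi / (2 * b)))" by (simp add: s_def)
      then show "sqrt (pi / (2 * b)) = s / 2" by (simp only: real_sqrt_mult) simp
    qed
    have "A1 * (M2 / L * sqrt (pi / b)) + A2 * (m / L * (sqrt (pi / b) / (2 * b))) + A3 * (M4 / L * sqrt (pi / (2 * b)))
       = s * (\<kappa>\<^sup>2 / (4 * b) + L * (M2 / (2 * m) + G * M4 / (2 * m\<^sup>2)))"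
      unfolding s1 s2 A1_def A2_def A3_def using L m0 b(2)
      by (simp add: divide_simps) (simp add: algebra_simps power2_eq_square)
    also have "\<dots> \<le> s * (\<kappa>\<^sup>2 / (4 * b) + L * ((tf_energy G + \<tau>\<^sup>2 / 2) / N0\<^sup>2))"
    proof -
      have "N0\<^sup>2 \<le> m\<^sup>2" by (rule power_mono[OF mN]) (use N0(2) in simp)
      moreover have "m\<^sup>2 \<le> m" using m0 m(3) by (simp add: power2_eq_square mult_left_le)
      ultimately have N2: "N0\<^sup>2 \<le> m\<^sup>2" "m\<^sup>2 \<le> m" "N0\<^sup>2 > 0" using N0(2) by auto
      have "M2 / (2 * m) \<le> (D2 + \<tau>\<^sup>2) / (2 * N0\<^sup>2)" using M2 D0 N2 m0 by (intro frac_le) auto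
      moreover have "G * M4 / (2 * m\<^sup>2) \<le> G * D4 / (2 * N0\<^sup>2)" using M4 D0 N2 m0 e by (intro frac_le) auto
      ultimately have "M2 / (2 * m) + G * M4 / (2 * m\<^sup>2) \<le> (D2 + \<tau>\<^sup>2) / (2 * N0\<^sup>2) + G * D4 / (2 * N0\<^sup>2)" by simp
      also have "\<dots> = (tf_energy G + \<tau>\<^sup>2 / 2) / N0\<^sup>2" unfolding tfE by (simp add: add_divide_distrib)
      finally show ?thesis using L b(2) by (intro mult_left_mono add_left_mono) (auto simp: s_def)
    qed
    finally show "A1 * (M2 / L * sqrt (pi / b)) + A2 * (m / L * (sqrt (pi / b) / (2 * b))) + A3 * (M4 / L * sqrt (pi / (2 * b)))
       \<le> sqrt (2 * pi / b) * (\<kappa>\<^sup>2 / (4 * b) + L * ((tf_energy G + \<tau>\<^sup>2 / 2) / N0\<^sup>2))"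
      by (simp add: s_def)
  qed
  finally show ?thesis .
qed

section \<open>From densities to wave functions\<close>

lemma AE_plane_fst:
  assumes "AE x in lborel. Q (x :: real)"
  shows "AE p in (lborel :: (real \<times> real) measure). Q (fst p)"
proof -
  obtain N where N: "N \<in> null_sets lborel" "{x \<in> space lborel. \<not> Q x} \<subseteq> N"
    using assms by (auto simp: eventually_ae_filter)
  have "emeasure (lborel \<Otimes>\<^sub>M lborel) (N \<times> (UNIV :: real set)) = emeasure lborel N * emeasure lborel (UNIV :: real set)"
    using N by (intro lborel.emeasure_pair_measure_Times) auto
  then have "N \<times> (UNIV :: real set) \<in> null_sets (lborel \<Otimes>\<^sub>M lborel)"
    using N by (intro null_setsI) (auto simp: null_setsD1)
  then have "N \<times> (UNIV :: real set) \<in> null_sets lborel" by (simp only: lborel_prod)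
  then show ?thesis by (rule AE_I') (use N in auto)
qed

lemma has_bochner_integral_plane_dilation:
  fixes f :: "real \<times> real \<Rightarrow> real"
  assumes f: "has_bochner_integral lborel f a" "\<And>p. 0 \<le> f p" and L: "L > 0"
  shows "has_bochner_integral lborel (\<lambda>(x, y). f (x / L, y)) (L * a)"
proof -
  have fm: "f \<in> borel_measurable borel" and a: "0 \<le> a"
    using f by (auto simp: has_bochner_integral_iff intro!: Bochner_Integration.integral_nonneg)
  then have [measurable]: "f \<in> borel_measurable (borel \<Otimes>\<^sub>M borel)" by (simp add: borel_prod)
  have gm: "(\<lambda>(x, y). f (x / L, y)) \<in> borel_measurable (borel :: (real \<times> real) measure)"
    unfolding borel_prod[symmetric] by measurable
  have "(\<integral>\<^sup>+p. ennreal (case p of (x, y) \<Rightarrow> f (x / L, y)) \<partial>lborel) = (\<integral>\<^sup>+x. \<integral>\<^sup>+y. ennreal (f (x / L, y)) \<partial>lborel \<partial>lborel)"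
    using measurable_compose[OF gm measurable_ennreal] by (subst nn_integral_plane_iterated) auto
  also have "\<dots> = ennreal L * (\<integral>\<^sup>+x. \<integral>\<^sup>+y. ennreal (f (x, y)) \<partial>lborel \<partial>lborel)"
    using L by (subst nn_integral_real_affine[where c=L and t=0]) (auto simp: field_simps)
  also have "(\<integral>\<^sup>+x. \<integral>\<^sup>+y. ennreal (f (x, y)) \<partial>lborel \<partial>lborel) = (\<integral>\<^sup>+p. ennreal (f p) \<partial>lborel)"
    using fm by (subst nn_integral_plane_iterated) auto
  also have "\<dots> = ennreal a"
    using f by (subst nn_integral_eq_integral) (auto simp: has_bochner_integral_iff)
  finally show ?thesis
    using gm f(2) a L by (intro has_bochner_integral_nn_integral) (auto simp: ennreal_mult)
qed

lemma integral_tf_profile_le: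
  assumes G: "G > 0"
  shows "integrable lborel (tf_profile G)" "(LINT t|lborel. tf_profile G t) \<le> 2 * tf_radius G + 1"
proof -
  define T where "T = tf_radius G"
  have T: "T > 0" using tf_radius_pos[OF G] by (simp add: T_def)
  show i: "integrable lborel (tf_profile G)"
    by (rule integrable_continuous_compact_support[where T=T]) (auto simp: continuous_tf_profile tf_profile_outside G T_def)
  have ind: "integrable lborel (indicator {-T..T} :: real \<Rightarrow> real)" by (simp add: emeasure_lborel_Icc_eq)
  have "(LINT t|lborel. tf_profile G t) \<le> (LINT t|lborel. indicator {-T..T} t + tf_density G t)"
  proof (rule integral_mono)
    fix t
    show "tf_profile G t \<le> indicator {-T..T} t + tf_density G t"
    proof (cases "\<bar>t\<bar> \<le> T")
      case True
      have "0 \<le> (tf_profile G t - 1)\<^sup>2" by simp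
      then have "2 * tf_profile G t \<le> 1 + (tf_profile G t)\<^sup>2" by (simp add: power2_eq_square algebra_simps)
      then have "tf_profile G t \<le> 1 + (tf_profile G t)\<^sup>2" using tf_profile_nonneg[OF G, of t] by linarith
      then show ?thesis using True by (simp add: tf_profile_square[OF G] indicator_def abs_le_iff)
    qed (use tf_profile_outside[OF G, of t] tf_density_nonneg[OF G, of t] in \<open>auto simp: T_def\<close>)
  qed (use i ind integrable_tf_density[OF G] in auto)
  also have "\<dots> = 2 * T + 1" using ind integrable_tf_density[OF G] T by (simp add: integral_tf_density[OF G])
  finally show "(LINT t|lborel. tf_profile G t) \<le> 2 * tf_radius G + 1" by (simp add: T_def)
qed

text \<open>
  Both bounds compare the rescaled moduli \<open>a = |u|\<close> and \<open>b\<close>, the limit profile, through their squares.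
  The fourth moment uses \<open>|a - b|\<^sup>4 \<le> (a\<^sup>2 - b\<^sup>2)\<^sup>2\<close>. For the second moment, \<open>|a - b|\<^sup>2 \<le> |a\<^sup>2 - b\<^sup>2|\<close> and the
  excess of \<open>b\<^sup>2\<close> over \<open>a\<^sup>2\<close> is integrated with the help of the integrable function \<open>b\<close>, since
  an \<open>L\<^sup>2\<close> bound alone gives nothing on a set of infinite measure.
\<close>

lemma profile_error_bounds:
  assumes \<epsilon>: "\<epsilon> > 0" and G: "G > 0" and L: "L = \<epsilon> powr (2/3)"
    and u: "u \<in> Lambda0" "Lnorm 2 u = 1"
    and int: "integrable lborel (\<lambda>p. ((cmod (u p))\<^sup>2 - planar_profile G L p)\<^sup>2)"
    and D: "(LINT p|lborel. ((cmod (u p))\<^sup>2 - planar_profile G L p)\<^sup>2) = D"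
    and p: "J_nonneg_minimizer G p" and s: "s > 0"
  shows "profile_error \<epsilon> u p \<in> Lspace 2 \<inter> Lspace 4"
    and "(LINT z|lborel. norm (profile_error \<epsilon> u p z) ^ 4) \<le> D / L"
    and "(LINT z|lborel. norm (profile_error \<epsilon> u p z) ^ 2) \<le> 2 * (s * (2 powr (1/4) * (2 * tf_radius G + 1)) + D / L / s\<^sup>2)"
proof -
  have L0: "L > 0" using \<epsilon> L by simp
  define c where "c = \<epsilon> powr (1/3)"
  have c: "c > 0" "c\<^sup>2 = L" using \<epsilon> by (simp_all add: c_def L powr_power)
  have um: "u \<in> borel_measurable borel" using u by (simp add: Lambda0_def Lspace_def)
  then have um2[measurable]: "u \<in> borel_measurable (borel \<Otimes>\<^sub>M borel)" by (simp add: borel_prod)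
  have pm[measurable]: "p \<in> borel_measurable borel" using p by (simp add: J_nonneg_minimizer_def Lspace_def)
  define a where "a = (\<lambda>(x, y). 1 / c * cmod (u (x / L, y)))"
  define b where "b = (\<lambda>(x, y). tf_profile G x * (2 powr (1/4) * exp (- pi * y\<^sup>2)))"
  define err where "err z = a z - b z" for z
  have am: "a \<in> borel_measurable (borel :: (real \<times> real) measure)"
    unfolding a_def borel_prod[symmetric] by measurable
  have bm: "b \<in> borel_measurable (borel :: (real \<times> real) measure)"
    unfolding b_def borel_prod[symmetric] by measurable
  note [measurable] = am bm
  have errm[measurable]: "err \<in> borel_measurable borel" unfolding err_def[abs_def] by measurable
  have pem[measurable]: "profile_error \<epsilon> u p \<in> borel_measurable (borel :: (real \<times> real) measure)"
    unfolding profile_error_def borel_prod[symmetric] by measurable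
  have ae: "AE z in lborel. profile_error \<epsilon> u p z = err z"
    using AE_plane_fst[OF J_nonneg_minimizer_unique[OF G p]]
    by eventually_elim (auto simp: profile_error_def err_def a_def b_def c_def L)
  have a0: "0 \<le> a z" for z using c by (cases z) (simp add: a_def)
  have b0: "0 \<le> b z" for z using tf_profile_nonneg[OF G] by (cases z) (simp add: b_def)
  have a2: "(a (x, y))\<^sup>2 = 1 / L * (cmod (u (x / L, y)))\<^sup>2" for x y
    by (simp add: a_def power_mult_distrib power_divide c)
  have root: "(2 powr (1/4))\<^sup>2 = sqrt 2" by (simp add: powr_power powr_half_sqrt[symmetric])
  have b2: "(b (x, y))\<^sup>2 = 1 / L * planar_profile G L (x / L, y)" for x y
    using L0 by (simp add: b_def planar_profile_def power_mult_distrib tf_profile_square[OF G] root exp_double[symmetric] mult_ac)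
  have u2: "has_bochner_integral lborel (\<lambda>z. (cmod (u z))\<^sup>2) 1"
    using u by (simp add: Lambda0_def Lspace_def Lnorm_eq_1_iff has_bochner_integral_iff)
  have a2': "(\<lambda>z. (a z)\<^sup>2) = (\<lambda>z. 1 / L * (case z of (x, y) \<Rightarrow> (cmod (u (x / L, y)))\<^sup>2))"
    and b2': "(\<lambda>z. (b z)\<^sup>2) = (\<lambda>z. 1 / L * (case z of (x, y) \<Rightarrow> planar_profile G L (x / L, y)))"
    by (auto simp: fun_eq_iff a2 b2)
  have a2i: "has_bochner_integral lborel (\<lambda>z. (a z)\<^sup>2) 1"
    using has_bochner_integral_mult_right[OF has_bochner_integral_plane_dilation[OF u2 _ L0], of "1 / L"] L0
    unfolding a2' by simp
  have b2i: "has_bochner_integral lborel (\<lambda>z. (b z)\<^sup>2) 1"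
    using has_bochner_integral_mult_right[OF has_bochner_integral_plane_dilation[OF has_bochner_integral_planar_profile[OF G L0] planar_profile_nonneg[OF G L0] L0], of "1 / L"] L0
    unfolding b2' by simp
  have d2i: "has_bochner_integral lborel (\<lambda>z. ((a z)\<^sup>2 - (b z)\<^sup>2)\<^sup>2) (D / L)"
  proof -
    have "has_bochner_integral lborel (\<lambda>p. ((cmod (u p))\<^sup>2 - planar_profile G L p)\<^sup>2) D"
      using int D by (simp add: has_bochner_integral_iff)
    from has_bochner_integral_mult_right[OF has_bochner_integral_plane_dilation[OF this _ L0], of "1 / L\<^sup>2"]
    have "has_bochner_integral lborel (\<lambda>z. 1 / L\<^sup>2 * (case z of (x, y) \<Rightarrow> ((cmod (u (x / L, y)))\<^sup>2 - planar_profile G L (x / L, y))\<^sup>2)) (1 / L\<^sup>2 * (L * D))"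
      by simp
    also have "(\<lambda>z. 1 / L\<^sup>2 * (case z of (x, y) \<Rightarrow> ((cmod (u (x / L, y)))\<^sup>2 - planar_profile G L (x / L, y))\<^sup>2)) = (\<lambda>z. ((a z)\<^sup>2 - (b z)\<^sup>2)\<^sup>2)"
      by (auto simp: fun_eq_iff a2 b2 diff_divide_distrib[symmetric] power_divide)
    also have "1 / L\<^sup>2 * (L * D) = D / L" by (simp add: power2_eq_square)
    finally show ?thesis .
  qed
  have bi: "has_bochner_integral lborel b ((LINT t|lborel. tf_profile G t) * 2 powr (1/4))"
  proof -
    have "has_bochner_integral lborel (\<lambda>y. 2 powr (1/4) * exp (- pi * y\<^sup>2)) (2 powr (1/4) * sqrt (pi / pi))"
      using has_bochner_integral_gaussian[of pi 0] by (intro has_bochner_integral_mult_right) simp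
    then show ?thesis unfolding b_def
      using integral_tf_profile_le(1)[OF G] tf_profile_nonneg[OF G]
      by (intro has_bochner_integral_plane_product) (auto simp: has_bochner_integral_iff)
  qed
  have e2: "(err z)\<^sup>2 \<le> \<bar>(a z)\<^sup>2 - (b z)\<^sup>2\<bar>" for z
  proof -
    have "(err z)\<^sup>2 = \<bar>a z - b z\<bar> * \<bar>a z - b z\<bar>" by (simp add: err_def power2_eq_square abs_mult[symmetric])
    also have "\<dots> \<le> \<bar>a z - b z\<bar> * (a z + b z)" using a0[of z] b0[of z] by (intro mult_left_mono) auto
    also have "\<dots> = \<bar>(a z)\<^sup>2 - (b z)\<^sup>2\<bar>" using a0[of z] b0[of z]
      by (simp add: power2_eq_square square_diff_square_factored abs_mult mult.commute)
    finally show ?thesis .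
  qed
  have e4: "(err z) ^ 4 \<le> ((a z)\<^sup>2 - (b z)\<^sup>2)\<^sup>2" for z
  proof -
    have "(err z) ^ 4 = ((err z)\<^sup>2)\<^sup>2" by (simp flip: power_mult)
    also have "\<dots> \<le> \<bar>(a z)\<^sup>2 - (b z)\<^sup>2\<bar>\<^sup>2" by (intro power_mono e2) simp
    finally show ?thesis by simp
  qed
  \<comment> \<open>The two densities have equal mass, so their L1 distance is twice the mass missing from the
    first one, which is dominated by the second.\<close>
  have e2': "(err z)\<^sup>2 \<le> 2 * (s * b z + ((a z)\<^sup>2 - (b z)\<^sup>2)\<^sup>2 / s\<^sup>2) + ((a z)\<^sup>2 - (b z)\<^sup>2)" for z
  proof -
    define d where "d = max 0 ((b z)\<^sup>2 - (a z)\<^sup>2)"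
    have "\<bar>(a z)\<^sup>2 - (b z)\<^sup>2\<bar> = 2 * d + ((a z)\<^sup>2 - (b z)\<^sup>2)" by (auto simp: d_def max_def)
    moreover have "d \<le> s * b z + ((a z)\<^sup>2 - (b z)\<^sup>2)\<^sup>2 / s\<^sup>2"
    \<comment> \<open>If \<open>d\<close> exceeds \<open>s b\<close>, then \<open>d \<le> b\<^sup>2\<close> forces \<open>d \<ge> s\<^sup>2\<close>, so \<open>d \<le> d\<^sup>2 / s\<^sup>2\<close>.\<close>
    proof (cases "d \<le> s * b z")
      case True
      then show ?thesis using add_increasing2[of "((a z)\<^sup>2 - (b z)\<^sup>2)\<^sup>2 / s\<^sup>2" d "s * b z"] by simp
    next
      case False
      then have lt: "s * b z < d" by simp
      have d0: "0 \<le> d" "d \<le> (b z)\<^sup>2" by (auto simp: d_def)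
      have "s\<^sup>2 * d \<le> s\<^sup>2 * (b z)\<^sup>2" using d0 by (intro mult_left_mono) auto
      also have "\<dots> = (s * b z)\<^sup>2" by (simp add: power_mult_distrib)
      also have "\<dots> \<le> d\<^sup>2" using lt s b0[of z] by (intro power_mono) auto
      also have "d\<^sup>2 \<le> ((a z)\<^sup>2 - (b z)\<^sup>2)\<^sup>2" by (auto simp: d_def max_def power2_commute)
      finally have "d \<le> ((a z)\<^sup>2 - (b z)\<^sup>2)\<^sup>2 / s\<^sup>2" using s by (simp add: field_simps)
      moreover have "0 \<le> s * b z" using s b0[of z] by simp
      ultimately show ?thesis by simp
    qed
    ultimately show ?thesis using e2[of z] by simp
  qed
  have bound_i: "has_bochner_integral lborel (\<lambda>z. 2 * (s * b z + ((a z)\<^sup>2 - (b z)\<^sup>2)\<^sup>2 / s\<^sup>2) + ((a z)\<^sup>2 - (b z)\<^sup>2))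
      (2 * (s * ((LINT t|lborel. tf_profile G t) * 2 powr (1/4)) + D / L / s\<^sup>2) + (1 - 1))"
    by (intro has_bochner_integral_add has_bochner_integral_mult_right has_bochner_integral_divide has_bochner_integral_diff bi d2i a2i b2i)
  have i2: "integrable lborel (\<lambda>z. (err z)\<^sup>2)"
  proof (rule Bochner_Integration.integrable_bound)
    show "integrable lborel (\<lambda>z. 2 * (s * b z + ((a z)\<^sup>2 - (b z)\<^sup>2)\<^sup>2 / s\<^sup>2) + ((a z)\<^sup>2 - (b z)\<^sup>2))"
      using bound_i by (simp add: has_bochner_integral_iff)
    show "AE z in lborel. norm ((err z)\<^sup>2) \<le> norm (2 * (s * b z + ((a z)\<^sup>2 - (b z)\<^sup>2)\<^sup>2 / s\<^sup>2) + ((a z)\<^sup>2 - (b z)\<^sup>2))"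
    proof (rule AE_I2)
      fix z
      show "norm ((err z)\<^sup>2) \<le> norm (2 * (s * b z + ((a z)\<^sup>2 - (b z)\<^sup>2)\<^sup>2 / s\<^sup>2) + ((a z)\<^sup>2 - (b z)\<^sup>2))"
        using order_trans[OF e2'[of z] abs_ge_self] by simp
    qed
  qed simp
  have i4: "integrable lborel (\<lambda>z. err z ^ 4)"
  proof (rule Bochner_Integration.integrable_bound)
    show "integrable lborel (\<lambda>z. ((a z)\<^sup>2 - (b z)\<^sup>2)\<^sup>2)" using d2i by (simp add: has_bochner_integral_iff)
    show "AE z in lborel. norm (err z ^ 4) \<le> norm (((a z)\<^sup>2 - (b z)\<^sup>2)\<^sup>2)" using e4 by (intro AE_I2) simp
  qed simp
  have ae2: "AE z in lborel. norm (profile_error \<epsilon> u p z) ^ 2 = (err z)\<^sup>2"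
    and ae4: "AE z in lborel. norm (profile_error \<epsilon> u p z) ^ 4 = err z ^ 4"
    using ae by (eventually_elim, simp add: power_even_abs)+
  have "integrable lborel (\<lambda>z. norm (profile_error \<epsilon> u p z) ^ 2)"
    using integrable_cong_AE[OF _ _ ae2] i2 by simp
  moreover have "integrable lborel (\<lambda>z. norm (profile_error \<epsilon> u p z) ^ 4)"
    using integrable_cong_AE[OF _ _ ae4] i4 by simp
  ultimately show "profile_error \<epsilon> u p \<in> Lspace 2 \<inter> Lspace 4" by (simp add: Lspace_def)
  have "(LINT z|lborel. norm (profile_error \<epsilon> u p z) ^ 4) = (LINT z|lborel. err z ^ 4)"
    by (rule integral_cong_AE[OF _ _ ae4]) simp_all
  also have "\<dots> \<le> (LINT z|lborel. ((a z)\<^sup>2 - (b z)\<^sup>2)\<^sup>2)"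
    using i4 d2i e4 by (intro integral_mono) (auto simp: has_bochner_integral_iff)
  finally show "(LINT z|lborel. norm (profile_error \<epsilon> u p z) ^ 4) \<le> D / L" using d2i by (simp add: has_bochner_integral_iff)
  have "(LINT z|lborel. norm (profile_error \<epsilon> u p z) ^ 2) = (LINT z|lborel. (err z)\<^sup>2)"
    by (rule integral_cong_AE[OF _ _ ae2]) simp_all
  also have "\<dots> \<le> (LINT z|lborel. 2 * (s * b z + ((a z)\<^sup>2 - (b z)\<^sup>2)\<^sup>2 / s\<^sup>2) + ((a z)\<^sup>2 - (b z)\<^sup>2))"
    using i2 bound_i e2' by (intro integral_mono) (auto simp: has_bochner_integral_iff)
  also have "\<dots> = 2 * (s * ((LINT t|lborel. tf_profile G t) * 2 powr (1/4)) + D / L / s\<^sup>2)"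
    using has_bochner_integral_integral_eq[OF bound_i] by simp
  also have "\<dots> \<le> 2 * (s * (2 powr (1/4) * (2 * tf_radius G + 1)) + D / L / s\<^sup>2)"
    using mult_right_mono[OF integral_tf_profile_le(2)[OF G], of "2 powr (1/4)"] s
    by (intro mult_left_mono add_right_mono) (auto simp: mult.commute)
  finally show "(LINT z|lborel. norm (profile_error \<epsilon> u p z) ^ 2) \<le> 2 * (s * (2 powr (1/4) * (2 * tf_radius G + 1)) + D / L / s\<^sup>2)" .
qed

section \<open>Bounds on the parameters\<close>

lemma parameter_bounds:
  fixes g \<omega>\<^sub>0 :: real
  assumes g: "0 < g" and w0: "0 < \<omega>\<^sub>0"
  obtains K Gl Gu where "K > 0" "Gl > 0" "Gu > 0"
    "\<And>\<omega> \<nu> \<epsilon>. (\<omega>, \<nu>, \<epsilon>) \<in> admissible \<omega>\<^sub>0 \<Longrightarrow> 0 < kappa \<omega> \<nu> \<epsilon> \<and> kappa \<omega> \<nu> \<epsilon> \<le> K \<and> Gl \<le> g0 g \<omega> \<nu> \<and> g0 g \<omega> \<nu> \<le> Gu"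
proof
  define K where "K = sqrt (3 * (1 + 2 / (2 * \<omega>\<^sub>0\<^sup>2))) / (\<omega>\<^sub>0 / 3)"
  define Gl where "Gl = g * (2 * \<omega>\<^sub>0 / 6) * (4 * \<omega>\<^sub>0)\<^sup>2 / (4 * (9 / \<omega>\<^sub>0))"
  define Gu where "Gu = g * (6 / (4 * \<omega>\<^sub>0)) * (6 / \<omega>\<^sub>0)\<^sup>2 / (4 * (\<omega>\<^sub>0 / 3))"
  show "K > 0" "Gl > 0" "Gu > 0"
    unfolding K_def Gl_def Gu_def using g w0 by (auto intro!: divide_pos_pos mult_pos_pos add_pos_pos)
  fix \<omega> \<nu> \<epsilon> :: real
  assume adm: "(\<omega>, \<nu>, \<epsilon>) \<in> admissible \<omega>\<^sub>0"
  then have nu: "0 \<le> \<nu>" and ep: "0 < \<epsilon>" and sum: "\<omega>\<^sup>2 + \<nu>\<^sup>2 + \<epsilon>\<^sup>2 = 1" and wl: "\<omega>\<^sub>0 \<le> \<omega>" by (auto simp: admissible_def)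
  have w: "\<omega> > 0" using wl w0 by simp
  have sq: "0 \<le> \<omega>\<^sup>2" "0 \<le> \<nu>\<^sup>2" "0 \<le> \<epsilon>\<^sup>2" by simp_all
  have w2: "\<omega>\<^sup>2 \<le> 1" and n2: "\<nu>\<^sup>2 \<le> 1" and e2: "\<epsilon>\<^sup>2 \<le> 1" using sum sq by linarith+
  have w1: "\<omega> \<le> 1" using w2 w by (simp add: power_le_one_iff abs_square_le_1)
  have n4: "\<nu> ^ 4 = (\<nu>\<^sup>2)\<^sup>2" by (simp flip: power_mult)
  have n4': "0 \<le> \<nu> ^ 4" "\<nu> ^ 4 \<le> 1" unfolding n4 by (simp, rule power_le_one[OF sq(2) n2])
  define al where "al = alpha \<omega> \<nu>"
  have al1: "2 * \<omega> \<le> al" unfolding al_def alpha_def using n4' w by (intro real_le_rsqrt) (simp add: power_mult_distrib)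
  have al2: "al \<le> 3" unfolding al_def alpha_def using n4' w2 by (intro real_le_lsqrt) auto
  have al3: "\<nu>\<^sup>2 \<le> al" unfolding al_def alpha_def n4 by (intro real_le_rsqrt) simp
  define A where "A = al + 2 * \<omega>\<^sup>2 + \<nu>\<^sup>2"
  have A: "2 * \<omega>\<^sub>0 \<le> A" "A \<le> 6"
    unfolding A_def using al1 al2 wl w w2 n2 sq by linarith+
  have A0: "A > 0" using A w0 by linarith
  define mu where "mu = mu2 \<omega> \<nu>"
  have mu: "1 \<le> mu" "mu \<le> 3"
    unfolding mu_def mu2_def al_def[symmetric] using al1 al2 w sq w2 by (auto intro!: real_le_lsqrt real_le_rsqrt)
  have be: "beta2 \<omega> \<nu> = 2 * \<omega> * mu / A" by (simp add: beta2_def mu_def A_def al_def)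
  have be1: "\<omega>\<^sub>0 / 3 \<le> beta2 \<omega> \<nu>"
  proof -
    have "2 * \<omega>\<^sub>0 * 1 / 6 \<le> 2 * \<omega> * mu / A" using mu A A0 wl w0 by (intro frac_le mult_mono) auto
    then show ?thesis by (simp add: be)
  qed
  have be2: "beta2 \<omega> \<nu> \<le> 9 / \<omega>\<^sub>0"
  proof -
    have "2 * \<omega> * mu / A \<le> 2 * 1 * 3 / (2 * \<omega>\<^sub>0)" using mu A A0 wl w0 w w1 by (intro frac_le mult_mono) auto
    also have "\<dots> \<le> 9 / \<omega>\<^sub>0" using w0 by (simp add: field_simps)
    finally show ?thesis by (simp add: be)
  qed
  have be0: "beta2 \<omega> \<nu> > 0" using be1 w0 by (intro less_le_trans[OF _ be1]) simp
  have k1: "kappa1 \<omega> \<nu> \<epsilon> > 0" "kappa1 \<omega> \<nu> \<epsilon> \<le> sqrt (3 * (1 + 2 / (2 * \<omega>\<^sub>0\<^sup>2)))"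
  proof -
    define d where "d = al - \<nu>\<^sup>2 + 2 * \<omega>\<^sup>2"
    have "\<omega>\<^sub>0\<^sup>2 \<le> \<omega>\<^sup>2" using wl w0 by (intro power_mono) auto
    then have d: "2 * \<omega>\<^sub>0\<^sup>2 \<le> d" "d > 0" unfolding d_def using al3 w by (auto intro: add_nonneg_pos)
    have "2 * \<nu>\<^sup>2 / d \<le> 2 / (2 * \<omega>\<^sub>0\<^sup>2)" using d n2 w0 by (intro frac_le) auto
    moreover have "0 \<le> 2 * \<nu>\<^sup>2 / d" using d by simp
    moreover have "0 < 2 * \<nu>\<^sup>2 + \<epsilon>\<^sup>2" using ep by (intro add_nonneg_pos) auto
    moreover from calculation have "(2 * \<nu>\<^sup>2 + \<epsilon>\<^sup>2) * (1 + 2 * \<nu>\<^sup>2 / d) \<le> 3 * (1 + 2 / (2 * \<omega>\<^sub>0\<^sup>2))"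
      using n2 e2 by (intro mult_mono) auto
    ultimately show "kappa1 \<omega> \<nu> \<epsilon> > 0" "kappa1 \<omega> \<nu> \<epsilon> \<le> sqrt (3 * (1 + 2 / (2 * \<omega>\<^sub>0\<^sup>2)))"
      unfolding kappa1_def al_def[symmetric] d_def[symmetric] by (simp_all only: real_sqrt_le_iff real_sqrt_gt_0_iff)
        (auto intro!: mult_pos_pos add_pos_nonneg)
  qed
  have kap: "0 < kappa \<omega> \<nu> \<epsilon>" "kappa \<omega> \<nu> \<epsilon> \<le> K"
    unfolding kappa_def K_def by (rule divide_pos_pos[OF k1(1) be0], rule frac_le[OF _ k1(2) _ be1]) (use w0 in auto)
  have g1: "g1 g \<omega> \<nu> = g * (A / (2 * al))" by (simp add: g1_def A_def al_def)
  have g1l: "g * (2 * \<omega>\<^sub>0 / 6) \<le> g1 g \<omega> \<nu>"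
    unfolding g1 using g A al1 al2 w w0 by (intro mult_left_mono frac_le) auto
  have g1u: "g1 g \<omega> \<nu> \<le> g * (6 / (4 * \<omega>\<^sub>0))"
    unfolding g1 using g A al1 al2 w w0 wl by (intro mult_left_mono frac_le) auto
  have ga: "4 * \<omega>\<^sub>0 \<le> gamma \<omega> \<nu>" "gamma \<omega> \<nu> \<le> 6 / \<omega>\<^sub>0"
  proof -
    have "4 * \<omega>\<^sub>0 * \<omega> \<le> 4 * \<omega> * 1" using w w1 wl w0 by (simp add: mult.commute)
    then have "4 * \<omega>\<^sub>0 * \<omega> \<le> 2 * al" using al1 by linarith
    then show "4 * \<omega>\<^sub>0 \<le> gamma \<omega> \<nu>" using w by (simp add: gamma_def al_def field_simps)
    show "gamma \<omega> \<nu> \<le> 6 / \<omega>\<^sub>0" unfolding gamma_def al_def[symmetric] using al2 wl w0 by (intro frac_le) auto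
  qed
  have "Gl \<le> g0 g \<omega> \<nu>"
    unfolding Gl_def g0_def using g1l ga(1) be0 be2 w0 g by (intro frac_le mult_mono power_mono mult_nonneg_nonneg) (auto intro: order_trans[OF _ g1l])
  moreover have "g0 g \<omega> \<nu> \<le> Gu"
    unfolding Gu_def g0_def using g1u ga be0 be1 w0 g by (intro frac_le mult_mono power_mono mult_nonneg_nonneg) auto
  ultimately show "0 < kappa \<omega> \<nu> \<epsilon> \<and> kappa \<omega> \<nu> \<epsilon> \<le> K \<and> Gl \<le> g0 g \<omega> \<nu> \<and> g0 g \<omega> \<nu> \<le> Gu"
    using kap by blast
qed

lemma eventually_limit_regimeI:
  assumes "\<delta> > 0"
    and "\<And>\<omega> \<nu> \<epsilon>. (\<omega>, \<nu>, \<epsilon>) \<in> admissible \<omega>\<^sub>0 \<Longrightarrow> \<epsilon> < \<delta> \<Longrightarrow> \<epsilon> powr (1/3) / kappa \<omega> \<nu> \<epsilon> < \<delta> \<Longrightarrow> P \<omega> \<nu> \<epsilon>"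
  shows "\<forall>\<^sub>F (\<omega>, \<nu>, \<epsilon>) in limit_regime \<omega>\<^sub>0. P \<omega> \<nu> \<epsilon>"
proof -
  have "open ({..<\<delta>} \<times> {..<\<delta>})" by (intro open_Times) auto
  then have "eventually (\<lambda>p. p \<in> {..<\<delta>} \<times> {..<\<delta>}) (nhds (0, 0))"
    using assms(1) by (intro eventually_nhds_in_open) auto
  then have "\<forall>\<^sub>F x in filtercomap (\<lambda>(\<omega>, \<nu>, \<epsilon>). (\<epsilon>, \<epsilon> powr (1/3) / kappa \<omega> \<nu> \<epsilon>)) (nhds (0, 0)).
      (case x of (\<omega>, \<nu>, \<epsilon>) \<Rightarrow> (\<epsilon>, \<epsilon> powr (1/3) / kappa \<omega> \<nu> \<epsilon>)) \<in> {..<\<delta>} \<times> {..<\<delta>}"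
    by (rule eventually_filtercomapI)
  then show ?thesis
    unfolding limit_regime_def eventually_inf_principal
    by eventually_elim (use assms(2) in auto)
qed

section \<open>Asymptotics of the infimum\<close>

text \<open>
  The upper bound on the infimum with \<open>\<tau> = L\<^bsup>1/4\<^esup>\<close>, after subtracting the expected value and
  dividing by \<open>L\<close>. The first term bounds the change in the coefficient of \<open>\<kappa>\<^sup>2\<close>, the other two that
  of the one-dimensional energy; \<open>K\<close>, \<open>E\<close> and \<open>C\<close> are bounds for \<open>\<kappa>\<close>, for the minimal energy and for
  the constant in the loss of mass.
\<close>

definition trial_gap :: "real \<Rightarrow> real \<Rightarrow> real \<Rightarrow> real \<Rightarrow> real" where
  "trial_gap K E C L = K\<^sup>2 * (L powr (1/2) * (4 * pi - L powr (3/2)) / ((2 * pi - L powr (3/2))\<^sup>2 * (8 * pi)))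
     + E * \<bar>sqrt (2 * pi / (2 * pi - L powr (3/2))) / (1 - L powr (1/8) * C)\<^sup>2 - 1\<bar>
     + sqrt (2 * pi / (2 * pi - L powr (3/2))) * (L powr (1/2) / 2) / (1 - L powr (1/8) * C)\<^sup>2"

lemma trial_energy_asymptotics:
  fixes K E C \<eta> :: real
  assumes C: "C > 0" and \<eta>: "\<eta> > 0"
  shows "\<forall>\<^sub>F L in at_right 0. L powr (3/2) < 2 * pi \<and> L powr (1/8) * C < 1 \<and>
    trial_gap K E C L < \<eta>"
proof -
  have p: "((\<lambda>L::real. L powr (3/2)) \<longlongrightarrow> 0) (at_right 0)" "((\<lambda>L::real. L powr (1/2)) \<longlongrightarrow> 0) (at_right 0)"
    "((\<lambda>L::real. L powr (1/8)) \<longlongrightarrow> 0) (at_right 0)"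
    by real_asymp+
  have "((\<lambda>L. trial_gap K E C L) \<longlongrightarrow>
     K\<^sup>2 * (0 * (4 * pi - 0) / ((2 * pi - 0)\<^sup>2 * (8 * pi))) + E * \<bar>sqrt (2 * pi / (2 * pi - 0)) / (1 - 0 * C)\<^sup>2 - 1\<bar>
      + sqrt (2 * pi / (2 * pi - 0)) * (0 / 2) / (1 - 0 * C)\<^sup>2) (at_right 0)"
    unfolding trial_gap_def by (intro tendsto_intros p) auto
  from order_tendstoD(2)[OF this, of \<eta>] \<eta>
  have "\<forall>\<^sub>F L in at_right 0. trial_gap K E C L < \<eta>" by simp
  moreover have "\<forall>\<^sub>F L in at_right 0. (L::real) powr (3/2) < 2 * pi" by real_asymp
  moreover have "\<forall>\<^sub>F L in at_right 0. (L::real) powr (1/8) * C < 1" using C by real_asymp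
  ultimately show ?thesis by eventually_elim blast
qed

lemma I_inf_upper_asymptotics:
  assumes K: "K > 0" and Gl: "Gl > 0" and \<eta>: "\<eta> > 0"
  obtains \<delta> where "\<delta> > 0"
    "\<And>\<epsilon> \<kappa> G. 0 < \<epsilon> \<Longrightarrow> \<epsilon> < \<delta> \<Longrightarrow> 0 < \<kappa> \<Longrightarrow> \<kappa> \<le> K \<Longrightarrow> Gl \<le> G \<Longrightarrow> G \<le> Gu \<Longrightarrow>
       I_inf \<epsilon> \<kappa> G \<le> ennreal (\<kappa>\<^sup>2 / (8 * pi) + \<epsilon> powr (2/3) * (tf_energy G + \<eta>))"
proof -
  define T where "T = tf_radius Gu"
  define E where "E = T\<^sup>2 / 2"
  define C where "C = 1 + 2 * T\<^sup>2 / Gl"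
  have C: "C > 0" using Gl by (simp add: C_def add_pos_nonneg)
  have "filterlim (\<lambda>\<epsilon>::real. \<epsilon> powr (2/3)) (at_right 0) (at_right 0)" by real_asymp
  from eventually_compose_filterlim[OF trial_energy_asymptotics[OF C \<eta>, of K E] this]
  obtain \<delta> where \<delta>: "\<delta> > 0" and good: "\<And>\<epsilon> L. 0 < \<epsilon> \<Longrightarrow> \<epsilon> < \<delta> \<Longrightarrow> L = \<epsilon> powr (2/3) \<Longrightarrow> L powr (3/2) < 2 * pi \<and> L powr (1/8) * C < 1 \<and>
    trial_gap K E C L < \<eta>"
    unfolding eventually_at_right_field by blast
  show ?thesis
  proof (rule that[OF \<delta>])
    fix \<epsilon> \<kappa> G :: real
    assume \<epsilon>: "0 < \<epsilon>" "\<epsilon> < \<delta>" and \<kappa>: "0 < \<kappa>" "\<kappa> \<le> K" and G: "Gl \<le> G" "G \<le> Gu"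
    have G0: "G > 0" using G Gl by simp
    define L where "L = \<epsilon> powr (2/3)"
    have L: "L > 0" "L ^ 3 = \<epsilon>\<^sup>2" using \<epsilon> by (simp_all add: L_def powr_power)
    \<comment> \<open>Smoothing at the scale \<open>\<tau>\<close> is harmless when \<open>\<tau> \<rightarrow> 0\<close>, and the coefficient of \<open>\<kappa>\<^sup>2\<close> changes by a multiple
      of \<open>L\<^sup>2 / \<tau>\<^sup>2 = L\<^bsup>3/2\<^esup>\<close>, which is small compared with \<open>L\<close>.\<close>
    define \<tau> where "\<tau> = L powr (1/4)"
    have \<tau>: "\<tau> > 0" "\<tau>\<^sup>2 = L powr (1/2)" "sqrt \<tau> = L powr (1/8)" "L\<^sup>2 / \<tau>\<^sup>2 = L powr (3/2)"
    proof -
      show "\<tau> > 0" "\<tau>\<^sup>2 = L powr (1/2)" using L by (simp_all add: \<tau>_def powr_power)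
      then show "L\<^sup>2 / \<tau>\<^sup>2 = L powr (3/2)" using L powr_diff[of L 2 "1/2"] by simp
      show "sqrt \<tau> = L powr (1/8)" using L by (simp add: \<tau>_def powr_half_sqrt[symmetric] powr_powr)
    qed
    define b where "b = 2 * pi - L powr (3/2)"
    define N where "N = 1 - L powr (1/8) * C"
    define s where "s = sqrt (2 * pi / b)"
    define Y where "Y = L powr (1/2) * (4 * pi - L powr (3/2)) / ((2 * pi - L powr (3/2))\<^sup>2 * (8 * pi))"
    have gd: "b > 0" "N > 0" "K\<^sup>2 * Y + E * \<bar>s / N\<^sup>2 - 1\<bar> + s * (L powr (1/2) / 2) / N\<^sup>2 < \<eta>"
      using good[OF \<epsilon> L_def] by (auto simp: trial_gap_def b_def N_def s_def Y_def)
    have Y: "Y \<ge> 0" 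
    proof -
      have "0 \<le> 4 * pi - L powr (3/2)" using gd(1) pi_gt_zero unfolding b_def by linarith
      then show ?thesis unfolding Y_def by (intro divide_nonneg_nonneg mult_nonneg_nonneg) auto
    qed
    \<comment> \<open>With \<open>r = 2 pi / b \<ge> 1\<close> the left-hand side is \<open>(r\<^bsup>3/2\<^esup> - 1) / (8 pi) \<le> (r\<^sup>2 - 1) / (8 pi)\<close>.\<close>
    have XY: "s / (4 * b) - 1 / (8 * pi) \<le> L * Y"
    proof -
      have "sqrt r \<le> r" if "1 \<le> r" for r :: real
        using that by (intro real_le_lsqrt) (auto simp: power2_eq_square mult_le_cancel_left1)
      moreover have "1 \<le> 2 * pi / b" using gd(1) by (simp add: b_def)
      ultimately have "s \<le> 2 * pi / b" unfolding s_def by blast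
      then have "s / (4 * b) \<le> 2 * pi / b / (4 * b)" using gd(1) by (intro divide_right_mono) auto
      also have "\<dots> - 1 / (8 * pi) = (2 * pi - b) * (2 * pi + b) / (b\<^sup>2 * (8 * pi))"
        using gd(1) by (simp add: divide_simps) (simp add: power2_eq_square algebra_simps)
      also have "2 * pi - b = L * L powr (1/2)" using L powr_add[of L 1 "1/2"] by (simp add: b_def)
      also have "2 * pi + b = 4 * pi - L powr (3/2)" by (simp add: b_def)
      finally show ?thesis by (simp add: Y_def b_def[symmetric] mult.assoc)
    qed
    have s0: "s \<ge> 0" by (simp add: s_def gd(1) less_imp_le)
    have TG: "0 < tf_radius G" "tf_radius G \<le> T" using tf_radius_pos[OF G0] G Gl by (auto simp: T_def tf_radius_def)
    have T2: "(tf_radius G)\<^sup>2 \<le> T\<^sup>2" using TG by (intro power_mono) auto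
    define N0 where "N0 = 1 - sqrt \<tau> * (1 + 2 * (tf_radius G)\<^sup>2 / G)"
    have NN: "N \<le> N0"
    proof -
      have "2 * (tf_radius G)\<^sup>2 / G \<le> 2 * T\<^sup>2 / Gl" using T2 G Gl by (intro frac_le) auto
      then have "L powr (1/8) * (1 + 2 * (tf_radius G)\<^sup>2 / G) \<le> L powr (1/8) * C"
        unfolding C_def by (intro mult_left_mono) auto
      then show ?thesis by (simp add: N_def N0_def \<tau>(3))
    qed
    have N0: "N0 > 0" using NN gd(2) by simp
    have E: "0 \<le> tf_energy G" "tf_energy G \<le> E"
    proof -
      have "0 \<le> G / 2 * (LINT t|lborel. (tf_density G t)\<^sup>2)" using G0 by (simp add: Bochner_Integration.integral_nonneg)
      then show "tf_energy G \<le> E" using T2 unfolding tf_energy_def E_def by linarith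
    qed (rule tf_energy_nonneg[OF G0])
    have "I_inf \<epsilon> \<kappa> G \<le> ennreal (sqrt (2 * pi / b) * (\<kappa>\<^sup>2 / (4 * b) + L * ((tf_energy G + \<tau>\<^sup>2 / 2) / N0\<^sup>2)))"
      by (rule I_inf_upper_bound[OF \<epsilon>(1) G0 L \<tau>(1) _ gd(1) N0_def N0]) (simp add: b_def \<tau>(4))
    also have "\<dots> \<le> ennreal (\<kappa>\<^sup>2 / (8 * pi) + L * (tf_energy G + \<eta>))"
    proof (rule ennreal_leI)
      have "s * (\<kappa>\<^sup>2 / (4 * b) + L * ((tf_energy G + \<tau>\<^sup>2 / 2) / N0\<^sup>2)) \<le> s * (\<kappa>\<^sup>2 / (4 * b) + L * ((tf_energy G + \<tau>\<^sup>2 / 2) / N\<^sup>2))"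
        using NN gd(2) E L by (intro mult_left_mono add_left_mono divide_left_mono power_mono s0) (auto intro!: mult_pos_pos)
      also have "\<dots> = \<kappa>\<^sup>2 / (8 * pi) + \<kappa>\<^sup>2 * (s / (4 * b) - 1 / (8 * pi)) + L * (tf_energy G + tf_energy G * (s / N\<^sup>2 - 1) + s * (L powr (1/2) / 2) / N\<^sup>2)"
        unfolding \<tau>(2) by (simp add: algebra_simps add_divide_distrib)
      also have "\<kappa>\<^sup>2 * (s / (4 * b) - 1 / (8 * pi)) \<le> L * (K\<^sup>2 * Y)"
      proof -
        have "\<kappa>\<^sup>2 * (s / (4 * b) - 1 / (8 * pi)) \<le> \<kappa>\<^sup>2 * (L * Y)" by (intro mult_left_mono XY) simp
        also have "\<dots> \<le> K\<^sup>2 * (L * Y)" using \<kappa> L Y by (intro mult_right_mono power_mono) auto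
        finally show ?thesis by (simp add: mult_ac)
      qed
      also have "tf_energy G * (s / N\<^sup>2 - 1) \<le> E * \<bar>s / N\<^sup>2 - 1\<bar>"
        using E by (intro order_trans[OF mult_left_mono[OF abs_ge_self] mult_right_mono]) auto
      finally have "s * (\<kappa>\<^sup>2 / (4 * b) + L * ((tf_energy G + \<tau>\<^sup>2 / 2) / N0\<^sup>2)) \<le> \<kappa>\<^sup>2 / (8 * pi)
         + L * (K\<^sup>2 * Y) + L * (tf_energy G + E * \<bar>s / N\<^sup>2 - 1\<bar> + s * (L powr (1/2) / 2) / N\<^sup>2)"
        using L by simp
      also have "\<dots> = \<kappa>\<^sup>2 / (8 * pi) + L * (tf_energy G + (K\<^sup>2 * Y + E * \<bar>s / N\<^sup>2 - 1\<bar> + s * (L powr (1/2) / 2) / N\<^sup>2))"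
        by (simp only: distrib_left add.assoc add.left_commute)
      also have "\<dots> \<le> \<kappa>\<^sup>2 / (8 * pi) + L * (tf_energy G + \<eta>)"
        using gd(3) L by (intro add_left_mono mult_left_mono) auto
      finally show "sqrt (2 * pi / b) * (\<kappa>\<^sup>2 / (4 * b) + L * ((tf_energy G + \<tau>\<^sup>2 / 2) / N0\<^sup>2)) \<le> \<kappa>\<^sup>2 / (8 * pi) + L * (tf_energy G + \<eta>)"
        by (simp add: s_def)
    qed
    finally show "I_inf \<epsilon> \<kappa> G \<le> ennreal (\<kappa>\<^sup>2 / (8 * pi) + \<epsilon> powr (2/3) * (tf_energy G + \<eta>))"
      by (simp add: L_def)
  qed
qed

section \<open>The limit theorem\<close>

lemma I_inf_lower_asymptotics:
  assumes \<epsilon>: "\<epsilon> > 0" and \<kappa>: "\<kappa> > 0" and G: "G > 0"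
  shows "ennreal (\<kappa>\<^sup>2 / (8 * pi) + \<epsilon> powr (2/3) * (tf_energy G - 2 * pi\<^sup>2 * tf_radius G ^ 4 * (\<epsilon> powr (1/3) / \<kappa>)\<^sup>2)) \<le> I_inf \<epsilon> \<kappa> G"
  unfolding I_inf_def
proof (rule INF_greatest)
  fix u assume u: "u \<in> {u \<in> Lambda0. Lnorm 2 u = 1}"
  define L where "L = \<epsilon> powr (2/3)"
  have L: "L > 0" "L ^ 3 = \<epsilon>\<^sup>2" "(\<epsilon> powr (1/3))\<^sup>2 = L" using \<epsilon> by (simp_all add: L_def powr_power)
  show "ennreal (\<kappa>\<^sup>2 / (8 * pi) + \<epsilon> powr (2/3) * (tf_energy G - 2 * pi\<^sup>2 * tf_radius G ^ 4 * (\<epsilon> powr (1/3) / \<kappa>)\<^sup>2)) \<le> energy \<epsilon> \<kappa> G u"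
  proof (cases "energy \<epsilon> \<kappa> G u < \<infinity>")
    case True
    have eq: "\<epsilon> powr (2/3) * (tf_energy G - 2 * pi\<^sup>2 * tf_radius G ^ 4 * (\<epsilon> powr (1/3) / \<kappa>)\<^sup>2)
       = L * tf_energy G - 2 * pi\<^sup>2 * L\<^sup>2 * tf_radius G ^ 4 / \<kappa>\<^sup>2"
      unfolding L_def[symmetric] power_divide L(3) by (simp add: power2_eq_square algebra_simps)
    have "ennreal (\<kappa>\<^sup>2 / (8 * pi) + \<epsilon> powr (2/3) * (tf_energy G - 2 * pi\<^sup>2 * tf_radius G ^ 4 * (\<epsilon> powr (1/3) / \<kappa>)\<^sup>2))
      \<le> ennreal (\<kappa>\<^sup>2 / (8 * pi) + L * tf_energy G - 2 * pi\<^sup>2 * L\<^sup>2 * tf_radius G ^ 4 / \<kappa>\<^sup>2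
        + G / 2 * (LINT p|lborel. ((cmod (u p))\<^sup>2 - planar_profile G L p)\<^sup>2))"
      unfolding eq using G by (intro ennreal_leI) (simp add: Bochner_Integration.integral_nonneg)
    also have "\<dots> \<le> energy \<epsilon> \<kappa> G u"
      using u by (intro energy_lower_bound(2)[OF \<epsilon> \<kappa> G _ _ True L(1,2)]) auto
    finally show ?thesis .
  qed (simp add: less_top[symmetric])
qed

text \<open>
  For a minimizer the lower bound of its energy and the upper bound of the infimum leave room only
  for a small quadratic remainder.
\<close>

lemma minimizer_density_bound:
  assumes \<epsilon>: "\<epsilon> > 0" and \<kappa>: "\<kappa> > 0" and G: "G > 0" and u: "I_minimizer \<epsilon> \<kappa> G u"
    and L: "L = \<epsilon> powr (2/3)"
    and up: "I_inf \<epsilon> \<kappa> G \<le> ennreal (\<kappa>\<^sup>2 / (8 * pi) + L * (tf_energy G + \<eta>))" and \<eta>: "0 < \<eta>"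
    and err: "2 * pi\<^sup>2 * tf_radius G ^ 4 * (\<epsilon> powr (1/3) / \<kappa>)\<^sup>2 \<le> \<eta>"
  shows "integrable lborel (\<lambda>p. ((cmod (u p))\<^sup>2 - planar_profile G L p)\<^sup>2)"
    and "(LINT p|lborel. ((cmod (u p))\<^sup>2 - planar_profile G L p)\<^sup>2) \<le> 4 * L * \<eta> / G"
proof -
  have L0: "L > 0" "L ^ 3 = \<epsilon>\<^sup>2" "(\<epsilon> powr (1/3))\<^sup>2 = L" using \<epsilon> by (simp_all add: L powr_power)
  have u': "u \<in> Lambda0" "Lnorm 2 u = 1" and eu: "energy \<epsilon> \<kappa> G u = I_inf \<epsilon> \<kappa> G"
    using u by (auto simp: I_minimizer_def)
  have fin: "energy \<epsilon> \<kappa> G u < \<infinity>" unfolding eu using up by (rule le_less_trans) simp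
  note lower = energy_lower_bound[OF \<epsilon> \<kappa> G u' fin L0(1,2)]
  show "integrable lborel (\<lambda>p. ((cmod (u p))\<^sup>2 - planar_profile G L p)\<^sup>2)" by (rule lower(1))
  define D where "D = (LINT p|lborel. ((cmod (u p))\<^sup>2 - planar_profile G L p)\<^sup>2)"
  have "ennreal (\<kappa>\<^sup>2 / (8 * pi) + L * tf_energy G - 2 * pi\<^sup>2 * L\<^sup>2 * tf_radius G ^ 4 / \<kappa>\<^sup>2 + G / 2 * D)
      \<le> ennreal (\<kappa>\<^sup>2 / (8 * pi) + L * (tf_energy G + \<eta>))"
    using order_trans[OF lower(2)] up eu by (simp add: D_def)
  then have "\<kappa>\<^sup>2 / (8 * pi) + L * tf_energy G - 2 * pi\<^sup>2 * L\<^sup>2 * tf_radius G ^ 4 / \<kappa>\<^sup>2 + G / 2 * D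
      \<le> \<kappa>\<^sup>2 / (8 * pi) + L * (tf_energy G + \<eta>)"
    using tf_energy_nonneg[OF G] \<eta> L0 by (subst (asm) ennreal_le_iff) auto
  then have "G / 2 * D \<le> L * \<eta> + 2 * pi\<^sup>2 * L\<^sup>2 * tf_radius G ^ 4 / \<kappa>\<^sup>2" by (simp add: distrib_left)
  also have "2 * pi\<^sup>2 * L\<^sup>2 * tf_radius G ^ 4 / \<kappa>\<^sup>2 = L * (2 * pi\<^sup>2 * tf_radius G ^ 4 * (\<epsilon> powr (1/3) / \<kappa>)\<^sup>2)"
    unfolding power_divide L0(3) by (simp add: power2_eq_square)
  also have "\<dots> \<le> L * \<eta>" using err L0 by (intro mult_left_mono) auto
  finally have "G * D \<le> 4 * (L * \<eta>)" by simp
  then have "D \<le> 4 * L * \<eta> / G" using G by (simp add: field_simps)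
  then show "(LINT p|lborel. ((cmod (u p))\<^sup>2 - planar_profile G L p)\<^sup>2) \<le> 4 * L * \<eta> / G" by (simp add: D_def)
qed

lemma root_less_of_less_power:
  assumes "n > 0" "0 < \<eta>" "x < \<eta> ^ n"
  shows "root n x < \<eta>"
  using real_root_less_mono[OF assms(1,3)] assms(1,2) by (simp add: real_root_power_cancel)

theorem theorem1p2:
  fixes g \<omega>\<^sub>0 :: real
  assumes "0 < g" and "0 < \<omega>\<^sub>0"
  shows
    "((\<lambda>(\<omega>, \<nu>, \<epsilon>).
        (enn2ereal (I_inf \<epsilon> (kappa \<omega> \<nu> \<epsilon>) (g0 g \<omega> \<nu>)) - ereal ((kappa \<omega> \<nu> \<epsilon>)\<^sup>2 / (8 * pi)))
          / ereal (\<epsilon> powr (2/3))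
        - enn2ereal (J_inf (g0 g \<omega> \<nu>))) \<longlongrightarrow> 0) (limit_regime \<omega>\<^sub>0)
     \<and> (\<forall>(\<omega>, \<nu>, \<epsilon>) \<in> admissible \<omega>\<^sub>0. \<exists>p. J_nonneg_minimizer (g0 g \<omega> \<nu>) p \<and>
          (\<forall>q. J_nonneg_minimizer (g0 g \<omega> \<nu>) q \<longrightarrow> (AE t in lborel. q t = p t)))
     \<and> (\<forall>\<eta>>0. \<forall>\<^sub>F (\<omega>, \<nu>, \<epsilon>) in limit_regime \<omega>\<^sub>0. \<forall>u p.
          I_minimizer \<epsilon> (kappa \<omega> \<nu> \<epsilon>) (g0 g \<omega> \<nu>) u \<longrightarrow>
          J_nonneg_minimizer (g0 g \<omega> \<nu>) p \<longrightarrow>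
            profile_error \<epsilon> u p \<in> Lspace 2 \<inter> Lspace 4 \<and>
            Lnorm 2 (profile_error \<epsilon> u p) < \<eta> \<and> Lnorm 4 (profile_error \<epsilon> u p) < \<eta>)"
proof -
  obtain K Gl Gu where K: "K > 0" and Gl: "Gl > 0" and Gu: "Gu > 0"
    and par: "\<And>\<omega> \<nu> \<epsilon>. (\<omega>, \<nu>, \<epsilon>) \<in> admissible \<omega>\<^sub>0 \<Longrightarrow>
      0 < kappa \<omega> \<nu> \<epsilon> \<and> kappa \<omega> \<nu> \<epsilon> \<le> K \<and> Gl \<le> g0 g \<omega> \<nu> \<and> g0 g \<omega> \<nu> \<le> Gu"
    using parameter_bounds[OF assms] by blast
  define T where "T = tf_radius Gu"
  have T: "T > 0" using tf_radius_pos[OF Gu] by (simp add: T_def)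
  have radius: "tf_radius G \<le> T" "0 < tf_radius G" if "Gl \<le> G" "G \<le> Gu" for G
    using that Gl tf_radius_pos[of G] by (auto simp: T_def tf_radius_def)
  \<comment> \<open>One event, at tolerance \<open>\<eta>\<close>, carries both the energy limit and the convergence of
    minimizers: the upper bound on the infimum, and smallness of the loss in the lower bound.\<close>
  define good where "good \<epsilon> \<kappa> G \<eta> \<longleftrightarrow> 0 < \<epsilon> \<and> 0 < \<kappa> \<and> Gl \<le> G \<and> G \<le> Gu \<and>
      I_inf \<epsilon> \<kappa> G \<le> ennreal (\<kappa>\<^sup>2 / (8 * pi) + \<epsilon> powr (2/3) * (tf_energy G + \<eta>)) \<and>
      2 * pi\<^sup>2 * tf_radius G ^ 4 * (\<epsilon> powr (1/3) / \<kappa>)\<^sup>2 \<le> \<eta>" for \<epsilon> \<kappa> G \<eta> :: real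
  have regime: "\<exists>\<delta>>0. \<forall>\<omega> \<nu> \<epsilon>. (\<omega>, \<nu>, \<epsilon>) \<in> admissible \<omega>\<^sub>0 \<longrightarrow> \<epsilon> < \<delta> \<longrightarrow> \<epsilon> powr (1/3) / kappa \<omega> \<nu> \<epsilon> < \<delta> \<longrightarrow>
      good \<epsilon> (kappa \<omega> \<nu> \<epsilon>) (g0 g \<omega> \<nu>) \<eta>" if \<eta>: "\<eta> > 0" for \<eta>
  proof -
    obtain \<delta>1 where \<delta>1: "\<delta>1 > 0"
      and up: "\<And>\<epsilon> \<kappa> G. 0 < \<epsilon> \<Longrightarrow> \<epsilon> < \<delta>1 \<Longrightarrow> 0 < \<kappa> \<Longrightarrow> \<kappa> \<le> K \<Longrightarrow> Gl \<le> G \<Longrightarrow> G \<le> Gu \<Longrightarrow>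
       I_inf \<epsilon> \<kappa> G \<le> ennreal (\<kappa>\<^sup>2 / (8 * pi) + \<epsilon> powr (2/3) * (tf_energy G + \<eta>))"
      using I_inf_upper_asymptotics[OF K Gl \<eta>] by blast
    define \<delta>2 where "\<delta>2 = sqrt (\<eta> / (2 * pi\<^sup>2 * T ^ 4))"
    have \<delta>2: "\<delta>2 > 0" using \<eta> T by (simp add: \<delta>2_def)
    show ?thesis
      unfolding good_def
    proof (intro exI[of _ "min \<delta>1 \<delta>2"] conjI allI impI)
      show "min \<delta>1 \<delta>2 > 0" using \<delta>1 \<delta>2 by simp
      fix \<omega> \<nu> \<epsilon> assume adm: "(\<omega>, \<nu>, \<epsilon>) \<in> admissible \<omega>\<^sub>0" and e: "\<epsilon> < min \<delta>1 \<delta>2" "\<epsilon> powr (1/3) / kappa \<omega> \<nu> \<epsilon> < min \<delta>1 \<delta>2"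
      note P = par[OF adm]
      show e0: "0 < \<epsilon>" using adm by (auto simp: admissible_def)
      show "0 < kappa \<omega> \<nu> \<epsilon>" "Gl \<le> g0 g \<omega> \<nu>" "g0 g \<omega> \<nu> \<le> Gu" using P by auto
      show "I_inf \<epsilon> (kappa \<omega> \<nu> \<epsilon>) (g0 g \<omega> \<nu>) \<le> ennreal ((kappa \<omega> \<nu> \<epsilon>)\<^sup>2 / (8 * pi) + \<epsilon> powr (2/3) * (tf_energy (g0 g \<omega> \<nu>) + \<eta>))"
        using P e e0 by (intro up) auto
      have "2 * pi\<^sup>2 * tf_radius (g0 g \<omega> \<nu>) ^ 4 * (\<epsilon> powr (1/3) / kappa \<omega> \<nu> \<epsilon>)\<^sup>2 \<le> 2 * pi\<^sup>2 * T ^ 4 * \<delta>2\<^sup>2"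
        using P e e0 radius[of "g0 g \<omega> \<nu>"] T by (intro mult_mono power_mono) auto
      also have "\<dots> = \<eta>" using \<eta> T by (simp add: \<delta>2_def)
      finally show "2 * pi\<^sup>2 * tf_radius (g0 g \<omega> \<nu>) ^ 4 * (\<epsilon> powr (1/3) / kappa \<omega> \<nu> \<epsilon>)\<^sup>2 \<le> \<eta>" .
    qed
  qed
  define r where "r = (\<lambda>(\<omega>, \<nu>, \<epsilon>). (enn2real (I_inf \<epsilon> (kappa \<omega> \<nu> \<epsilon>) (g0 g \<omega> \<nu>)) - (kappa \<omega> \<nu> \<epsilon>)\<^sup>2 / (8 * pi)) / \<epsilon> powr (2/3) - tf_energy (g0 g \<omega> \<nu>))"
  have r_small: "\<forall>\<^sub>F (\<omega>, \<nu>, \<epsilon>) in limit_regime \<omega>\<^sub>0. \<bar>r (\<omega>, \<nu>, \<epsilon>)\<bar> \<le> \<eta> \<and>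
      ereal (r (\<omega>, \<nu>, \<epsilon>)) = (enn2ereal (I_inf \<epsilon> (kappa \<omega> \<nu> \<epsilon>) (g0 g \<omega> \<nu>)) - ereal ((kappa \<omega> \<nu> \<epsilon>)\<^sup>2 / (8 * pi)))
          / ereal (\<epsilon> powr (2/3)) - enn2ereal (J_inf (g0 g \<omega> \<nu>))" if \<eta>: "\<eta> > 0" for \<eta>
  proof -
    obtain \<delta> where \<delta>: "\<delta> > 0" and R: "\<And>\<omega> \<nu> \<epsilon>. (\<omega>, \<nu>, \<epsilon>) \<in> admissible \<omega>\<^sub>0 \<Longrightarrow> \<epsilon> < \<delta> \<Longrightarrow> \<epsilon> powr (1/3) / kappa \<omega> \<nu> \<epsilon> < \<delta> \<Longrightarrow>
      good \<epsilon> (kappa \<omega> \<nu> \<epsilon>) (g0 g \<omega> \<nu>) \<eta>"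
      using regime[OF \<eta>] by blast
    show ?thesis
    proof (rule eventually_limit_regimeI[OF \<delta>])
      fix \<omega> \<nu> \<epsilon>
      assume A: "(\<omega>, \<nu>, \<epsilon>) \<in> admissible \<omega>\<^sub>0" "\<epsilon> < \<delta>" "\<epsilon> powr (1/3) / kappa \<omega> \<nu> \<epsilon> < \<delta>"
      define \<kappa> G L where "\<kappa> = kappa \<omega> \<nu> \<epsilon>" and "G = g0 g \<omega> \<nu>" and "L = \<epsilon> powr (2/3)"
      have R': "0 < \<epsilon>" "0 < \<kappa>" "Gl \<le> G" "G \<le> Gu" and up: "I_inf \<epsilon> \<kappa> G \<le> ennreal (\<kappa>\<^sup>2 / (8 * pi) + L * (tf_energy G + \<eta>))"
        and err: "2 * pi\<^sup>2 * tf_radius G ^ 4 * (\<epsilon> powr (1/3) / \<kappa>)\<^sup>2 \<le> \<eta>"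
        using R[OF A] unfolding good_def \<kappa>_def[symmetric] G_def[symmetric] L_def[symmetric] by auto
      have G0: "G > 0" using R' Gl by simp
      have L: "L > 0" using R' by (simp add: L_def)
      have "I_inf \<epsilon> \<kappa> G < \<infinity>" using up by (rule le_less_trans) simp
      then obtain i where i: "I_inf \<epsilon> \<kappa> G = ennreal i" "0 \<le> i" by (cases "I_inf \<epsilon> \<kappa> G") auto
      have "ennreal i \<le> ennreal (\<kappa>\<^sup>2 / (8 * pi) + L * (tf_energy G + \<eta>))" using up i by simp
      then have iu: "i \<le> \<kappa>\<^sup>2 / (8 * pi) + L * (tf_energy G + \<eta>)"
        using tf_energy_nonneg[OF G0] \<eta> L by (subst (asm) ennreal_le_iff) auto
      have "ennreal (\<kappa>\<^sup>2 / (8 * pi) + L * (tf_energy G - 2 * pi\<^sup>2 * tf_radius G ^ 4 * (\<epsilon> powr (1/3) / \<kappa>)\<^sup>2)) \<le> ennreal i"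
        using I_inf_lower_asymptotics[OF R'(1,2) G0] i by (simp add: L_def)
      then have "\<kappa>\<^sup>2 / (8 * pi) + L * (tf_energy G - 2 * pi\<^sup>2 * tf_radius G ^ 4 * (\<epsilon> powr (1/3) / \<kappa>)\<^sup>2) \<le> i"
        using i(2) by (simp add: ennreal_le_iff)
      moreover have "L * (tf_energy G - \<eta>) \<le> L * (tf_energy G - 2 * pi\<^sup>2 * tf_radius G ^ 4 * (\<epsilon> powr (1/3) / \<kappa>)\<^sup>2)"
        using err L by (intro mult_left_mono) auto
      ultimately have il: "\<kappa>\<^sup>2 / (8 * pi) + L * (tf_energy G - \<eta>) \<le> i" by linarith
      have r: "r (\<omega>, \<nu>, \<epsilon>) = (i - \<kappa>\<^sup>2 / (8 * pi)) / L - tf_energy G"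
        unfolding r_def prod.case \<kappa>_def[symmetric] G_def[symmetric] L_def[symmetric] i(1) using i(2) by simp
      have "tf_energy G - \<eta> \<le> (i - \<kappa>\<^sup>2 / (8 * pi)) / L" "(i - \<kappa>\<^sup>2 / (8 * pi)) / L \<le> tf_energy G + \<eta>"
        unfolding pos_le_divide_eq[OF L] pos_divide_le_eq[OF L] using iu il by (simp_all only: mult.commute[of _ L])
      then have "\<bar>r (\<omega>, \<nu>, \<epsilon>)\<bar> \<le> \<eta>" unfolding r by linarith
      moreover have "ereal (r (\<omega>, \<nu>, \<epsilon>)) = (enn2ereal (I_inf \<epsilon> \<kappa> G) - ereal (\<kappa>\<^sup>2 / (8 * pi))) / ereal L - enn2ereal (J_inf G)"
        unfolding r i(1) J_inf_eq[OF G0] using i(2) tf_energy_nonneg[OF G0] L by (simp add: enn2ereal_ennreal)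
      ultimately show "\<bar>r (\<omega>, \<nu>, \<epsilon>)\<bar> \<le> \<eta> \<and>
        ereal (r (\<omega>, \<nu>, \<epsilon>)) = (enn2ereal (I_inf \<epsilon> (kappa \<omega> \<nu> \<epsilon>) (g0 g \<omega> \<nu>)) - ereal ((kappa \<omega> \<nu> \<epsilon>)\<^sup>2 / (8 * pi)))
          / ereal (\<epsilon> powr (2/3)) - enn2ereal (J_inf (g0 g \<omega> \<nu>))"
        by (simp add: \<kappa>_def G_def L_def)
    qed
  qed
  have limit: "((\<lambda>(\<omega>, \<nu>, \<epsilon>).
        (enn2ereal (I_inf \<epsilon> (kappa \<omega> \<nu> \<epsilon>) (g0 g \<omega> \<nu>)) - ereal ((kappa \<omega> \<nu> \<epsilon>)\<^sup>2 / (8 * pi)))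
          / ereal (\<epsilon> powr (2/3))
        - enn2ereal (J_inf (g0 g \<omega> \<nu>))) \<longlongrightarrow> 0) (limit_regime \<omega>\<^sub>0)"
  proof -
    have "(r \<longlongrightarrow> 0) (limit_regime \<omega>\<^sub>0)"
    proof (rule tendstoI)
      fix \<eta> :: real assume "\<eta> > 0"
      then have "\<eta> / 2 > 0" by simp
      from r_small[OF this] show "\<forall>\<^sub>F x in limit_regime \<omega>\<^sub>0. dist (r x) 0 < \<eta>"
        by eventually_elim (use \<open>\<eta> > 0\<close> in \<open>auto simp: dist_real_def\<close>)
    qed
    then have "((\<lambda>x. ereal (r x)) \<longlongrightarrow> ereal 0) (limit_regime \<omega>\<^sub>0)" by (rule tendsto_ereal)
    then have "((\<lambda>x. ereal (r x)) \<longlongrightarrow> 0) (limit_regime \<omega>\<^sub>0)" by (simp only: zero_ereal_def)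
    then show ?thesis
      by (rule Lim_transform_eventually) (rule eventually_mono[OF r_small[of 1]], auto)
  qed
  have unique: "\<forall>(\<omega>, \<nu>, \<epsilon>) \<in> admissible \<omega>\<^sub>0. \<exists>p. J_nonneg_minimizer (g0 g \<omega> \<nu>) p \<and>
          (\<forall>q. J_nonneg_minimizer (g0 g \<omega> \<nu>) q \<longrightarrow> (AE t in lborel. q t = p t))"
  proof (clarify)
    fix \<omega> \<nu> \<epsilon> assume "(\<omega>, \<nu>, \<epsilon>) \<in> admissible \<omega>\<^sub>0"
    from par[OF this] Gl have G: "g0 g \<omega> \<nu> > 0" by linarith
    show "\<exists>p. J_nonneg_minimizer (g0 g \<omega> \<nu>) p \<and> (\<forall>q. J_nonneg_minimizer (g0 g \<omega> \<nu>) q \<longrightarrow> (AE t in lborel. q t = p t))"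
      using J_nonneg_minimizer_tf_profile[OF G] J_nonneg_minimizer_unique[OF G] by blast
  qed
  have profiles: "\<forall>\<^sub>F (\<omega>, \<nu>, \<epsilon>) in limit_regime \<omega>\<^sub>0. \<forall>u p.
          I_minimizer \<epsilon> (kappa \<omega> \<nu> \<epsilon>) (g0 g \<omega> \<nu>) u \<longrightarrow>
          J_nonneg_minimizer (g0 g \<omega> \<nu>) p \<longrightarrow>
            profile_error \<epsilon> u p \<in> Lspace 2 \<inter> Lspace 4 \<and>
            Lnorm 2 (profile_error \<epsilon> u p) < \<eta> \<and> Lnorm 4 (profile_error \<epsilon> u p) < \<eta>" if \<eta>: "\<eta> > 0" for \<eta> :: real
  proof -
    define S where "S = 2 powr (1/4) * (2 * T + 1)"
    have S: "S > 0" using T by (simp add: S_def)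
    \<comment> \<open>Both contributions to the squared \<open>L\<^sup>2\<close> norm in \<open>profile_error_bounds\<close> become at most \<open>\<eta>\<^sup>2 / 4\<close>.\<close>
    define s where "s = \<eta>\<^sup>2 / (8 * S)"
    have s: "s > 0" using S \<eta> by (simp add: s_def)
    define \<eta>' where "\<eta>' = min (Gl * \<eta> ^ 4 / 8) (Gl * \<eta>\<^sup>2 * s\<^sup>2 / 32)"
    have \<eta>': "\<eta>' > 0" using Gl \<eta> s by (simp add: \<eta>'_def)
    obtain \<delta> where \<delta>: "\<delta> > 0" and R: "\<And>\<omega> \<nu> \<epsilon>. (\<omega>, \<nu>, \<epsilon>) \<in> admissible \<omega>\<^sub>0 \<Longrightarrow> \<epsilon> < \<delta> \<Longrightarrow> \<epsilon> powr (1/3) / kappa \<omega> \<nu> \<epsilon> < \<delta> \<Longrightarrow>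
      good \<epsilon> (kappa \<omega> \<nu> \<epsilon>) (g0 g \<omega> \<nu>) \<eta>'"
      using regime[OF \<eta>'] by blast
    show ?thesis
    proof (rule eventually_limit_regimeI[OF \<delta>], intro allI impI)
      fix \<omega> \<nu> \<epsilon> u p
      assume A: "(\<omega>, \<nu>, \<epsilon>) \<in> admissible \<omega>\<^sub>0" "\<epsilon> < \<delta>" "\<epsilon> powr (1/3) / kappa \<omega> \<nu> \<epsilon> < \<delta>"
        and u: "I_minimizer \<epsilon> (kappa \<omega> \<nu> \<epsilon>) (g0 g \<omega> \<nu>) u" and p: "J_nonneg_minimizer (g0 g \<omega> \<nu>) p"
      define \<kappa> G L where "\<kappa> = kappa \<omega> \<nu> \<epsilon>" and "G = g0 g \<omega> \<nu>" and "L = \<epsilon> powr (2/3)"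
      have R': "0 < \<epsilon>" "0 < \<kappa>" "Gl \<le> G" "G \<le> Gu" and up: "I_inf \<epsilon> \<kappa> G \<le> ennreal (\<kappa>\<^sup>2 / (8 * pi) + L * (tf_energy G + \<eta>'))"
        and err: "2 * pi\<^sup>2 * tf_radius G ^ 4 * (\<epsilon> powr (1/3) / \<kappa>)\<^sup>2 \<le> \<eta>'"
        using R[OF A] unfolding good_def \<kappa>_def[symmetric] G_def[symmetric] L_def[symmetric] by auto
      have G0: "G > 0" using R' Gl by simp
      have L: "L > 0" using R' by (simp add: L_def)
      have u1: "I_minimizer \<epsilon> \<kappa> G u" and u2: "u \<in> Lambda0" "Lnorm 2 u = 1" and p1: "J_nonneg_minimizer G p"
        using u p by (auto simp: \<kappa>_def G_def I_minimizer_def)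
      define D where "D = (LINT z|lborel. ((cmod (u z))\<^sup>2 - planar_profile G L z)\<^sup>2)"
      note dens = minimizer_density_bound[OF R'(1,2) G0 u1 L_def up \<eta>' err]
      have "D \<le> 4 * L * \<eta>' / G" using dens(2) by (simp add: D_def)
      then have "D / L \<le> 4 * \<eta>' / G" using L by (simp add: field_simps)
      also have "\<dots> \<le> 4 * \<eta>' / Gl" using R' Gl \<eta>' by (intro divide_left_mono) auto
      finally have DL: "D / L \<le> 4 * \<eta>' / Gl" .
      have "4 * \<eta>' / Gl \<le> 4 * (Gl * \<eta> ^ 4 / 8) / Gl" using Gl by (intro divide_right_mono) (auto simp: \<eta>'_def)
      also have "\<dots> = \<eta> ^ 4 / 2" using Gl by simp
      also have "\<dots> < \<eta> ^ 4" using \<eta> by simp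
      finally have D4: "D / L < \<eta> ^ 4" using DL by linarith
      have "4 * \<eta>' / Gl \<le> 4 * (Gl * \<eta>\<^sup>2 * s\<^sup>2 / 32) / Gl" using Gl by (intro divide_right_mono) (auto simp: \<eta>'_def)
      also have "\<dots> = \<eta>\<^sup>2 / 8 * s\<^sup>2" using Gl by simp
      finally have "D / L \<le> \<eta>\<^sup>2 / 8 * s\<^sup>2" using DL by linarith
      moreover have "0 < s\<^sup>2" using s by simp
      ultimately have "D / L / s\<^sup>2 \<le> \<eta>\<^sup>2 / 8" by (simp only: pos_divide_le_eq)
      moreover have "s * (2 powr (1/4) * (2 * tf_radius G + 1)) \<le> \<eta>\<^sup>2 / 8"
      proof -
        have "s * (2 powr (1/4) * (2 * tf_radius G + 1)) \<le> s * S"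
        unfolding S_def using s radius(1)[OF R'(3,4)] by (intro mult_left_mono) auto
        also have "s * S = \<eta>\<^sup>2 / 8" using S by (simp add: s_def)
        finally show ?thesis .
      qed
      moreover have "\<eta>\<^sup>2 > 0" using \<eta> by simp
      moreover have "2 * (a + d) < e" if "d \<le> e / 8" "a \<le> e / 8" "0 < e" for a d e :: real
        using that by (simp add: distrib_left)
      ultimately have D2: "2 * (s * (2 powr (1/4) * (2 * tf_radius G + 1)) + D / L / s\<^sup>2) < \<eta>\<^sup>2" by blast
      note bounds = profile_error_bounds[OF R'(1) G0 L_def u2 dens(1) D_def[symmetric] p1 s]
      have "Lnorm 2 (profile_error \<epsilon> u p) < \<eta>"
        unfolding Lnorm_def by (rule root_less_of_less_power[OF _ \<eta>]) (use bounds(3) D2 in auto)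
      moreover have "Lnorm 4 (profile_error \<epsilon> u p) < \<eta>"
        unfolding Lnorm_def by (rule root_less_of_less_power[OF _ \<eta>]) (use bounds(2) D4 in auto)
      ultimately show "profile_error \<epsilon> u p \<in> Lspace 2 \<inter> Lspace 4 \<and>
            Lnorm 2 (profile_error \<epsilon> u p) < \<eta> \<and> Lnorm 4 (profile_error \<epsilon> u p) < \<eta>"
        using bounds(1) by blast
    qed
  qed
  show ?thesis using limit unique profiles by blast
qed

end
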